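(* Let $p \geq 1$ be a real number, let $E$ be a $\sigma$-Dedekind complete Banach lattice and let $k$ be a positive integer. The following statements are equivalent. (a) $E$ has the disjoint Dunford-Pettis* property of order $p$ (disjoint $DP^\ast P_p$). (b) For any Banach lattice $F$ such that the closed unit ball $B_{F^\ast}$ of $F^\ast$ is sequentially weak* compact, every positive $k$-homogeneous polynomial $P \colon E \to F$ is disjoint $p$-convergent. (c) Every positive $k$-homogeneous polynomial $P \colon E \to c_0$ is disjoint $p$-convergent. (d) Every regular $k$-homogeneous polynomial $P \colon E \to c_0$ is disjoint $p$-convergent. (e) For every disjoint weakly $p$-summable sequence $(x_n)_n$ in $E$ and every weak* null sequence $(P_n)_n$ in $\mathcal{P}^r(^k E)$, it holds $P_n(x_n) \longrightarrow 0$. (f) For every disjoint weakly $p$-summable sequence $(x_n)_n$ in $E$ and every disjoint weak* null sequence $(P_n)_n$ in $\mathcal{P}^r(^k E)$, it holds $P_n(x_n) \longrightarrow 0$. (g) For every disjoint weakly $p$-summable sequence $(x_n)_n$ in $E$ and every positive disjoint weak* null sequence $(P_n)_n$ in $\mathcal{P}^r(^k E)$, it holds $P_n(x_n) \longrightarrow 0$. (h) For every disjoint weakly $p$-summable sequence $(x_n)_n$ in $E$ and every positive weak* null sequence $(P_n)_n$ in $\mathcal{P}^r(^k E)$, it holds $P_n(x_n) \longrightarrow 0$.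
   Context: A sequence $(x_n)_n$ in a Banach lattice is disjoint if $|x_n| \wedge |x_m| = 0$ whenever $n \neq m$, and positive if $x_n \geq 0$ for every $n$. A sequence $(x_n)_n$ in a Banach space $X$ is weakly $p$-summable if $\sum_n |x^\ast(x_n)|^p < \infty$ for every $x^\ast \in X^\ast$. A subset $A$ of a Banach space $X$ is limited if every weak* null sequence in $X^\ast$ converges uniformly to zero on $A$. A Banach lattice $E$ has the disjoint $DP^\ast P_p$ if, for every disjoint weakly $p$-summable sequence $(x_n)_n$ in $E$, the set $\{x_n : n \in \mathbb{N}\}$ is limited. A (linear or nonlinear) map from a Banach lattice to a Banach space is disjoint $p$-convergent if it sends disjoint weakly $p$-summable sequences to norm null sequences. A $k$-homogeneous polynomial $P \colon E \to F$ between Banach lattices, with associated symmetric $k$-linear operator $T_P \colon E^k \to F$ (so $P(x) = T_P(x, \ldots, x)$), is positive if $T_P(x_1, \ldots, x_k) \geq 0$ for all $x_1, \ldots, x_k \in E^+$. The difference of two positive $k$-homogeneous polynomials is called regular; $\mathcal{P}^r(^k E, F)$ is the set of all regular $k$-homogeneous polynomials from $E$ to $F$, ordered by $P \leq Q$ if $Q - P$ is positive, and $\mathcal{P}^r(^k E)$ denotes the case where $F$ is the scalar field. $\mathcal{P}^r(^k E)$ is a Banach lattice with the regular norm $\|P\|_r = \| |P| \|$, where $|P|$ is the absolute value of $P$; positive and disjoint sequences in $\mathcal{P}^r(^k E)$ refer to this structure. $\widehat{\otimes}_{s,|\pi|}^k E$ denotes the $k$-fold positive projective symmetric tensor product of $E$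 (the symmetric Fremlin tensor product), a Banach lattice with the positive projective symmetric tensor norm, and $\otimes^k x = x \otimes \cdots \otimes x$ ($k$ factors). For every $P \in \mathcal{P}^r(^k E)$ there is a unique regular linear functional $P^\otimes$ on $\widehat{\otimes}_{s,|\pi|}^k E$, called the linearization of $P$, such that $P(x) = P^\otimes(\otimes^k x)$ for every $x \in E$; the correspondence $P \mapsto P^\otimes$ is an isometric isomorphism and a lattice homomorphism from $\mathcal{P}^r(^k E)$ onto $\left(\widehat{\otimes}_{s,|\pi|}^k E\right)^\ast$. A sequence $(P_n)_n$ in $\mathcal{P}^r(^k E)$ is weak* null if $(P_n^\otimes)_n$ is weak* null in $\left(\widehat{\otimes}_{s,|\pi|}^k E\right)^\ast$. *)

theory Defs
  imports "HOL-Analysis.Analysis" "HOL-Library.Lattice_Algebras" "HOL-Library.Equipollence"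
begin

section \<open>Banach lattices\<close>

text \<open>The modulus is the library's \<open>\<bar>x\<bar> = sup x (- x)\<close> (class \<open>lattice_ab_group_add_abs\<close>).\<close>

class banach_lattice = banach + ordered_real_vector + lattice_ab_group_add_abs +
  assumes norm_lattice: "\<bar>x\<bar> \<le> \<bar>y\<bar> \<Longrightarrow> norm x \<le> norm y"

instance real :: banach_lattice
  by standard auto

definition sigma_Dedekind_complete :: "'a::order itself \<Rightarrow> bool" where
  "sigma_Dedekind_complete _ \<longleftrightarrow>
     (\<forall>A::'a set. A \<noteq> {} \<and> countable A \<and> bdd_above A \<longrightarrow>
        (\<exists>s. (\<forall>a\<in>A. a \<le> s) \<and> (\<forall>u. (\<forall>a\<in>A. a \<le> u) \<longrightarrow> s \<le> u)))"

definition disjoint_sequence :: "(nat \<Rightarrow> 'a::banach_lattice) \<Rightarrow> bool" where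
  "disjoint_sequence x \<longleftrightarrow> (\<forall>n m. n \<noteq> m \<longrightarrow> inf \<bar>x n\<bar> \<bar>x m\<bar> = 0)"

definition weakly_summable :: "real \<Rightarrow> (nat \<Rightarrow> 'a::real_normed_vector) \<Rightarrow> bool" where
  "weakly_summable p x \<longleftrightarrow>
     (\<forall>f::'a \<Rightarrow> real. bounded_linear f \<longrightarrow> summable (\<lambda>n. \<bar>f (x n)\<bar> powr p))"

definition limited_set :: "'a::real_normed_vector set \<Rightarrow> bool" where
  "limited_set A \<longleftrightarrow>
     (\<forall>f::nat \<Rightarrow> 'a \<Rightarrow> real.
        (\<forall>n. bounded_linear (f n)) \<and> (\<forall>x. (\<lambda>n. f n x) \<longlonglongrightarrow> 0) \<longrightarrow>
        uniform_limit A f (\<lambda>_. 0) sequentially)"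

definition disjoint_DP_star :: "'a::banach_lattice itself \<Rightarrow> real \<Rightarrow> bool" where
  "disjoint_DP_star _ p \<longleftrightarrow>
     (\<forall>x::nat \<Rightarrow> 'a. disjoint_sequence x \<and> weakly_summable p x \<longrightarrow> limited_set (range x))"


section \<open>Ordered vector spaces and Banach lattices on a carrier\<close>

text \<open>
  Quantification over all Banach lattices inside a formula, spaces of polynomials, duals and tensor
  products do not live on a whole type, so these are records with a carrier.  The domain \<open>E\<close> of the
  polynomials is a type of class \<open>banach_lattice\<close>.  ``All Banach lattices'' means all \<open>'u normed_lattice\<close>
  with \<open>banach_lattice_on\<close>, for an arbitrary universe type \<open>'u\<close> at least as large as \<open>c\<^sub>0\<close>.
\<close>

record 'b ordered_space =
  car :: "'b set"
  vadd :: "'b \<Rightarrow> 'b \<Rightarrow> 'b"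
  vzero :: 'b
  vscale :: "real \<Rightarrow> 'b \<Rightarrow> 'b"
  vle :: "'b \<Rightarrow> 'b \<Rightarrow> bool"

record 'b normed_lattice = "'b ordered_space" +
  vnorm :: "'b \<Rightarrow> real"

definition vminus :: "('b, 'm) ordered_space_scheme \<Rightarrow> 'b \<Rightarrow> 'b \<Rightarrow> 'b" where
  "vminus V x y = vadd V x (vscale V (- 1) y)"

definition is_sup :: "('b, 'm) ordered_space_scheme \<Rightarrow> 'b \<Rightarrow> 'b \<Rightarrow> 'b \<Rightarrow> bool" where
  "is_sup V x y s \<longleftrightarrow> s \<in> car V \<and> vle V x s \<and> vle V y s \<and>
     (\<forall>u\<in>car V. vle V x u \<and> vle V y u \<longrightarrow> vle V s u)"

definition is_inf :: "('b, 'm) ordered_space_scheme \<Rightarrow> 'b \<Rightarrow> 'b \<Rightarrow> 'b \<Rightarrow> bool" where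
  "is_inf V x y s \<longleftrightarrow> s \<in> car V \<and> vle V s x \<and> vle V s y \<and>
     (\<forall>u\<in>car V. vle V u x \<and> vle V u y \<longrightarrow> vle V u s)"

definition is_modulus :: "('b, 'm) ordered_space_scheme \<Rightarrow> 'b \<Rightarrow> 'b \<Rightarrow> bool" where
  "is_modulus V x a \<longleftrightarrow> is_sup V x (vscale V (- 1) x) a"

locale banach_lattice_on =
  fixes F :: "'b normed_lattice"
  assumes zero_closed: "vzero F \<in> car F"
    and add_closed: "\<lbrakk>x \<in> car F; y \<in> car F\<rbrakk> \<Longrightarrow> vadd F x y \<in> car F"
    and scale_closed: "x \<in> car F \<Longrightarrow> vscale F a x \<in> car F"
    and add_assoc: "\<lbrakk>x \<in> car F; y \<in> car F; z \<in> car F\<rbrakk> \<Longrightarrow> vadd F (vadd F x y) z = vadd F x (vadd F y z)"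
    and add_commute: "\<lbrakk>x \<in> car F; y \<in> car F\<rbrakk> \<Longrightarrow> vadd F x y = vadd F y x"
    and add_zero: "x \<in> car F \<Longrightarrow> vadd F x (vzero F) = x"
    and add_inverse: "x \<in> car F \<Longrightarrow> vadd F x (vscale F (- 1) x) = vzero F"
    and scale_right_distrib: "\<lbrakk>x \<in> car F; y \<in> car F\<rbrakk> \<Longrightarrow> vscale F a (vadd F x y) = vadd F (vscale F a x) (vscale F a y)"
    and scale_left_distrib: "x \<in> car F \<Longrightarrow> vscale F (a + b) x = vadd F (vscale F a x) (vscale F b x)"
    and scale_scale: "x \<in> car F \<Longrightarrow> vscale F a (vscale F b x) = vscale F (a * b) x"
    and scale_one: "x \<in> car F \<Longrightarrow> vscale F 1 x = x"
    and le_refl: "x \<in> car F \<Longrightarrow> vle F x x"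
    and le_trans: "\<lbrakk>x \<in> car F; y \<in> car F; z \<in> car F; vle F x y; vle F y z\<rbrakk> \<Longrightarrow> vle F x z"
    and le_antisym: "\<lbrakk>x \<in> car F; y \<in> car F; vle F x y; vle F y x\<rbrakk> \<Longrightarrow> x = y"
    and add_mono: "\<lbrakk>x \<in> car F; y \<in> car F; z \<in> car F; vle F x y\<rbrakk> \<Longrightarrow> vle F (vadd F x z) (vadd F y z)"
    and scale_mono: "\<lbrakk>x \<in> car F; y \<in> car F; vle F x y; 0 \<le> a\<rbrakk> \<Longrightarrow> vle F (vscale F a x) (vscale F a y)"
    and sup_exists: "\<lbrakk>x \<in> car F; y \<in> car F\<rbrakk> \<Longrightarrow> \<exists>s. is_sup F x y s"
    and inf_exists: "\<lbrakk>x \<in> car F; y \<in> car F\<rbrakk> \<Longrightarrow> \<exists>s. is_inf F x y s"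
    and norm_eq_zero: "x \<in> car F \<Longrightarrow> vnorm F x = 0 \<longleftrightarrow> x = vzero F"
    and norm_triangle: "\<lbrakk>x \<in> car F; y \<in> car F\<rbrakk> \<Longrightarrow> vnorm F (vadd F x y) \<le> vnorm F x + vnorm F y"
    and norm_scale: "x \<in> car F \<Longrightarrow> vnorm F (vscale F a x) = \<bar>a\<bar> * vnorm F x"
    and norm_mono: "\<lbrakk>x \<in> car F; y \<in> car F; is_modulus F x s; is_modulus F y t; vle F s t\<rbrakk> \<Longrightarrow> vnorm F x \<le> vnorm F y"
    and complete: "\<lbrakk>\<And>n. X n \<in> car F; \<And>e. 0 < e \<Longrightarrow> \<exists>N::nat. \<forall>m\<ge>N. \<forall>n\<ge>N. vnorm F (vminus F (X m) (X n)) < e\<rbrakk>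
      \<Longrightarrow> \<exists>l\<in>car F. (\<lambda>n. vnorm F (vminus F (X n) l)) \<longlonglongrightarrow> 0"

definition type_lattice :: "'b::banach_lattice normed_lattice" where
  "type_lattice = \<lparr>car = UNIV, vadd = (+), vzero = 0, vscale = scaleR, vle = (\<le>), vnorm = norm\<rparr>"

lemma banach_lattice_on_type_lattice: "banach_lattice_on (type_lattice :: 'b::banach_lattice normed_lattice)"
proof
  fix X :: "nat \<Rightarrow> 'b"
  assume "\<And>e. 0 < e \<Longrightarrow> \<exists>N::nat. \<forall>m\<ge>N. \<forall>n\<ge>N. vnorm type_lattice (vminus type_lattice (X m) (X n)) < e"
  then have "Cauchy X"
    by (simp add: Cauchy_def dist_norm type_lattice_def vminus_def)
  then obtain l where "X \<longlonglongrightarrow> l" using Cauchy_convergent convergent_def by blast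
  then show "\<exists>l\<in>car type_lattice. (\<lambda>n. vnorm type_lattice (vminus type_lattice (X n) l)) \<longlonglongrightarrow> 0"
    by (auto simp: type_lattice_def vminus_def tendsto_norm_zero_iff LIM_zero_iff)
next
  fix x y s t :: 'b
  assume "is_modulus type_lattice x s" "is_modulus type_lattice y t" "vle type_lattice s t"
  moreover have "z = \<bar>w\<bar>" if "is_modulus type_lattice w z" for w z :: 'b
    using that unfolding is_modulus_def is_sup_def type_lattice_def
    by (auto simp: abs_lattice intro!: order.antisym)
  ultimately show "vnorm type_lattice x \<le> vnorm type_lattice y"
    by (auto simp: type_lattice_def intro!: norm_lattice)
next
  fix x y :: 'b
  show "\<exists>s. is_sup type_lattice x y s"
    by (rule exI[of _ "sup x y"]) (simp add: is_sup_def type_lattice_def)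
  show "\<exists>s. is_inf type_lattice x y s"
    by (rule exI[of _ "inf x y"]) (simp add: is_inf_def type_lattice_def)
qed (auto simp: type_lattice_def scaleR_add_right scaleR_add_left norm_triangle_ineq scaleR_left_mono)

abbreviation scalars :: "real normed_lattice" where
  "scalars \<equiv> type_lattice"

definition c0 :: "(nat \<Rightarrow> real) normed_lattice" where
  "c0 = \<lparr>car = {x. x \<longlonglongrightarrow> 0}, vadd = (\<lambda>x y n. x n + y n), vzero = (\<lambda>_. 0),
         vscale = (\<lambda>a x n. a * x n), vle = (\<lambda>x y. \<forall>n. x n \<le> y n),
         vnorm = (\<lambda>x. SUP n. \<bar>x n\<bar>)\<rparr>"

lemma c0_bdd: "x \<longlonglongrightarrow> 0 \<Longrightarrow> bdd_above (range (\<lambda>n. \<bar>x n :: real\<bar>))"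
  using Bseq_eq_bounded convergentI convergent_imp_Bseq
  by (metis Bseq_def bdd_above.I2 real_norm_def)

lemma banach_lattice_on_c0: "banach_lattice_on c0"
proof
  have mod: "s = (\<lambda>n. \<bar>x n\<bar>)" if x: "x \<in> car c0" and m: "is_modulus c0 x s" for x s
  proof -
    have "(\<lambda>n. \<bar>x n\<bar>) \<longlonglongrightarrow> 0" using x by (simp add: c0_def tendsto_rabs_zero)
    then have "\<forall>n. s n \<le> \<bar>x n\<bar>" using m by (auto simp: is_modulus_def is_sup_def c0_def)
    moreover have "\<forall>n. \<bar>x n\<bar> \<le> s n" using m by (auto simp: is_modulus_def is_sup_def c0_def abs_le_iff)
    ultimately show ?thesis by (auto intro: order.antisym)
  qed
  {
    fix x y s t assume *: "x \<in> car c0" "y \<in> car c0" "is_modulus c0 x s" "is_modulus c0 y t" "vle c0 s t"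
    have "\<bar>x n\<bar> \<le> \<bar>y n\<bar>" for n using * mod[OF *(1,3)] mod[OF *(2,4)] by (simp add: c0_def)
    then show "vnorm c0 x \<le> vnorm c0 y" using *(2)
      by (auto simp: c0_def intro!: cSUP_mono c0_bdd)
  next
    fix x y assume *: "x \<in> car c0" "y \<in> car c0"
    show "\<exists>s. is_sup c0 x y s"
      using * tendsto_max[of x 0 _ y 0] by (intro exI[of _ "\<lambda>n. max (x n) (y n)"]) (auto simp: is_sup_def c0_def)
    show "\<exists>s. is_inf c0 x y s"
      using * tendsto_min[of x 0 _ y 0] by (intro exI[of _ "\<lambda>n. min (x n) (y n)"]) (auto simp: is_inf_def c0_def)
    have "\<bar>x n + y n\<bar> \<le> (SUP n. \<bar>x n\<bar>) + (SUP n. \<bar>y n\<bar>)" for n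
    proof -
      have "\<bar>x n\<bar> \<le> (SUP n. \<bar>x n\<bar>)" "\<bar>y n\<bar> \<le> (SUP n. \<bar>y n\<bar>)"
        using * by (auto simp: c0_def intro!: cSUP_upper c0_bdd)
      then show ?thesis by linarith
    qed
    then show "vnorm c0 (vadd c0 x y) \<le> vnorm c0 x + vnorm c0 y"
      by (auto simp: c0_def intro!: cSUP_least)
  next
    fix x assume *: "x \<in> car c0"
    then have b: "bdd_above (range (\<lambda>n. \<bar>x n\<bar>))" by (simp add: c0_def c0_bdd)
    show "vnorm c0 x = 0 \<longleftrightarrow> x = vzero c0"
    proof
      assume "vnorm c0 x = 0"
      then have "\<bar>x n\<bar> \<le> 0" for n using cSUP_upper[OF _ b, of n] by (simp add: c0_def)
      then show "x = vzero c0" by (auto simp: c0_def)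
    qed (simp add: c0_def)
    fix a
    have n: "0 \<le> (SUP n. \<bar>x n\<bar>)" using cSUP_upper[OF UNIV_I b, of 0] by linarith
    have 1: "(SUP n. \<bar>a * x n\<bar>) \<le> \<bar>a\<bar> * (SUP n. \<bar>x n\<bar>)"
      by (intro cSUP_least) (auto simp: abs_mult intro!: mult_left_mono cSUP_upper b)
    have b2: "bdd_above (range (\<lambda>n. \<bar>a * x n\<bar>))"
      using * by (intro c0_bdd) (auto simp: c0_def intro: tendsto_mult_right_zero)
    have 2: "\<bar>a\<bar> * (SUP n. \<bar>x n\<bar>) \<le> (SUP n. \<bar>a * x n\<bar>)" if "a \<noteq> 0"
    proof -
      have "(SUP n. \<bar>x n\<bar>) \<le> (SUP n. \<bar>a * x n\<bar>) / \<bar>a\<bar>"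
        using that cSUP_upper[OF UNIV_I b2]
        by (intro cSUP_least) (auto simp: pos_le_divide_eq abs_mult mult.commute)
      then show ?thesis using that by (simp add: pos_le_divide_eq mult.commute)
    qed
    show "vnorm c0 (vscale c0 a x) = \<bar>a\<bar> * vnorm c0 x"
      using 1 2 by (cases "a = 0") (auto simp: c0_def)
  next
    fix X assume X: "\<And>n. X n \<in> car c0"
      and C: "\<And>e. 0 < e \<Longrightarrow> \<exists>N::nat. \<forall>m\<ge>N. \<forall>n\<ge>N. vnorm c0 (vminus c0 (X m) (X n)) < e"
    have bd: "bdd_above (range (\<lambda>i. \<bar>X m i - X n i\<bar>))" for m n
      using X[of m] X[of n] tendsto_diff[of "X m" 0 _ "X n" 0] by (intro c0_bdd) (auto simp: c0_def)
    have C': "\<exists>N. \<forall>m\<ge>N. \<forall>n\<ge>N. \<forall>i. \<bar>X m i - X n i\<bar> < e" if epos: "0 < e" for e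
    proof -
      obtain N where N: "\<forall>m\<ge>N. \<forall>n\<ge>N. (SUP i. \<bar>X m i - X n i\<bar>) < e"
        using C[OF epos] by (auto simp: c0_def vminus_def)
      have "\<bar>X m i - X n i\<bar> < e" if "m \<ge> N" "n \<ge> N" for m n i
        using N that cSUP_upper[OF UNIV_I bd[of m n], of i] le_less_trans by blast
      then show ?thesis by blast
    qed
    have "uniformly_Cauchy_on UNIV X"
      unfolding uniformly_Cauchy_on_def dist_real_def using C' by blast
    then obtain l where l: "uniform_limit UNIV X l sequentially"
      using Cauchy_uniformly_convergent uniformly_convergent_on_def by blast
    have "l \<longlonglongrightarrow> 0"
    proof -
      have "(\<lambda>_::nat. 0::real) \<longlonglongrightarrow> 0" by simp
      moreover have "\<forall>\<^sub>F n in sequentially. (X n \<longlongrightarrow> 0) sequentially" using X by (simp add: c0_def)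
      ultimately show ?thesis
        using swap_uniform_limit'[OF _ _ l, of "\<lambda>_. 0" sequentially 0] by simp
    qed
    moreover have "(\<lambda>n. SUP i. \<bar>X n i - l i\<bar>) \<longlonglongrightarrow> 0"
    proof (rule LIMSEQ_I)
      fix r :: real assume "0 < r"
      then have "\<forall>\<^sub>F n in sequentially. \<forall>i\<in>UNIV. dist (X n i) (l i) < r/2"
        using uniform_limitD[OF l, of "r/2"] by simp
      then obtain N where N: "\<And>n i. n \<ge> N \<Longrightarrow> \<bar>X n i - l i\<bar> < r/2"
        by (auto simp: eventually_sequentially dist_real_def)
      have "norm ((SUP i. \<bar>X n i - l i\<bar>) - 0) < r" if "n \<ge> N" for n
      proof -
        have b: "bdd_above (range (\<lambda>i. \<bar>X n i - l i\<bar>))"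
          using N[OF that] by (intro bdd_aboveI2[of _ _ "r/2"]) (rule less_imp_le)
        have "0 \<le> (SUP i. \<bar>X n i - l i\<bar>)" using cSUP_upper[OF UNIV_I b, of 0] by linarith
        moreover have "(SUP i. \<bar>X n i - l i\<bar>) \<le> r/2"
          using N[OF that] by (intro cSUP_least) (auto intro: less_imp_le)
        ultimately show ?thesis using \<open>0<r\<close> by simp
      qed
      then show "\<exists>N. \<forall>n\<ge>N. norm ((SUP i. \<bar>X n i - l i\<bar>) - 0) < r" by blast
    qed
    ultimately show "\<exists>l\<in>car c0. (\<lambda>n. vnorm c0 (vminus c0 (X n) l)) \<longlonglongrightarrow> 0"
      by (intro bexI[of _ l]) (auto simp: c0_def vminus_def)
  }
next
  show "\<And>x y z. \<lbrakk>x \<in> car c0; y \<in> car c0; z \<in> car c0; vle c0 x y; vle c0 y z\<rbrakk> \<Longrightarrow> vle c0 x z"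
    by (simp add: c0_def) (meson order_trans)
next
  show "\<And>x y. \<lbrakk>x \<in> car c0; y \<in> car c0; vle c0 x y; vle c0 y x\<rbrakk> \<Longrightarrow> x = y"
    by (simp add: c0_def fun_eq_iff) (meson order.antisym)
qed (auto simp: c0_def algebra_simps tendsto_add_zero tendsto_mult_right_zero mult_left_mono)

text \<open>
  Functionals are total functions whose values outside the carrier are irrelevant.
\<close>

definition linear_functional :: "('b, 'm) ordered_space_scheme \<Rightarrow> ('b \<Rightarrow> real) \<Rightarrow> bool" where
  "linear_functional V f \<longleftrightarrow>
     (\<forall>x\<in>car V. \<forall>y\<in>car V. f (vadd V x y) = f x + f y) \<and>
     (\<forall>x\<in>car V. \<forall>a. f (vscale V a x) = a * f x)"

definition dual :: "('b, 'm) normed_lattice_scheme \<Rightarrow> ('b \<Rightarrow> real) set" where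
  "dual F = {f. linear_functional F f \<and> (\<exists>C. \<forall>y\<in>car F. \<bar>f y\<bar> \<le> C * vnorm F y)}"

definition dual_ball :: "('b, 'm) normed_lattice_scheme \<Rightarrow> ('b \<Rightarrow> real) set" where
  "dual_ball F = {f \<in> dual F. \<forall>y\<in>car F. \<bar>f y\<bar> \<le> vnorm F y}"

definition weak_star_null :: "('b, 'm) normed_lattice_scheme \<Rightarrow> (nat \<Rightarrow> 'b \<Rightarrow> real) \<Rightarrow> bool" where
  "weak_star_null F f \<longleftrightarrow> (\<forall>n. f n \<in> dual F) \<and> (\<forall>y\<in>car F. (\<lambda>n. f n y) \<longlonglongrightarrow> 0)"

definition dual_ball_seq_weak_star_compact :: "('b, 'm) normed_lattice_scheme \<Rightarrow> bool" where
  "dual_ball_seq_weak_star_compact F \<longleftrightarrow>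
     (\<forall>f::nat \<Rightarrow> 'b \<Rightarrow> real. (\<forall>n. f n \<in> dual_ball F) \<longrightarrow>
        (\<exists>g\<in>dual_ball F. \<exists>r::nat \<Rightarrow> nat. strict_mono r \<and>
           (\<forall>y\<in>car F. (\<lambda>n. f (r n) y) \<longlonglongrightarrow> g y)))"

definition positive_seq :: "('b, 'm) ordered_space_scheme \<Rightarrow> (nat \<Rightarrow> 'b) \<Rightarrow> bool" where
  "positive_seq V x \<longleftrightarrow> (\<forall>n. vle V (vzero V) (x n))"

definition disjoint_seq :: "('b, 'm) ordered_space_scheme \<Rightarrow> (nat \<Rightarrow> 'b) \<Rightarrow> bool" where
  "disjoint_seq V x \<longleftrightarrow>
     (\<forall>n m. n \<noteq> m \<longrightarrow> (\<exists>a b. is_modulus V (x n) a \<and> is_modulus V (x m) b \<and> is_inf V a b (vzero V)))"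


section \<open>Homogeneous polynomials\<close>

text \<open>
  Elements of \<open>E\<^sup>k\<close> are functions \<open>nat \<Rightarrow> 'a\<close> of which only the arguments \<open>i < k\<close> matter.
\<close>

definition multilinear_op ::
  "nat \<Rightarrow> ('b, 'm) ordered_space_scheme \<Rightarrow> ((nat \<Rightarrow> 'a::real_vector) \<Rightarrow> 'b) \<Rightarrow> bool" where
  "multilinear_op k F T \<longleftrightarrow>
     (\<forall>x. T x \<in> car F) \<and>
     (\<forall>x y. (\<forall>i<k. x i = y i) \<longrightarrow> T x = T y) \<and>
     (\<forall>x a b. \<forall>i<k. T (x(i := a + b)) = vadd F (T (x(i := a))) (T (x(i := b)))) \<and>
     (\<forall>x a r. \<forall>i<k. T (x(i := r *\<^sub>R a)) = vscale F r (T (x(i := a))))"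

definition symmetric_op :: "nat \<Rightarrow> ((nat \<Rightarrow> 'a) \<Rightarrow> 'b) \<Rightarrow> bool" where
  "symmetric_op k T \<longleftrightarrow> (\<forall>\<sigma> x. \<sigma> permutes {..<k} \<longrightarrow> T (x \<circ> \<sigma>) = T x)"

text \<open>
  \<open>associated_op k F P T\<close>: \<open>P\<close> is a \<open>k\<close>-homogeneous polynomial and \<open>T\<close> is its (unique, by
  polarization) associated symmetric \<open>k\<close>-linear operator.  No continuity is required: positive, hence
  regular, polynomials between Banach lattices are automatically continuous.
\<close>

definition associated_op ::
  "nat \<Rightarrow> ('b, 'm) ordered_space_scheme \<Rightarrow> ('a::real_vector \<Rightarrow> 'b) \<Rightarrow> ((nat \<Rightarrow> 'a) \<Rightarrow> 'b) \<Rightarrow> bool" where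
  "associated_op k F P T \<longleftrightarrow>
     multilinear_op k F T \<and> symmetric_op k T \<and> (\<forall>x. P x = T (\<lambda>_. x))"

definition positive_poly ::
  "nat \<Rightarrow> ('b, 'm) ordered_space_scheme \<Rightarrow> ('a::banach_lattice \<Rightarrow> 'b) \<Rightarrow> bool" where
  "positive_poly k F P \<longleftrightarrow>
     (\<exists>T. associated_op k F P T \<and> (\<forall>x. (\<forall>i<k. 0 \<le> x i) \<longrightarrow> vle F (vzero F) (T x)))"

definition regular_poly ::
  "nat \<Rightarrow> ('b, 'm) ordered_space_scheme \<Rightarrow> ('a::banach_lattice \<Rightarrow> 'b) \<Rightarrow> bool" where
  "regular_poly k F P \<longleftrightarrow>
     (\<exists>Q R. positive_poly k F Q \<and> positive_poly k F R \<and> (\<forall>x. P x = vminus F (Q x) (R x)))"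

definition disjoint_convergent ::
  "real \<Rightarrow> ('b, 'm) normed_lattice_scheme \<Rightarrow> ('a::banach_lattice \<Rightarrow> 'b) \<Rightarrow> bool" where
  "disjoint_convergent p F P \<longleftrightarrow>
     (\<forall>x. disjoint_sequence x \<and> weakly_summable p x \<longrightarrow> (\<lambda>n. vnorm F (P (x n))) \<longlonglongrightarrow> 0)"

definition regular_polys :: "nat \<Rightarrow> ('a::banach_lattice \<Rightarrow> real) ordered_space" where
  "regular_polys k = \<lparr>car = {P. regular_poly k scalars P},
     vadd = (\<lambda>P Q x. P x + Q x), vzero = (\<lambda>_. 0), vscale = (\<lambda>a P x. a * P x),
     vle = (\<lambda>P Q. positive_poly k scalars (\<lambda>x. Q x - P x))\<rparr>"


section \<open>The positive projective symmetric tensor product\<close>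

text \<open>
  As usual for tensor products, a symmetric tensor is realised as a functional on the space of
  polynomials: \<open>x \<otimes> \<dots> \<otimes> x\<close> is the evaluation \<open>P \<mapsto> P x\<close> on the regular \<open>k\<close>-homogeneous forms.
  The order is the one of the order dual of the regular forms; the symmetric Fremlin vector lattice
  tensor product is the vector sublattice generated by the tensors \<open>x \<otimes> \<dots> \<otimes> x\<close>, and the positive
  projective symmetric tensor product is its completion in the norm \<open>tensor_norm\<close>, realised as a
  closure.  To make extensionally equal functionals equal, functionals in \<open>order_dual\<close> vanish
  outside the carrier.
\<close>

definition positive_functional :: "('b, 'm) ordered_space_scheme \<Rightarrow> ('b \<Rightarrow> real) \<Rightarrow> bool" where
  "positive_functional V f \<longleftrightarrow> linear_functional V f \<and> (\<forall>x\<in>car V. vle V (vzero V) x \<longrightarrow> 0 \<le> f x)"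

definition order_dual :: "('b, 'm) ordered_space_scheme \<Rightarrow> ('b \<Rightarrow> real) ordered_space" where
  "order_dual V = \<lparr>car = {f. (\<forall>x. x \<notin> car V \<longrightarrow> f x = 0) \<and>
        (\<exists>g h. positive_functional V g \<and> positive_functional V h \<and> (\<forall>x\<in>car V. f x = g x - h x))},
     vadd = (\<lambda>f g x. f x + g x), vzero = (\<lambda>_. 0), vscale = (\<lambda>a f x. a * f x),
     vle = (\<lambda>f g. \<forall>x\<in>car V. vle V (vzero V) x \<longrightarrow> f x \<le> g x)\<rparr>"

text \<open>Closure under infima follows from \<open>inf u v = - sup (- u) (- v)\<close>.\<close>

inductive_set sublattice_generated :: "('b, 'm) ordered_space_scheme \<Rightarrow> 'b set \<Rightarrow> 'b set"
  for V S where
    base: "x \<in> S \<Longrightarrow> x \<in> sublattice_generated V S"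
  | add: "\<lbrakk>u \<in> sublattice_generated V S; v \<in> sublattice_generated V S\<rbrakk> \<Longrightarrow> vadd V u v \<in> sublattice_generated V S"
  | scale: "u \<in> sublattice_generated V S \<Longrightarrow> vscale V a u \<in> sublattice_generated V S"
  | sup: "\<lbrakk>u \<in> sublattice_generated V S; v \<in> sublattice_generated V S; is_sup V u v w\<rbrakk>
      \<Longrightarrow> w \<in> sublattice_generated V S"

definition tensor_power :: "nat \<Rightarrow> 'a::banach_lattice \<Rightarrow> ('a \<Rightarrow> real) \<Rightarrow> real" where
  "tensor_power k x = (\<lambda>P. if P \<in> car (regular_polys k) then P x else 0)"

definition fremlin_tensor_lattice :: "nat \<Rightarrow> (('a::banach_lattice \<Rightarrow> real) \<Rightarrow> real) set" where
  "fremlin_tensor_lattice k = sublattice_generated (order_dual (regular_polys k)) (range (tensor_power k))"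

text \<open>
  The positive projective symmetric tensor norm of \<open>u\<close> is the infimum of \<open>\<Sum>i. \<parallel>x i\<parallel> ^ k\<close> over all
  \<open>x i \<ge> 0\<close> with \<open>\<bar>u\<bar> \<le> \<Sum>i. x i \<otimes> \<dots> \<otimes> x i\<close>.  On the Fremlin tensor lattice finite and countable sums
  give the same infimum (both are the norm dual to the regular norm of forms); countable sums make
  the formula valid on the completion as well.
  Since the right-hand side is a positive functional, \<open>\<bar>u\<bar> \<le> w\<close> says \<open>\<bar>u P\<bar> \<le> w P\<close> for all positive \<open>P\<close>.
\<close>

definition tensor_norm_bounds :: "nat \<Rightarrow> (('a::banach_lattice \<Rightarrow> real) \<Rightarrow> real) \<Rightarrow> real set" where
  "tensor_norm_bounds k u = {(\<Sum>i. norm (x i) ^ k) | x :: nat \<Rightarrow> 'a.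
     (\<forall>i. 0 \<le> x i) \<and> summable (\<lambda>i. norm (x i) ^ k) \<and>
     (\<forall>P. positive_poly k scalars P \<longrightarrow> \<bar>u P\<bar> \<le> (\<Sum>i. tensor_power k (x i) P))}"

definition tensor_norm :: "nat \<Rightarrow> (('a::banach_lattice \<Rightarrow> real) \<Rightarrow> real) \<Rightarrow> real" where
  "tensor_norm k u = Inf (tensor_norm_bounds k u)"

definition sym_tensor_product :: "nat \<Rightarrow> (('a::banach_lattice \<Rightarrow> real) \<Rightarrow> real) normed_lattice" where
  "sym_tensor_product k = \<lparr>
     car = {z \<in> car (order_dual (regular_polys k)).
        \<forall>e>0. \<exists>u\<in>fremlin_tensor_lattice k. \<exists>r\<in>tensor_norm_bounds k (\<lambda>P. z P - u P). r < e},
     vadd = vadd (order_dual (regular_polys k)), vzero = vzero (order_dual (regular_polys k)),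
     vscale = vscale (order_dual (regular_polys k)), vle = vle (order_dual (regular_polys k)),
     vnorm = tensor_norm k\<rparr>"

text \<open>
  With tensors realised as functionals on forms, the linearization of \<open>P\<close>, determined by
  \<open>linearization P (tensor_power k x) = P x\<close>, is evaluation at \<open>P\<close>.
\<close>

definition linearization :: "('a::banach_lattice \<Rightarrow> real) \<Rightarrow> (('a \<Rightarrow> real) \<Rightarrow> real) \<Rightarrow> real" where
  "linearization P = (\<lambda>z. z P)"

definition weak_star_null_polys :: "nat \<Rightarrow> (nat \<Rightarrow> 'a::banach_lattice \<Rightarrow> real) \<Rightarrow> bool" where
  "weak_star_null_polys k P \<longleftrightarrow>
     (\<forall>n. P n \<in> car (regular_polys k)) \<and>
     weak_star_null (sym_tensor_product k) (\<lambda>n. linearization (P n))"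


section \<open>Equivalence of a list of statements\<close>

definition all_equivalent :: "bool list \<Rightarrow> bool" where
  "all_equivalent bs \<longleftrightarrow> (\<forall>b\<in>set bs. \<forall>c\<in>set bs. b \<longrightarrow> c)"

end

theory Submission
  imports Defs "HOL-Complex_Analysis.Great_Picard"
begin

text \<open>
  The Dunford-Pettis* property implies everything else through one observation about forms.  Let \<open>T\<^sub>n\<close> be
  separately continuous \<open>k\<close>-linear forms converging pointwise, and let \<open>x\<^sub>n\<close> be a disjoint weakly
  \<open>p\<close>-summable sequence.  With all arguments but one fixed, the \<open>T\<^sub>n\<close> give a weakly* convergent sequence of
  functionals; the set of the \<open>x\<^sub>n\<close> is limited and \<open>x\<^sub>n\<close> is weakly null, so inserting \<open>x\<^sub>n\<close> gives a null
  sequence.  Hence the functionals belonging to the next free argument converge weakly* to zero, and after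
  \<open>k\<close> steps \<open>T\<^sub>n (x\<^sub>n, \<dots>, x\<^sub>n) \<longlonglongrightarrow> 0\<close> (\<open>disjoint_DP_star_forms_tendsto\<close>).
  For weakly* null polynomials, \<open>polarization\<close> provides the pointwise convergence of the forms.  For a positive polynomial \<open>P\<close> into a lattice whose dual ball is sequentially
  weakly* compact, one takes \<open>T\<^sub>n = f\<^sub>n \<circ> T\<^sub>P\<close> with functionals \<open>f\<^sub>n\<close> norming \<open>P x\<^sub>n\<close>.  Positive
  multilinear operators are continuous (\<open>positive_op_slot_bounded\<close>).

  Null sequences form such a lattice (\<open>c0_dual_ball_compact\<close>), and a weakly* null sequence of positive
  forms is the coordinate sequence of a positive polynomial with values in it.  So every
  statement implies the one about positive disjoint weakly* null sequences of forms, and it remains to recover the Dunford-Pettis* property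
  from that one (\<open>disjoint_DP_star_if_positive_disjoint_forms\<close>).

  Suppose that \<open>\<bar>f\<^sub>n (x\<^sub>n)\<bar> \<ge> \<epsilon>\<close> with \<open>f\<^sub>n\<close> weakly* null.  Up to a sign, \<open>f\<^sub>n\<close> is at least \<open>\<epsilon> / 2\<close> at the
  positive or the negative part \<open>e\<^sub>n\<close> of \<open>x\<^sub>n\<close>.  Let \<open>h\<^sub>n\<close> be the component of \<open>f\<^sub>n\<^sup>+\<close> carried by the band of
  \<open>e\<^sub>n\<close>, so \<open>h\<^sub>n z = sup f\<^sub>n y\<close> over \<open>0 \<le> y \<le> z\<close> in the ideal generated by \<open>e\<^sub>n\<close>.  The \<open>h\<^sub>n\<close> are
  positive and disjoint, and \<open>h\<^sub>n z\<close> is almost \<open>f\<^sub>n y\<^sub>n\<close> for a disjoint sequence \<open>y\<^sub>n\<close> in \<open>[0, z]\<close>.  By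
  \<open>\<sigma>\<close>-Dedekind completeness, \<open>A \<mapsto> sup {y\<^sub>i | i \<in> A}\<close> is an additive vector measure on the subsets of the
  natural numbers, and the diagonal part of Phillips' lemma (\<open>finitely_additive_diagonal_tendsto\<close>) gives
  \<open>f\<^sub>n y\<^sub>n \<longlonglongrightarrow> 0\<close>.  Hence \<open>h\<^sub>n \<longlonglongrightarrow> 0\<close> pointwise.  The polynomials \<open>h\<^sub>n\<^sup>k\<close> are positive, disjoint and
  pointwise null, but do not tend to zero at \<open>x\<^sub>n\<close>.

  Weak* nullity of \<open>h\<^sub>n\<^sup>k\<close> concerns all elements of the tensor product, not just the tensor powers.
  Every element is dominated by a series of positive tensor powers, which for positive forms reduces the claim to pointwise convergence by dominated convergence (\<open>weak_star_null_polysI\<close>).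
\<close>

section \<open>Banach lattices\<close>

lemma pprt_diff_pprt:
  fixes x :: "'a::lattice_ab_group_add_abs"
  shows "pprt x - pprt (- x) = x" "pprt x + pprt (- x) = \<bar>x\<bar>"
  by (simp_all add: pprt_neg abs_prts flip: prts)

lemma pprt_le_abs:
  fixes x :: "'a::lattice_ab_group_add_abs"
  shows "pprt x \<le> \<bar>x\<bar>" "pprt (- x) \<le> \<bar>x\<bar>"
  by (metis pprt_diff_pprt(2) zero_le_pprt le_add_same_cancel1)
     (metis pprt_diff_pprt(2) zero_le_pprt le_add_same_cancel2)

lemma norm_mono_positive:
  fixes x y :: "'a::banach_lattice"
  assumes "0 \<le> x" "x \<le> y"
  shows "norm x \<le> norm y"
  using assms by (intro norm_lattice) simp

lemma norm_pprt_le: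
  fixes x :: "'a::banach_lattice"
  shows "norm (pprt x) \<le> norm x" "norm (pprt (- x)) \<le> norm x"
  by (intro norm_lattice; simp add: pprt_le_abs)+

text \<open>
  The negative part of the limit is dominated by \<open>\<bar>X n - x\<bar>\<close>, because \<open>X n\<close> has none.
\<close>

lemma positive_cone_closed:
  fixes x :: "'a::banach_lattice"
  assumes "X \<longlonglongrightarrow> x" and "\<And>n. 0 \<le> X n"
  shows "0 \<le> x"
proof -
  have "norm (pprt (- x)) \<le> norm (X n - x)" for n
  proof (rule norm_lattice)
    have "- x \<le> X n - x" using assms(2)[of n] by simp
    also have "\<dots> \<le> \<bar>X n - x\<bar>" by (rule abs_ge_self)
    finally have "pprt (- x) \<le> \<bar>X n - x\<bar>" by (simp add: pprt_def)
    then show "\<bar>pprt (- x)\<bar> \<le> \<bar>X n - x\<bar>" by simp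
  qed
  moreover have "(\<lambda>n. norm (X n - x)) \<longlonglongrightarrow> 0"
    using assms(1) by (simp add: tendsto_norm_zero_iff LIM_zero_iff)
  ultimately have "norm (pprt (- x)) \<le> 0"
    by (intro LIMSEQ_le_const) auto
  then have "pprt (- x) = 0" by simp
  then show ?thesis by (simp add: le_zero_iff_zero_pprt[symmetric])
qed

lemma term_le_suminf_lattice:
  fixes u :: "nat \<Rightarrow> 'a::banach_lattice"
  assumes "summable u" and "\<And>n. 0 \<le> u n"
  shows "u m \<le> suminf u"
proof -
  have "(\<lambda>n. (\<Sum>i<n + Suc m. u i) - u m) \<longlonglongrightarrow> suminf u - u m"
    by (intro tendsto_diff tendsto_const LIMSEQ_ignore_initial_segment summable_LIMSEQ assms(1))
  moreover have "0 \<le> (\<Sum>i<n + Suc m. u i) - u m" for n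
  proof -
    have "(\<Sum>i\<in>{m}. u i) \<le> (\<Sum>i<n + Suc m. u i)"
      by (intro sum_mono2) (auto simp: assms(2))
    then show ?thesis by simp
  qed
  ultimately have "0 \<le> suminf u - u m" by (rule positive_cone_closed)
  then show ?thesis by simp
qed

text \<open>
  The gliding-hump argument behind automatic continuity: vectors \<open>u n\<close> of norm \<open>1 / 2 ^ n\<close> with
  \<open>\<phi> (u n) > n\<close> would all lie below their sum \<open>w\<close>, forcing \<open>\<phi> w > n\<close> for every \<open>n\<close>.
\<close>

lemma monotone_homogeneous_bounded:
  fixes \<phi> :: "'a::banach_lattice \<Rightarrow> real"
  assumes mono: "\<And>x y. 0 \<le> x \<Longrightarrow> x \<le> y \<Longrightarrow> \<phi> x \<le> \<phi> y"
    and homogeneous: "\<And>x t. 0 \<le> x \<Longrightarrow> 0 \<le> t \<Longrightarrow> \<phi> (t *\<^sub>R x) = t ^ k * \<phi> x"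
    and "1 \<le> k"
  obtains C where "0 \<le> C" "\<And>x. 0 \<le> x \<Longrightarrow> \<phi> x \<le> C * norm x ^ k"
proof -
  have zero: "\<phi> 0 = 0" using homogeneous[of 0 0] \<open>1 \<le> k\<close> by (cases k) auto
  have "\<exists>C\<ge>0. \<forall>x\<ge>0. \<phi> x \<le> C * norm x ^ k"
  proof (rule ccontr)
    assume no: "\<not> ?thesis"
    have "\<exists>z\<ge>0. real n * (2 ^ n) ^ k * norm z ^ k < \<phi> z" for n
    proof -
      have "0 \<le> real n * (2 ^ n) ^ k" by simp
      then show ?thesis using no not_le by blast
    qed
    then obtain z where z: "\<And>n. 0 \<le> z n" "\<And>n. real n * (2 ^ n) ^ k * norm (z n) ^ k < \<phi> (z n)"
      by metis
    have nz: "0 < norm (z n)" for n using z(2)[of n] zero \<open>1 \<le> k\<close> by (cases "z n = 0"; cases k) auto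
    define t where "t n = 1 / (2 ^ n * norm (z n))" for n
    have t: "0 < t n" for n using nz by (simp add: t_def)
    define u where "u n = t n *\<^sub>R z n" for n
    have u0: "0 \<le> u n" for n using z(1)[of n] t[of n] by (simp add: u_def scaleR_nonneg_nonneg)
    have "norm (u n) = (1/2) ^ n" for n
      using nz[of n] by (simp add: u_def t_def power_one_over)
    then have "summable (\<lambda>n. norm (u n))" by (simp add: summable_geometric)
    then have su: "summable u" by (rule summable_norm_cancel)
    have "real n \<le> \<phi> (suminf u)" for n
    proof -
      have "real n = t n ^ k * (real n * (2 ^ n) ^ k * norm (z n) ^ k)"
        using nz[of n] by (simp add: t_def power_divide power_mult_distrib)
      also have "\<dots> \<le> t n ^ k * \<phi> (z n)"
        using z(2)[of n] t[of n] by (intro mult_left_mono) auto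
      also have "\<dots> = \<phi> (u n)" using homogeneous[OF z(1)] t[of n] by (simp add: u_def)
      also have "\<dots> \<le> \<phi> (suminf u)" by (intro mono u0 term_le_suminf_lattice su)
      finally show ?thesis .
    qed
    then show False using reals_Archimedean2 not_le by blast
  qed
  then show ?thesis using that by blast
qed

section \<open>Banach lattices on a carrier\<close>

context banach_lattice_on
begin

lemma vscale_zero:
  assumes "x \<in> car F" shows "vscale F 0 x = vzero F"
  using scale_left_distrib[OF assms, of 1 "- 1"] assms by (simp add: scale_one add_inverse)

lemma minus_closed: "x \<in> car F \<Longrightarrow> y \<in> car F \<Longrightarrow> vminus F x y \<in> car F"
  by (simp add: vminus_def add_closed scale_closed)

lemma vzero_add: "x \<in> car F \<Longrightarrow> vadd F (vzero F) x = x"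
  using add_commute[OF zero_closed] add_zero by simp

lemma vnorm_zero: "vnorm F (vzero F) = 0"
  using norm_eq_zero zero_closed by blast

lemma vnorm_uminus: "x \<in> car F \<Longrightarrow> vnorm F (vscale F (- 1) x) = vnorm F x"
  by (simp add: norm_scale)

lemma vnorm_nonneg:
  assumes "x \<in> car F" shows "0 \<le> vnorm F x"
proof -
  have "vnorm F (vadd F x (vscale F (- 1) x)) \<le> vnorm F x + vnorm F x"
    using norm_triangle[OF assms scale_closed[OF assms]] vnorm_uminus[OF assms] by metis
  then show ?thesis using assms by (simp add: add_inverse vnorm_zero)
qed

lemma vnorm_minus_le:
  "x \<in> car F \<Longrightarrow> y \<in> car F \<Longrightarrow> vnorm F (vminus F x y) \<le> vnorm F x + vnorm F y"
  unfolding vminus_def using norm_triangle[of x "vscale F (- 1) y"]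
  by (simp add: scale_closed vnorm_uminus)

lemma vle_add_positive:
  assumes "x \<in> car F" "y \<in> car F" "vle F (vzero F) y" shows "vle F x (vadd F x y)"
  using add_mono[OF zero_closed assms(2,1,3)] assms by (simp add: vzero_add add_commute)

lemma uminus_le_zero:
  assumes "x \<in> car F" "vle F (vzero F) x" shows "vle F (vscale F (- 1) x) (vzero F)"
  using add_mono[OF zero_closed assms(1) scale_closed[OF assms(1)] assms(2)] assms(1)
  by (metis add_inverse vzero_add scale_closed)

lemma is_modulus_positive:
  assumes "x \<in> car F" "vle F (vzero F) x" shows "is_modulus F x x"
  unfolding is_modulus_def is_sup_def
  using assms le_trans[OF scale_closed zero_closed _ uminus_le_zero] by (auto simp: le_refl)

lemma vnorm_mono_positive:
  assumes "x \<in> car F" "y \<in> car F" "vle F (vzero F) x" "vle F x y"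
  shows "vnorm F x \<le> vnorm F y"
proof -
  have "vle F (vzero F) y" using le_trans[OF zero_closed assms(1,2,3,4)] .
  then show ?thesis using norm_mono[OF assms(1,2)] is_modulus_positive assms by blast
qed

end

lemma type_lattice_simps [simp]:
  "car type_lattice = UNIV" "vadd type_lattice = (+)" "vzero type_lattice = 0"
  "vscale type_lattice = scaleR" "vle type_lattice = (\<le>)" "vnorm type_lattice = norm"
  "vminus type_lattice = (-)"
  by (simp_all add: type_lattice_def vminus_def fun_eq_iff)

section \<open>Multilinear operators\<close>

lemma multilinear_op_add:
  "multilinear_op k F T \<Longrightarrow> i < k \<Longrightarrow> T (x(i := a + b)) = vadd F (T (x(i := a))) (T (x(i := b)))"
  unfolding multilinear_op_def by blast

lemma multilinear_op_scale:
  "multilinear_op k F T \<Longrightarrow> i < k \<Longrightarrow> T (x(i := r *\<^sub>R a)) = vscale F r (T (x(i := a)))"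
  unfolding multilinear_op_def by blast

lemma multilinear_op_closed: "multilinear_op k F T \<Longrightarrow> T x \<in> car F"
  unfolding multilinear_op_def by blast

lemma multilinear_op_cong:
  "multilinear_op k F T \<Longrightarrow> (\<And>i. i < k \<Longrightarrow> x i = y i) \<Longrightarrow> T x = T y"
  unfolding multilinear_op_def by blast

lemma multilinear_op_diff:
  assumes "multilinear_op k F T" "i < k"
  shows "T (x(i := a - b)) = vminus F (T (x(i := a))) (T (x(i := b)))"
  using multilinear_op_add[OF assms, of x a "(- 1) *\<^sub>R b"] multilinear_op_scale[OF assms, of x "- 1" b]
  by (simp add: vminus_def)

text \<open>Splitting one argument at a time into positive parts reduces claims to positive arguments.\<close>

lemma nonpositive_arguments_induct:
  fixes a :: "nat \<Rightarrow> 'a::banach_lattice"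
  assumes positive: "\<And>a :: nat \<Rightarrow> 'a. (\<And>l. l < k \<Longrightarrow> 0 \<le> a l) \<Longrightarrow> P a"
    and split: "\<And>(a :: nat \<Rightarrow> 'a) l. l < k \<Longrightarrow> P (a(l := pprt (a l))) \<Longrightarrow> P (a(l := pprt (- a l))) \<Longrightarrow> P a"
  shows "P a"
proof -
  have "P a" if "finite I" "\<And>l. l < k \<Longrightarrow> l \<notin> I \<Longrightarrow> 0 \<le> a l" for I and a :: "nat \<Rightarrow> 'a"
    using that
  proof (induction I arbitrary: a rule: finite_induct)
    case empty
    then show ?case using positive by blast
  next
    case (insert l I)
    show ?case
    proof (cases "l < k")
      case True
      then show ?thesis by (rule split; intro insert.IH) (auto intro: insert.prems)
    next
      case False
      then have "0 \<le> a l'" if "l' < k" "l' \<notin> I" for l' using insert.prems that by (cases "l' = l") auto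
      then show ?thesis by (rule insert.IH)
    qed
  qed
  from this[of "{..<k}" a] show ?thesis by simp
qed

definition positive_op ::
  "nat \<Rightarrow> ('b, 'm) ordered_space_scheme \<Rightarrow> ((nat \<Rightarrow> 'a::banach_lattice) \<Rightarrow> 'b) \<Rightarrow> bool" where
  "positive_op k F T \<longleftrightarrow> multilinear_op k F T \<and> (\<forall>x. (\<forall>i<k. 0 \<le> x i) \<longrightarrow> vle F (vzero F) (T x))"

lemma positive_poly_iff:
  "positive_poly k F P \<longleftrightarrow> (\<exists>T. positive_op k F T \<and> symmetric_op k T \<and> (\<forall>x. P x = T (\<lambda>_. x)))"
  unfolding positive_poly_def associated_op_def positive_op_def by blast

lemma (in banach_lattice_on) positive_op_slot_mono:
  assumes "positive_op k F T" "\<And>l. l < k \<Longrightarrow> 0 \<le> a l" "i < k" "0 \<le> x" "x \<le> y"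
  shows "vle F (T (a(i := x))) (T (a(i := y)))"
proof -
  have M: "multilinear_op k F T" using assms(1) by (simp add: positive_op_def)
  have "vle F (vzero F) (T (a(i := y - x)))" using assms by (simp add: positive_op_def)
  then have "vle F (T (a(i := x))) (vadd F (T (a(i := x))) (T (a(i := y - x))))"
    by (intro vle_add_positive multilinear_op_closed[OF M])
  then show ?thesis using multilinear_op_add[OF M \<open>i < k\<close>, of a x "y - x"] by simp
qed

text \<open>
  Automatic continuity.  With positive arguments in the other slots the operator is monotone in the free
  one, so \<open>monotone_homogeneous_bounded\<close> applies to its norm.  The other arguments are reduced to positive ones by splitting.
\<close>

lemma (in banach_lattice_on) positive_op_slot_bounded:
  fixes T :: "(nat \<Rightarrow> 'a::banach_lattice) \<Rightarrow> 'b"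
  assumes T: "positive_op k F T" and i: "i < k"
  shows "\<exists>C. \<forall>y. vnorm F (T (a(i := y))) \<le> C * norm y"
proof (induction a rule: nonpositive_arguments_induct[of k])
  case (1 a)
  have M: "multilinear_op k F T" using T by (simp add: positive_op_def)
  have cl: "T x \<in> car F" for x by (rule multilinear_op_closed[OF M])
  obtain C where C: "0 \<le> C" "\<And>y. 0 \<le> y \<Longrightarrow> vnorm F (T (a(i := y))) \<le> C * norm y ^ 1"
  proof (rule monotone_homogeneous_bounded[where \<phi> = "\<lambda>y. vnorm F (T (a(i := y)))" and k = 1])
    show "vnorm F (T (a(i := x))) \<le> vnorm F (T (a(i := y)))" if "0 \<le> x" "x \<le> y" for x y
      using that 1 positive_op_slot_mono[OF T 1 i that] T
      by (intro vnorm_mono_positive cl) (auto simp: positive_op_def)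
    show "vnorm F (T (a(i := t *\<^sub>R x))) = t ^ 1 * vnorm F (T (a(i := x)))" if "0 \<le> t" for x t
      using that multilinear_op_scale[OF M i] by (simp add: norm_scale cl)
  qed auto
  have "vnorm F (T (a(i := y))) \<le> (2 * C) * norm y" for y
  proof -
    have "vnorm F (T (a(i := y))) = vnorm F (T (a(i := pprt y - pprt (- y))))"
      by (simp add: pprt_diff_pprt)
    also have "\<dots> \<le> vnorm F (T (a(i := pprt y))) + vnorm F (T (a(i := pprt (- y))))"
      unfolding multilinear_op_diff[OF M i] by (intro vnorm_minus_le cl)
    also have "\<dots> \<le> C * norm (pprt y) + C * norm (pprt (- y))"
      using C(2)[of "pprt y"] C(2)[of "pprt (- y)"] by simp
    also have "\<dots> \<le> C * norm y + C * norm y"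
      using C(1) by (intro add_mono_thms_linordered_semiring(1) conjI mult_left_mono norm_pprt_le)
    finally show ?thesis by simp
  qed
  then show ?case by blast
next
  case (2 a l)
  have M: "multilinear_op k F T" using T by (simp add: positive_op_def)
  show ?case
  proof (cases "l = i")
    case True
    show ?thesis using 2(2) unfolding True fun_upd_upd .
  next
    case False
    obtain C D where C: "\<And>y. vnorm F (T (a(l := pprt (a l), i := y))) \<le> C * norm y"
      and D: "\<And>y. vnorm F (T (a(l := pprt (- a l), i := y))) \<le> D * norm y"
      using 2(2,3) by blast
    have "vnorm F (T (a(i := y))) \<le> (C + D) * norm y" for y
    proof -
      have "vnorm F (T (a(i := y))) = vnorm F (T (a(i := y, l := pprt (a l) - pprt (- a l))))"
        using False by (intro arg_cong[of _ _ "\<lambda>b. vnorm F (T b)"]) (auto simp: pprt_diff_pprt)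
      also have "\<dots> \<le> vnorm F (T (a(i := y, l := pprt (a l)))) + vnorm F (T (a(i := y, l := pprt (- a l))))"
        unfolding multilinear_op_diff[OF M 2(1)] by (intro vnorm_minus_le multilinear_op_closed[OF M])
      also have "\<dots> \<le> C * norm y + D * norm y"
        using C[of y] D[of y] False by (simp add: fun_upd_twist)
      finally show ?thesis by (simp add: algebra_simps)
    qed
    then show ?thesis by blast
  qed
qed

definition separately_bounded_linear :: "nat \<Rightarrow> ((nat \<Rightarrow> 'a::real_normed_vector) \<Rightarrow> real) \<Rightarrow> bool" where
  "separately_bounded_linear k T \<longleftrightarrow> (\<forall>i<k. \<forall>a. bounded_linear (\<lambda>y. T (a(i := y))))"

lemma separately_bounded_linear_diff:
  "separately_bounded_linear k S \<Longrightarrow> separately_bounded_linear k T \<Longrightarrow>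
     separately_bounded_linear k (\<lambda>x. S x - T x)"
  by (simp add: separately_bounded_linear_def bounded_linear_sub)

lemma (in banach_lattice_on) dual_positive_op_separately_bounded_linear:
  assumes T: "positive_op k F T" and f: "f \<in> dual F"
  shows "separately_bounded_linear k (\<lambda>x. f (T x))"
  unfolding separately_bounded_linear_def
proof (intro allI impI)
  fix i a assume i: "i < k"
  have M: "multilinear_op k F T" using T by (simp add: positive_op_def)
  note cl = multilinear_op_closed[OF M]
  obtain B where B: "\<And>y. y \<in> car F \<Longrightarrow> \<bar>f y\<bar> \<le> B * vnorm F y" and lin: "linear_functional F f"
    using f by (auto simp: dual_def)
  have B': "\<bar>f y\<bar> \<le> \<bar>B\<bar> * vnorm F y" if "y \<in> car F" for y
    using B[OF that] mult_right_mono[OF abs_ge_self[of B] vnorm_nonneg[OF that]] by linarith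
  obtain C where C: "\<And>y. vnorm F (T (a(i := y))) \<le> C * norm y"
    using positive_op_slot_bounded[OF T i] by blast
  show "bounded_linear (\<lambda>y. f (T (a(i := y))))"
  proof (rule bounded_linear_intro)
    show "f (T (a(i := x + y))) = f (T (a(i := x))) + f (T (a(i := y)))" for x y
      using lin cl by (simp add: multilinear_op_add[OF M i] linear_functional_def)
    show "f (T (a(i := r *\<^sub>R x))) = r *\<^sub>R f (T (a(i := x)))" for r x
      using lin cl by (simp add: multilinear_op_scale[OF M i] linear_functional_def)
    show "norm (f (T (a(i := x)))) \<le> norm x * (\<bar>B\<bar> * C)" for x
    proof -
      have "norm (f (T (a(i := x)))) \<le> \<bar>B\<bar> * vnorm F (T (a(i := x)))" using B' cl by simp
      also have "\<dots> \<le> \<bar>B\<bar> * (C * norm x)" using C by (intro mult_left_mono) auto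
      finally show ?thesis by (simp add: algebra_simps)
    qed
  qed
qed

interpretation scalars: banach_lattice_on "scalars"
  by (rule banach_lattice_on_type_lattice)

lemma id_in_dual_scalars: "(\<lambda>y. y) \<in> dual scalars"
  by (auto simp: dual_def linear_functional_def intro!: exI[of _ 1])

lemmas positive_form_separately_bounded_linear =
  scalars.dual_positive_op_separately_bounded_linear[OF _ id_in_dual_scalars]

text \<open>
  The usual \<open>\<bar>T x\<bar> \<le> T \<bar>x\<bar>\<close>: replacing \<open>a l\<close> by its positive and negative parts turns a difference into a
  sum of the same two terms.
\<close>

lemma positive_form_abs_le:
  assumes T: "positive_op k scalars T"
  shows "\<bar>T a\<bar> \<le> T (\<lambda>i. \<bar>a i\<bar>)"
proof (induction a rule: nonpositive_arguments_induct[of k])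
  case (1 a)
  have "T (\<lambda>i. \<bar>a i\<bar>) = T a"
    using T 1 by (intro multilinear_op_cong[of k scalars T]) (auto simp: positive_op_def)
  moreover have "0 \<le> T a" using T 1 by (simp add: positive_op_def)
  ultimately show ?case by simp
next
  case (2 a l)
  have M: "multilinear_op k scalars T" using T by (simp add: positive_op_def)
  have abs: "(\<lambda>i. \<bar>(a(l := z)) i\<bar>) = (\<lambda>i. \<bar>a i\<bar>)(l := \<bar>z\<bar>)" for z by auto
  have "\<bar>T a\<bar> = \<bar>T (a(l := pprt (a l) - pprt (- a l)))\<bar>" by (simp add: pprt_diff_pprt)
  also have "\<dots> \<le> \<bar>T (a(l := pprt (a l)))\<bar> + \<bar>T (a(l := pprt (- a l)))\<bar>"
    unfolding multilinear_op_diff[OF M 2(1)] by simp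
  also have "\<dots> \<le> T ((\<lambda>i. \<bar>a i\<bar>)(l := pprt (a l))) + T ((\<lambda>i. \<bar>a i\<bar>)(l := pprt (- a l)))"
    using 2(2,3)[unfolded abs abs_of_nonneg[OF zero_le_pprt]] by (rule add_mono)
  also have "\<dots> = T ((\<lambda>i. \<bar>a i\<bar>)(l := pprt (a l) + pprt (- a l)))"
    by (simp add: multilinear_op_add[OF M 2(1)])
  also have "\<dots> = T (\<lambda>i. \<bar>a i\<bar>)" by (intro arg_cong[of _ _ T]) (auto simp: pprt_diff_pprt)
  finally show ?case .
qed

lemma positive_form_diagonal_mono:
  assumes T: "positive_op k scalars T" and "0 \<le> x" "x \<le> y"
  shows "T (\<lambda>_. x) \<le> T (\<lambda>_. y)"
proof -
  have M: "multilinear_op k scalars T" using T by (simp add: positive_op_def)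
  have "T (\<lambda>_. x) \<le> T (\<lambda>i. if i < m then y else x)" if "m \<le> k" for m
    using that
  proof (induction m)
    case (Suc m)
    let ?a = "\<lambda>i. if i < m then y else x"
    have "T ?a = T (?a(m := x))" by (intro arg_cong[of _ _ T]) auto
    also have "\<dots> \<le> T (?a(m := y))"
      using scalars.positive_op_slot_mono[OF T, of ?a m x y] assms Suc.prems by fastforce
    also have "\<dots> = T (\<lambda>i. if i < Suc m then y else x)" by (intro arg_cong[of _ _ T]) auto
    finally show ?case using Suc by simp
  qed auto
  from this[of k] show ?thesis using multilinear_op_cong[OF M, of "\<lambda>i. if i < k then y else x" "\<lambda>_. y"] by simp
qed

lemma multilinear_form_diagonal_scale:
  assumes M: "multilinear_op k scalars T"
  shows "T (\<lambda>_. t *\<^sub>R x) = t ^ k * T (\<lambda>_. x)"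
proof -
  have "T (\<lambda>i. if i < m then t *\<^sub>R x else x) = t ^ m * T (\<lambda>_. x)" if "m \<le> k" for m
    using that
  proof (induction m)
    case (Suc m)
    let ?a = "\<lambda>i. if i < m then t *\<^sub>R x else x"
    have "T (\<lambda>i. if i < Suc m then t *\<^sub>R x else x) = T (?a(m := t *\<^sub>R x))"
      by (intro arg_cong[of _ _ T]) auto
    also have "\<dots> = t * T (?a(m := x))" using Suc.prems by (simp add: multilinear_op_scale[OF M])
    also have "?a(m := x) = ?a" by auto
    finally show ?case using Suc by simp
  qed auto
  from this[of k] show ?thesis
    using multilinear_op_cong[OF M, of "\<lambda>i. if i < k then t *\<^sub>R x else x" "\<lambda>_. t *\<^sub>R x"] by simp
qed

section \<open>Polarization\<close>

lemma multilinear_form_sum: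
  assumes M: "multilinear_op k scalars T" and "i < k" and "finite J"
  shows "T (x(i := sum y J)) = (\<Sum>j\<in>J. T (x(i := y j)))"
  using \<open>finite J\<close>
proof (induction J rule: finite_induct)
  case empty
  then show ?case using multilinear_op_scale[OF M \<open>i < k\<close>, of x 0 0] by (simp add: fun_upd_def)
next
  case (insert j J)
  then show ?case using multilinear_op_add[OF M \<open>i < k\<close>, of x "y j" "sum y J"] by (simp add: fun_upd_def)
qed

lemma multilinear_form_expand:
  assumes M: "multilinear_op k scalars T" and J: "finite J"
  shows "T (\<lambda>_. sum y J) = (\<Sum>\<phi>\<in>{..<k} \<rightarrow>\<^sub>E J. T (\<lambda>i. y (\<phi> i)))"
proof -
  have "T (\<lambda>i. if i < m then sum y J else x i) =
      (\<Sum>\<phi>\<in>{..<m} \<rightarrow>\<^sub>E J. T (\<lambda>i. if i < m then y (\<phi> i) else x i))" if "m \<le> k" for m x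
    using that
  proof (induction m arbitrary: x)
    case 0
    then show ?case by simp
  next
    case (Suc m)
    have "T (\<lambda>i. if i < Suc m then sum y J else x i) = T ((\<lambda>i. if i < m then sum y J else x i)(m := sum y J))"
      by (intro arg_cong[of _ _ T]) auto
    also have "\<dots> = (\<Sum>j\<in>J. T ((\<lambda>i. if i < m then sum y J else x i)(m := y j)))"
      using Suc.prems by (intro multilinear_form_sum[OF M _ J]) auto
    also have "\<dots> = (\<Sum>j\<in>J. T (\<lambda>i. if i < m then sum y J else (x(m := y j)) i))"
      by (intro sum.cong refl arg_cong[of _ _ T]) auto
    also have "\<dots> = (\<Sum>j\<in>J. \<Sum>\<phi>\<in>{..<m} \<rightarrow>\<^sub>E J. T (\<lambda>i. if i < m then y (\<phi> i) else (x(m := y j)) i))"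
      using Suc by (intro sum.cong refl Suc.IH) auto
    also have "\<dots> = (\<Sum>(j, \<phi>)\<in>J \<times> ({..<m} \<rightarrow>\<^sub>E J). T (\<lambda>i. if i < m then y (\<phi> i) else (x(m := y j)) i))"
      by (rule sum.cartesian_product)
    also have "\<dots> = (\<Sum>\<phi>\<in>{..<Suc m} \<rightarrow>\<^sub>E J. T (\<lambda>i. if i < Suc m then y (\<phi> i) else x i))"
      by (rule sum.reindex_bij_witness[of _ "\<lambda>\<phi>. (\<phi> m, \<phi>(m := undefined))" "\<lambda>(j, \<phi>). \<phi>(m := j)"])
        (auto simp: PiE_def extensional_def fun_eq_iff less_Suc_eq intro!: arg_cong[of _ _ T])
    finally show ?case .
  qed
  from this[of k "\<lambda>_. 0"]
  have "T (\<lambda>i. if i < k then sum y J else 0) = (\<Sum>\<phi>\<in>{..<k} \<rightarrow>\<^sub>E J. T (\<lambda>i. if i < k then y (\<phi> i) else 0))"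
    by simp
  moreover have "T (\<lambda>i. if i < k then sum y J else 0) = T (\<lambda>_. sum y J)"
    by (rule multilinear_op_cong[OF M]) simp
  moreover have "T (\<lambda>i. if i < k then y (\<phi> i) else 0) = T (\<lambda>i. y (\<phi> i))" for \<phi>
    by (rule multilinear_op_cong[OF M]) simp
  ultimately show ?thesis by simp
qed

text \<open>
  An index \<open>j\<close> outside \<open>R\<close> pairs each \<open>S\<close> with \<open>S\<close> together with \<open>j\<close>, and the two signs cancel.
\<close>

lemma signed_sum_supersets:
  assumes K: "finite K" and R: "R \<subseteq> K"
  shows "(\<Sum>S\<in>Pow K. if R \<subseteq> S then (- 1) ^ (card K + card S) else 0) = (if R = K then 1 else 0 :: real)"
proof (cases "R = K")
  case True
  have "(\<Sum>S\<in>Pow K. if R \<subseteq> S then (- 1) ^ (card K + card S) else 0)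
      = (\<Sum>S\<in>Pow K. if S = K then 1 else (0::real))"
    using True by (intro sum.cong refl) (auto simp flip: mult_2)
  then show ?thesis using True K by (simp add: sum.delta)
next
  case False
  then obtain j where j: "j \<in> K" "j \<notin> R" using R by blast
  define L where "L = K - {j}"
  have KL: "K = insert j L" "j \<notin> L" "finite L" using j K by (auto simp: L_def)
  let ?t = "\<lambda>S. if R \<subseteq> S then (- 1) ^ (card K + card S) else (0::real)"
  have "sum ?t (Pow K) = sum ?t (Pow L) + sum ?t (insert j ` Pow L)"
    unfolding KL(1) Pow_insert using KL by (intro sum.union_disjoint) auto
  also have "sum ?t (insert j ` Pow L) = (\<Sum>S\<in>Pow L. ?t (insert j S))"
    using KL(2) by (intro sum.reindex_cong[OF _ refl refl]) (auto simp: inj_on_def)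
  also have "\<dots> = (\<Sum>S\<in>Pow L. - ?t S)"
  proof (intro sum.cong refl)
    fix S assume "S \<in> Pow L"
    then have "finite S" "j \<notin> S" using KL finite_subset by auto
    then show "?t (insert j S) = - ?t S" using j by auto
  qed
  finally show ?thesis using False by (simp add: sum_negf)
qed

text \<open>
  Expanding the left-hand side over maps \<open>\<phi>\<close> of the index set into itself, the alternating signs kill
  every \<open>\<phi>\<close> that is not a permutation, and by symmetry each permutation contributes \<open>T y\<close>.
\<close>

lemma polarization:
  assumes M: "multilinear_op k scalars T" and sym: "symmetric_op k T"
  shows "(\<Sum>S\<in>Pow {..<k}. (- 1) ^ (k + card S) * T (\<lambda>_. sum y S)) = fact k * T y"
proof -
  let ?K = "{..<k}" let ?\<Phi> = "?K \<rightarrow>\<^sub>E ?K"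
  have fin: "finite ?\<Phi>" by (simp add: finite_PiE)
  have "T (\<lambda>_. sum y S) = (\<Sum>\<phi>\<in>?\<Phi>. if \<phi> ` ?K \<subseteq> S then T (\<lambda>i. y (\<phi> i)) else 0)" if "S \<subseteq> ?K" for S
  proof -
    have "T (\<lambda>_. sum y S) = (\<Sum>\<phi>\<in>?K \<rightarrow>\<^sub>E S. T (\<lambda>i. y (\<phi> i)))"
      using that finite_subset by (intro multilinear_form_expand[OF M]) auto
    also have "?K \<rightarrow>\<^sub>E S = {\<phi> \<in> ?\<Phi>. \<phi> ` ?K \<subseteq> S}" using that by (auto simp: PiE_def)
    also have "(\<Sum>\<phi>\<in>\<dots>. T (\<lambda>i. y (\<phi> i))) = (\<Sum>\<phi>\<in>?\<Phi>. if \<phi> ` ?K \<subseteq> S then T (\<lambda>i. y (\<phi> i)) else 0)"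
      by (rule sum.inter_filter[OF fin])
    finally show ?thesis .
  qed
  then have "(\<Sum>S\<in>Pow ?K. (- 1) ^ (k + card S) * T (\<lambda>_. sum y S))
      = (\<Sum>S\<in>Pow ?K. \<Sum>\<phi>\<in>?\<Phi>. (if \<phi> ` ?K \<subseteq> S then (- 1) ^ (card ?K + card S) else 0) * T (\<lambda>i. y (\<phi> i)))"
    by (intro sum.cong refl) (auto simp: sum_distrib_left intro!: sum.cong)
  also have "\<dots> = (\<Sum>\<phi>\<in>?\<Phi>. (\<Sum>S\<in>Pow ?K. if \<phi> ` ?K \<subseteq> S then (- 1) ^ (card ?K + card S) else 0) * T (\<lambda>i. y (\<phi> i)))"
    by (subst sum.swap) (simp add: sum_distrib_right)
  also have "\<dots> = (\<Sum>\<phi>\<in>?\<Phi>. if \<phi> ` ?K = ?K then T (\<lambda>i. y (\<phi> i)) else 0)"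
    by (intro sum.cong refl, subst signed_sum_supersets) auto
  also have "\<dots> = (\<Sum>\<phi>\<in>{\<phi> \<in> ?\<Phi>. \<phi> ` ?K = ?K}. T (\<lambda>i. y (\<phi> i)))"
    by (rule sum.inter_filter[OF fin, symmetric])
  also have "\<dots> = (\<Sum>\<sigma>\<in>{\<sigma>. \<sigma> permutes ?K}. T y)"
  proof (rule sum.reindex_bij_witness[of _ "\<lambda>\<sigma>. restrict \<sigma> ?K" "\<lambda>\<phi> i. if i < k then \<phi> i else i"])
    fix \<phi> assume \<phi>: "\<phi> \<in> {\<phi> \<in> ?\<Phi>. \<phi> ` ?K = ?K}"
    let ?\<sigma> = "\<lambda>i. if i < k then \<phi> i else i"
    show "restrict ?\<sigma> ?K = \<phi>" using \<phi> by (auto simp: PiE_def extensional_def restrict_def)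
    have "?\<sigma> ` ?K = ?K" using \<phi> by auto
    then have "bij_betw ?\<sigma> ?K ?K" by (simp add: bij_betw_def eq_card_imp_inj_on)
    then show perm: "?\<sigma> \<in> {\<sigma>. \<sigma> permutes ?K}" 
      by (simp, intro bij_imp_permutes) auto
    have "T y = T (y \<circ> ?\<sigma>)" using sym perm by (simp add: symmetric_op_def)
    also have "\<dots> = T (\<lambda>i. y (\<phi> i))" by (rule multilinear_op_cong[OF M]) simp
    finally show "T y = T (\<lambda>i. y (\<phi> i))" .
  next
    fix \<sigma> assume \<sigma>: "\<sigma> \<in> {\<sigma>. \<sigma> permutes ?K}"
    show "(\<lambda>i. if i < k then restrict \<sigma> ?K i else i) = \<sigma>"
      using \<sigma> by (auto simp: permutes_def)
    show "restrict \<sigma> ?K \<in> {\<phi> \<in> ?\<Phi>. \<phi> ` ?K = ?K}"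
      using \<sigma> permutes_in_image[of \<sigma> ?K] by (auto simp: permutes_image)
  qed
  also have "\<dots> = fact k * T y" by (simp add: card_permutations)
  finally show ?thesis .
qed

text \<open>
  A form inherits convergence from its polynomial, since polarization expresses \<open>T n y\<close> by finitely many
  values on the diagonal.
\<close>

lemma polarization_tendsto:
  assumes "\<And>n. multilinear_op k scalars (T n)" "\<And>n. symmetric_op k (T n)"
    and "\<And>x. (\<lambda>n. T n (\<lambda>_. x)) \<longlonglongrightarrow> 0"
  shows "(\<lambda>n. T n y) \<longlonglongrightarrow> 0"
proof -
  have "(\<lambda>n. (\<Sum>S\<in>Pow {..<k}. (- 1) ^ (k + card S) * T n (\<lambda>_. sum y S)) / fact k) \<longlonglongrightarrow> 0"
    by (intro tendsto_divide_zero tendsto_null_sum tendsto_mult_right_zero assms(3))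
  then show ?thesis by (simp add: polarization[OF assms(1,2)])
qed

section \<open>Forms on disjoint weakly summable sequences\<close>

lemma weakly_summable_tendsto:
  fixes f :: "'a::real_normed_vector \<Rightarrow> real"
  assumes "weakly_summable p x" "0 < p" "bounded_linear f"
  shows "(\<lambda>n. f (x n)) \<longlonglongrightarrow> 0"
proof -
  have "(\<lambda>n. \<bar>f (x n)\<bar> powr p) \<longlonglongrightarrow> 0"
    using assms by (intro summable_LIMSEQ_zero) (simp add: weakly_summable_def)
  then have "(\<lambda>n. (\<bar>f (x n)\<bar> powr p) powr (1/p)) \<longlonglongrightarrow> 0 powr (1/p)"
    using \<open>0 < p\<close> by (intro tendsto_powr' tendsto_const) auto
  then have "(\<lambda>n. \<bar>f (x n)\<bar>) \<longlonglongrightarrow> 0" using \<open>0 < p\<close> by (simp add: powr_powr)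
  then show ?thesis by (simp add: tendsto_rabs_zero_iff)
qed

lemma weakly_summable_subseq:
  assumes "weakly_summable p x" "strict_mono r" shows "weakly_summable p (x \<circ> r)"
  unfolding weakly_summable_def
proof (intro allI impI)
  fix f :: "'a \<Rightarrow> real" assume "bounded_linear f"
  then have summable: "summable (\<lambda>n. \<bar>f (x n)\<bar> powr p)" using assms(1) by (simp add: weakly_summable_def)
  show "summable (\<lambda>n. \<bar>f ((x \<circ> r) n)\<bar> powr p)"
  proof (rule summableI_nonneg_bounded)
    fix n
    have "(\<Sum>i<n. \<bar>f ((x \<circ> r) i)\<bar> powr p) = (\<Sum>j\<in>r ` {..<n}. \<bar>f (x j)\<bar> powr p)"
      using strict_mono_on_imp_inj_on[OF assms(2)] by (subst sum.reindex) (auto intro: inj_on_subset)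
    also have "\<dots> \<le> (\<Sum>j. \<bar>f (x j)\<bar> powr p)"
      by (intro sum_le_suminf summable) auto
    finally show "(\<Sum>i<n. \<bar>f ((x \<circ> r) i)\<bar> powr p) \<le> (\<Sum>j. \<bar>f (x j)\<bar> powr p)" .
  qed simp
qed

lemma disjoint_sequence_subseq:
  assumes "disjoint_sequence x" "strict_mono r" shows "disjoint_sequence (x \<circ> r)"
  using assms strict_mono_eq[OF assms(2)] by (simp add: disjoint_sequence_def)

lemma disjoint_DP_star_diagonal:
  fixes x :: "nat \<Rightarrow> 'a::banach_lattice" and f :: "nat \<Rightarrow> 'a \<Rightarrow> real"
  assumes DP: "disjoint_DP_star TYPE('a) p" and "0 < p"
    and x: "disjoint_sequence x" "weakly_summable p x"
    and f: "\<And>n. bounded_linear (f n)" "bounded_linear g" "\<And>y. (\<lambda>n. f n y) \<longlonglongrightarrow> g y"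
  shows "(\<lambda>n. f n (x n)) \<longlonglongrightarrow> 0"
proof -
  have "limited_set (range x)" using DP x by (simp add: disjoint_DP_star_def)
  moreover have "bounded_linear (\<lambda>y. f n y - g y)" for n using f by (intro bounded_linear_sub)
  moreover have "(\<lambda>n. f n y - g y) \<longlonglongrightarrow> 0" for y using f(3) by (simp add: LIM_zero)
  ultimately have u: "uniform_limit (range x) (\<lambda>n y. f n y - g y) (\<lambda>_. 0) sequentially"
    by (simp add: limited_set_def)
  have "(\<lambda>n. f n (x n) - g (x n)) \<longlonglongrightarrow> 0"
  proof (rule tendstoI)
    fix e :: real assume "0 < e"
    from uniform_limitD[OF u this]
    show "\<forall>\<^sub>F n in sequentially. dist (f n (x n) - g (x n)) 0 < e"
      by eventually_elim blast
  qed
  moreover have "(\<lambda>n. g (x n)) \<longlonglongrightarrow> 0" by (rule weakly_summable_tendsto[OF x(2) \<open>0 < p\<close> f(2)])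
  ultimately show ?thesis using tendsto_add by fastforce
qed

text \<open>
  The arguments are filled with \<open>x n\<close> one at a time.  With all other arguments fixed, the next free slot
  carries a weakly* convergent sequence of functionals, and a limited set turns its values at \<open>x n\<close>
  into a null sequence; this null sequence says that the functionals of the following slot converge
  weakly* to zero.
\<close>

lemma disjoint_DP_star_forms_tendsto:
  fixes x :: "nat \<Rightarrow> 'a::banach_lattice"
  assumes DP: "disjoint_DP_star TYPE('a) p" and "0 < p" and "1 \<le> k"
    and x: "disjoint_sequence x" "weakly_summable p x"
    and T: "\<And>n. separately_bounded_linear k (T n)" "separately_bounded_linear k S"
      "\<And>y. (\<lambda>n. T n y) \<longlonglongrightarrow> S y"
    and local: "\<And>n y z. (\<And>i. i < k \<Longrightarrow> y i = z i) \<Longrightarrow> T n y = T n z"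
  shows "(\<lambda>n. T n (\<lambda>_. x n)) \<longlonglongrightarrow> 0"
proof -
  \<comment> \<open>the limit once \<open>m\<close> slots are filled: only for the first slot can the weak* limit of the functionals be nonzero\<close>
  define L where "L m y = (if m = 0 then S y else 0)" for m :: nat and y
  have L: "bounded_linear (\<lambda>z. L m (y(i := z)))" if "i < k" for m y i
    using T(2) that by (cases m) (simp_all add: L_def separately_bounded_linear_def)
  have "(\<lambda>n. T n (\<lambda>i. if i < m then x n else y i)) \<longlonglongrightarrow> L m y" if "m \<le> k" for m y
    using that
  proof (induction m arbitrary: y)
    case 0
    then show ?case using T(3)[of y] by (simp add: L_def)
  next
    case (Suc m)
    let ?f = "\<lambda>n z. T n ((\<lambda>i. if i < m then x n else y i)(m := z))"
    have "(\<lambda>n. ?f n (x n)) \<longlonglongrightarrow> 0"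
    proof (rule disjoint_DP_star_diagonal[OF DP \<open>0 < p\<close> x, where f = ?f and g = "\<lambda>z. L m (y(m := z))"])
      show "bounded_linear (?f n)" for n
        using T(1) Suc.prems by (simp add: separately_bounded_linear_def)
      show "bounded_linear (\<lambda>z. L m (y(m := z)))" using L Suc.prems by simp
      have "?f n z = T n (\<lambda>i. if i < m then x n else (y(m := z)) i)" for n z
        by (intro arg_cong[of _ _ "T n"]) auto
      then show "(\<lambda>n. ?f n z) \<longlonglongrightarrow> L m (y(m := z))" for z
        using Suc.IH[of "y(m := z)"] Suc.prems by (simp add: fun_upd_def)
    qed
    moreover have "?f n (x n) = T n (\<lambda>i. if i < Suc m then x n else y i)" for n
      by (intro arg_cong[of _ _ "T n"]) auto
    ultimately show ?case by (simp add: L_def)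
  qed
  from this[of k "\<lambda>_. 0"] have "(\<lambda>n. T n (\<lambda>i. if i < k then x n else 0)) \<longlonglongrightarrow> 0"
    using \<open>1 \<le> k\<close> by (simp add: L_def)
  moreover have "T n (\<lambda>i. if i < k then x n else 0) = T n (\<lambda>_. x n)" for n by (rule local) simp
  ultimately show ?thesis by simp
qed

section \<open>Norming functionals\<close>

context banach_lattice_on
begin

definition sublinear :: "('b \<Rightarrow> real) \<Rightarrow> bool" where
  "sublinear q \<longleftrightarrow>
     (\<forall>x\<in>car F. \<forall>y\<in>car F. q (vadd F x y) \<le> q x + q y) \<and>
     (\<forall>x\<in>car F. \<forall>a\<ge>0. q (vscale F a x) \<le> a * q x) \<and>
     (\<forall>x. x \<notin> car F \<longrightarrow> q x = 0)"

lemma sublinear_scale: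
  assumes q: "sublinear q" and x: "x \<in> car F" and a: "0 \<le> a"
  shows "q (vscale F a x) = a * q x"
proof (cases "a = 0")
  case True
  have "q (vscale F 0 x) \<le> 0" using q x by (fastforce simp: sublinear_def)
  moreover have "q (vzero F) \<le> q (vzero F) + q (vzero F)"
    using q zero_closed add_zero[OF zero_closed] unfolding sublinear_def by metis
  ultimately show ?thesis using True x by (simp add: vscale_zero)
next
  case False
  have "q x = q (vscale F (1/a) (vscale F a x))" using False x by (simp add: scale_scale scale_one)
  also have "\<dots> \<le> 1/a * q (vscale F a x)"
    using q scale_closed[OF x] a unfolding sublinear_def by (metis zero_le_divide_1_iff)
  finally have "a * q x \<le> q (vscale F a x)" using False a by (simp add: field_simps)
  moreover have "q (vscale F a x) \<le> a * q x" using q x a by (simp add: sublinear_def)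
  ultimately show ?thesis by simp
qed

lemma sublinear_uminus:
  assumes q: "sublinear q" and x: "x \<in> car F"
  shows "- q (vscale F (- 1) x) \<le> q x"
proof -
  have "q (vadd F x (vscale F (- 1) x)) \<le> q x + q (vscale F (- 1) x)"
    using q x scale_closed unfolding sublinear_def by blast
  moreover have "q (vzero F) = 0" using sublinear_scale[OF q x, of 0] x by (simp add: vscale_zero)
  ultimately show ?thesis using x by (simp add: add_inverse)
qed

text \<open>
  Moving \<open>q\<close> down along the direction \<open>y\<close> as far as sublinearity allows: the result is below \<open>q\<close> and
  takes the least conceivable value \<open>- q y\<close> at \<open>- y\<close>.
\<close>

definition lowered :: "('b \<Rightarrow> real) \<Rightarrow> 'b \<Rightarrow> 'b \<Rightarrow> real" where
  "lowered q y x = (if x \<in> car F then INF t\<in>{0..}. q (vadd F x (vscale F t y)) - t * q y else 0)"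

context
  fixes q y assumes q: "sublinear q" and y: "y \<in> car F"
begin

lemma lowered_bdd_below:
  assumes x: "x \<in> car F"
  shows "bdd_below ((\<lambda>t. q (vadd F x (vscale F t y)) - t * q y) ` {0..})"
proof (rule bdd_belowI2[of _ "- q (vscale F (- 1) x)"])
  fix t :: real assume t: "t \<in> {0..}"
  let ?ty = "vscale F t y" and ?mx = "vscale F (- 1) x"
  have cl: "?ty \<in> car F" "?mx \<in> car F" "vadd F x ?ty \<in> car F" using x y by (simp_all add: scale_closed add_closed)
  have "vadd F (vadd F x ?ty) ?mx = vadd F (vadd F ?ty x) ?mx" using x cl by (simp add: add_commute)
  also have "\<dots> = ?ty" using x cl by (simp add: add_assoc add_inverse add_zero)
  finally have "t * q y = q (vadd F (vadd F x ?ty) ?mx)" using sublinear_scale[OF q y, of t] t by simp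
  also have "\<dots> \<le> q (vadd F x ?ty) + q ?mx" using q cl unfolding sublinear_def by blast
  finally show "- q ?mx \<le> q (vadd F x ?ty) - t * q y" by simp
qed

lemma lowered_le_shift:
  "x \<in> car F \<Longrightarrow> 0 \<le> t \<Longrightarrow> lowered q y x \<le> q (vadd F x (vscale F t y)) - t * q y"
  by (simp add: lowered_def cINF_lower[OF lowered_bdd_below])

lemma le_lowered:
  "x \<in> car F \<Longrightarrow> (\<And>t. 0 \<le> t \<Longrightarrow> c \<le> q (vadd F x (vscale F t y)) - t * q y) \<Longrightarrow> c \<le> lowered q y x"
  by (auto simp: lowered_def intro!: cINF_greatest)

lemma lowered_le: "x \<in> car F \<Longrightarrow> lowered q y x \<le> q x"
  using lowered_le_shift[of x 0] y by (simp add: vscale_zero add_zero)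

lemma lowered_uminus: "lowered q y (vscale F (- 1) y) \<le> - q y"
proof -
  have "vadd F (vscale F (- 1) y) (vscale F 1 y) = vzero F"
    using y by (simp add: scale_one add_commute scale_closed add_inverse)
  moreover have "q (vzero F) = 0" using sublinear_scale[OF q y, of 0] y by (simp add: vscale_zero)
  ultimately show ?thesis using lowered_le_shift[of "vscale F (- 1) y" 1] y by (simp add: scale_closed)
qed

lemma sublinear_lowered: "sublinear (lowered q y)"
  unfolding sublinear_def
proof (intro conjI ballI allI impI)
  fix x z assume xz: "x \<in> car F" "z \<in> car F"
  have *: "lowered q y (vadd F x z) \<le> (q (vadd F x (vscale F s y)) - s * q y) + (q (vadd F z (vscale F t y)) - t * q y)"
    if "0 \<le> s" "0 \<le> t" for s t
  proof -
    let ?s = "vscale F s y" and ?t = "vscale F t y"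
    have cl: "?s \<in> car F" "?t \<in> car F" "vadd F z ?s \<in> car F" "vadd F z ?t \<in> car F" "vadd F x ?s \<in> car F"
      "vadd F ?s ?t \<in> car F" using xz y by (simp_all add: scale_closed add_closed)
    have "vadd F (vadd F x z) (vscale F (s + t) y) = vadd F x (vadd F (vadd F z ?s) ?t)"
      using xz y cl by (simp add: scale_left_distrib add_assoc)
    also have "vadd F z ?s = vadd F ?s z" using xz cl by (simp add: add_commute)
    also have "vadd F x (vadd F (vadd F ?s z) ?t) = vadd F (vadd F x ?s) (vadd F z ?t)"
      using xz cl by (simp add: add_assoc)
    finally have "lowered q y (vadd F x z) \<le> q (vadd F (vadd F x ?s) (vadd F z ?t)) - (s + t) * q y"
      using lowered_le_shift[of "vadd F x z" "s + t"] that xz by (simp add: add_closed)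
    also have "q (vadd F (vadd F x ?s) (vadd F z ?t)) \<le> q (vadd F x ?s) + q (vadd F z ?t)"
      using q cl unfolding sublinear_def by blast
    finally show ?thesis by (simp add: algebra_simps)
  qed
  have "lowered q y (vadd F x z) - (q (vadd F z (vscale F t y)) - t * q y) \<le> lowered q y x" if "0 \<le> t" for t
    using *[OF _ that] by (intro le_lowered xz) (simp add: algebra_simps)
  then have "lowered q y (vadd F x z) - lowered q y x \<le> lowered q y z"
    by (intro le_lowered xz) (simp add: algebra_simps)
  then show "lowered q y (vadd F x z) \<le> lowered q y x + lowered q y z" by simp
next
  fix x :: 'b and a :: real assume x: "x \<in> car F" and a: "0 \<le> a"
  show "lowered q y (vscale F a x) \<le> a * lowered q y x"
  proof (cases "a = 0")
    case True
    then show ?thesis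
      using lowered_le[of "vzero F"] sublinear_scale[OF q x, of 0] x by (simp add: vscale_zero zero_closed)
  next
    case False
    have "lowered q y (vscale F a x) / a \<le> q (vadd F x (vscale F t y)) - t * q y" if t: "0 \<le> t" for t
    proof -
      have "lowered q y (vscale F a x) \<le> q (vadd F (vscale F a x) (vscale F (a * t) y)) - (a * t) * q y"
        using a t x by (intro lowered_le_shift) (auto simp: scale_closed)
      also have "vadd F (vscale F a x) (vscale F (a * t) y) = vscale F a (vadd F x (vscale F t y))"
        using x y by (simp add: scale_right_distrib scale_closed scale_scale)
      also have "q \<dots> = a * q (vadd F x (vscale F t y))"
        using x y a by (intro sublinear_scale q) (auto simp: add_closed scale_closed)
      finally show ?thesis using False a by (simp add: field_simps)
    qed
    then have "lowered q y (vscale F a x) / a \<le> lowered q y x" by (intro le_lowered x)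
    then show ?thesis using False a by (simp add: field_simps)
  qed
qed (simp add: lowered_def)

end

text \<open>
  A minimal sublinear functional equals each of its lowered versions, hence is additive.  Zorn's lemma
  supplies a minimal one below any given sublinear functional.
\<close>

lemma hahn_banach_sublinear:
  assumes p: "sublinear p"
  shows "\<exists>f. linear_functional F f \<and> (\<forall>x\<in>car F. f x \<le> p x)"
proof -
  define A where "A = {q. sublinear q \<and> (\<forall>x. q x \<le> p x)}"
  define ge where "ge a b \<longleftrightarrow> (\<forall>x. b x \<le> a x)" for a b :: "'b \<Rightarrow> real"
  have pA: "p \<in> A" using p by (simp add: A_def)
  have "\<exists>m\<in>A. \<forall>a\<in>A. ge m a \<longrightarrow> a = m"
  proof (rule predicate_Zorn)
    show "partial_order_on A (relation_of ge A)"
      by (rule partial_order_on_relation_ofI) (auto simp: ge_def fun_eq_iff intro: order_trans order.antisym)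
  next
    fix C assume "C \<in> Chains (relation_of ge A)"
    then have CA: "C \<subseteq> A" and chain: "\<And>a b. a \<in> C \<Longrightarrow> b \<in> C \<Longrightarrow> ge a b \<or> ge b a"
      by (auto simp: Chains_def relation_of_def)
    show "\<exists>u\<in>A. \<forall>a\<in>C. ge a u"
    proof (cases "C = {}")
      case True
      then show ?thesis using pA by blast
    next
      case False
      define u where "u x = (INF q\<in>C. q x)" for x
      have sub: "sublinear c" if "c \<in> C" for c using CA that by (auto simp: A_def)
      have bdd: "bdd_below ((\<lambda>q. q x) ` C)" for x
      proof (cases "x \<in> car F")
        case True
        show ?thesis
        proof (rule bdd_belowI2)
          fix c assume c: "c \<in> C"
          have "c (vscale F (- 1) x) \<le> p (vscale F (- 1) x)" using CA c by (auto simp: A_def)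
          then show "- p (vscale F (- 1) x) \<le> c x" using sublinear_uminus[OF sub[OF c] True] by simp
        qed
      next
        case False
        then have "c x = 0" if "c \<in> C" for c using sub[OF that] by (simp add: sublinear_def)
        then show ?thesis by (intro bdd_belowI2[of _ 0]) (metis order_refl)
      qed
      have u_le: "u x \<le> c x" if "c \<in> C" for x c unfolding u_def by (intro cINF_lower bdd that)
      have le_u: "d \<le> u x" if "\<And>c. c \<in> C \<Longrightarrow> d \<le> c x" for x d
        unfolding u_def using False that by (rule cINF_greatest)
      have "sublinear u"
        unfolding sublinear_def
      proof (intro conjI ballI allI impI)
        fix x y assume xy: "x \<in> car F" "y \<in> car F"
        have *: "u (vadd F x y) \<le> c x + d y" if cd: "c \<in> C" "d \<in> C" for c d
        proof -
          obtain e where e: "e \<in> C" "ge c e" "ge d e" using chain[OF cd] cd by (auto simp: ge_def)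
          have "u (vadd F x y) \<le> e (vadd F x y)" by (rule u_le[OF e(1)])
          also have "\<dots> \<le> e x + e y" using sub[OF e(1)] xy by (simp add: sublinear_def)
          also have "\<dots> \<le> c x + d y" using e(2)[unfolded ge_def, rule_format, of x] e(3)[unfolded ge_def, rule_format, of y] by linarith
          finally show ?thesis .
        qed
        have "u (vadd F x y) - d y \<le> u x" if "d \<in> C" for d
          using *[OF _ that] by (intro le_u) (simp add: algebra_simps)
        then have "u (vadd F x y) - u x \<le> u y" by (intro le_u) (simp add: algebra_simps)
        then show "u (vadd F x y) \<le> u x + u y" by simp
      next
        fix x :: 'b and a :: real assume x: "x \<in> car F" and a: "0 \<le> a"
        have *: "u (vscale F a x) \<le> a * c x" if "c \<in> C" for c
          using u_le[OF that, of "vscale F a x"] sublinear_scale[OF sub[OF that] x a] by simp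
        show "u (vscale F a x) \<le> a * u x"
        proof (cases "a = 0")
          case True
          then show ?thesis using * False by auto
        next
          case False
          then have "u (vscale F a x) / a \<le> u x" using * a by (intro le_u) (simp add: field_simps)
          then show ?thesis using False a by (simp add: field_simps)
        qed
      next
        fix x assume "x \<notin> car F"
        then have "(\<lambda>q. q x) ` C = {0}" using sub False by (force simp: sublinear_def)
        then show "u x = 0" by (simp add: u_def)
      qed
      moreover have "u x \<le> p x" for x
      proof -
        obtain c where c: "c \<in> C" using False by blast
        then have "c x \<le> p x" using CA by (auto simp: A_def)
        then show ?thesis using u_le[OF c, of x] by simp
      qed
      ultimately have "u \<in> A" by (simp add: A_def)
      then show ?thesis using u_le by (auto simp: ge_def)
    qed
  qed
  then obtain f where f: "sublinear f" "\<And>x. f x \<le> p x" and min: "\<And>a. a \<in> A \<Longrightarrow> ge f a \<Longrightarrow> a = f"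
    by (auto simp: A_def)
  have low: "lowered f y = f" if "y \<in> car F" for y
  proof (rule min)
    have le: "lowered f y x \<le> f x" for x
      using lowered_le[OF f(1) that] f(1) by (cases "x \<in> car F") (auto simp: sublinear_def lowered_def)
    then show "ge f (lowered f y)" by (simp add: ge_def)
    have "lowered f y x \<le> p x" for x using le[of x] f(2)[of x] by simp
    then show "lowered f y \<in> A" using sublinear_lowered[OF f(1) that] by (simp add: A_def)
  qed
  have neg: "f (vscale F (- 1) y) = - f y" if "y \<in> car F" for y
    using lowered_uminus[OF f(1) that] sublinear_uminus[OF f(1) that] by (simp add: low that)
  have "linear_functional F f"
    unfolding linear_functional_def
  proof (intro conjI ballI allI)
    fix x y assume xy: "x \<in> car F" "y \<in> car F"
    have "f x \<le> f (vadd F x y) - f y"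
      using lowered_le_shift[OF f(1) xy(2,1), of 1] xy by (simp add: low scale_one)
    moreover have "f (vadd F x y) \<le> f x + f y" using f(1) xy by (simp add: sublinear_def)
    ultimately show "f (vadd F x y) = f x + f y" by simp
  next
    fix x :: 'b and a :: real assume x: "x \<in> car F"
    show "f (vscale F a x) = a * f x"
    proof (cases "0 \<le> a")
      case False
      have "f (vscale F a x) = f (vscale F (- 1) (vscale F (- a) x))" using x by (simp add: scale_scale)
      also have "\<dots> = - (- a * f x)"
        using False x by (subst neg) (simp_all add: scale_closed sublinear_scale[OF f(1)])
      finally show ?thesis by simp
    qed (rule sublinear_scale[OF f(1) x])
  qed
  then show ?thesis using f(2) by blast
qed

text \<open>
  Lowering the norm along \<open>v\<close> before applying the Hahn-Banach argument forces \<open>f (- v) \<le> - \<parallel>v\<parallel>\<close>, so the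
  dominated functional attains the norm at \<open>v\<close>.
\<close>

lemma norming_functional:
  assumes v: "v \<in> car F"
  shows "\<exists>f\<in>dual_ball F. f v = vnorm F v"
proof -
  define p where "p x = (if x \<in> car F then vnorm F x else 0)" for x
  have p: "sublinear p"
    unfolding sublinear_def p_def by (simp add: add_closed scale_closed norm_triangle norm_scale)
  obtain f where lin: "linear_functional F f" and f: "\<And>x. x \<in> car F \<Longrightarrow> f x \<le> lowered p v x"
    using hahn_banach_sublinear[OF sublinear_lowered[OF p v]] by blast
  have le: "f x \<le> vnorm F x" if "x \<in> car F" for x
    using f[OF that] lowered_le[OF p v that] that by (simp add: p_def)
  have neg: "f (vscale F (- 1) x) = - f x" if "x \<in> car F" for x
    using lin that by (simp add: linear_functional_def)
  have abs: "\<bar>f x\<bar> \<le> vnorm F x" if "x \<in> car F" for x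
    using le[OF that] le[OF scale_closed[OF that, of "- 1"]] that by (simp add: neg vnorm_uminus abs_le_iff)
  then have "f \<in> dual_ball F"
    using lin by (auto simp: dual_ball_def dual_def intro!: exI[of _ 1])
  moreover have "f v = vnorm F v"
    using f[OF scale_closed[OF v, of "- 1"]] lowered_uminus[OF p v] le[OF v] v by (simp add: neg p_def)
  ultimately show ?thesis by blast
qed

end

section \<open>The space of null sequences\<close>

lemma c0_simps [simp]:
  "x \<in> car c0 \<longleftrightarrow> x \<longlonglongrightarrow> 0" "vadd c0 x y = (\<lambda>n. x n + y n)" "vzero c0 = (\<lambda>_. 0)"
  "vscale c0 a x = (\<lambda>n. a * x n)" "vle c0 x y \<longleftrightarrow> (\<forall>n. x n \<le> y n)" "vnorm c0 x = (SUP n. \<bar>x n\<bar>)"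
  "vminus c0 x y = (\<lambda>n. x n - y n)"
  by (simp_all add: c0_def vminus_def)

lemma c0_abs_le_norm: "x \<longlonglongrightarrow> 0 \<Longrightarrow> \<bar>x n\<bar> \<le> vnorm c0 x"
  using cSUP_upper[OF UNIV_I c0_bdd, of x n] by simp

lemma c0_norm_le: "(\<And>n. \<bar>x n\<bar> \<le> e) \<Longrightarrow> vnorm c0 x \<le> e"
  by (simp add: cSUP_least)

definition c0_unit :: "nat \<Rightarrow> nat \<Rightarrow> real" where
  "c0_unit i = (\<lambda>n. if n = i then 1 else 0)"

lemma c0_unit_in: "c0_unit i \<longlonglongrightarrow> 0"
proof -
  have "\<forall>\<^sub>F n in sequentially. c0_unit i n = 0"
    using eventually_gt_at_top[of i] by eventually_elim (simp add: c0_unit_def)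
  then show ?thesis by (rule tendsto_eventually)
qed

lemma c0_truncation:
  "(\<lambda>n. \<Sum>i<N. y i * c0_unit i n) = (\<lambda>n. if n < N then y n else 0)"
  by (auto simp: c0_unit_def if_distrib[of "(*) _"] cong: if_cong)

lemma c0_truncation_functional:
  assumes "linear_functional c0 f"
  shows "f (\<lambda>n. \<Sum>i<N. y i * c0_unit i n) = (\<Sum>i<N. y i * f (c0_unit i))"
proof (induction N)
  case 0
  have "f (vscale c0 0 (\<lambda>_. 0)) = 0 * f (\<lambda>_. 0)"
    using assms unfolding linear_functional_def by (metis c0_simps(1) tendsto_const)
  then show ?case by simp
next
  case (Suc N)
  have 1: "(\<lambda>n. \<Sum>i<N. y i * c0_unit i n) \<longlonglongrightarrow> 0"
    by (intro tendsto_null_sum tendsto_mult_right_zero c0_unit_in)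
  have 2: "(\<lambda>n. y N * c0_unit N n) \<longlonglongrightarrow> 0"
    by (intro tendsto_mult_right_zero c0_unit_in)
  have "f (\<lambda>n. (\<Sum>i<N. y i * c0_unit i n) + y N * c0_unit N n)
      = f (\<lambda>n. \<Sum>i<N. y i * c0_unit i n) + f (\<lambda>n. y N * c0_unit N n)"
    using assms 1 2 by (simp add: linear_functional_def)
  also have "f (\<lambda>n. y N * c0_unit N n) = y N * f (c0_unit N)"
    using assms c0_unit_in[of N] by (simp add: linear_functional_def)
  finally show ?case using Suc by simp
qed

text \<open>
  Bounded functionals on this separable space are determined by their values at the unit vectors;
  a diagonal subsequence converges at each of them, and truncation extends the convergence to every
  null sequence.
\<close>

lemma c0_dual_ball_compact: "dual_ball_seq_weak_star_compact c0"
  unfolding dual_ball_seq_weak_star_compact_def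
proof (intro allI impI)
  fix f :: "nat \<Rightarrow> (nat \<Rightarrow> real) \<Rightarrow> real" assume f: "\<forall>n. f n \<in> dual_ball c0"
  have lin: "linear_functional c0 (f n)" for n using f by (simp add: dual_ball_def dual_def)
  have le: "\<bar>f n y\<bar> \<le> vnorm c0 y" if "y \<longlonglongrightarrow> 0" for n y using f that by (simp add: dual_ball_def)
  have "vnorm c0 (c0_unit i) \<le> 1" for i by (rule c0_norm_le) (simp add: c0_unit_def)
  then have unit_le: "\<bar>f n (c0_unit i)\<bar> \<le> 1" for n i using le[OF c0_unit_in] order_trans by blast
  obtain r :: "nat \<Rightarrow> nat" where r: "strict_mono r"
    and unit: "\<And>x. x \<in> range c0_unit \<Longrightarrow> \<exists>l. (\<lambda>n. f (r n) x) \<longlonglongrightarrow> l"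
    by (rule function_convergent_subsequence[of "range c0_unit" f 1]) (use unit_le in auto)
  then obtain l where l: "\<And>i. (\<lambda>n. f (r n) (c0_unit i)) \<longlonglongrightarrow> l i" by (metis rangeI)
  have conv: "convergent (\<lambda>n. f (r n) y)" if y: "y \<longlonglongrightarrow> 0" for y
  proof -
    have "Cauchy (\<lambda>n. f (r n) y)"
    proof (rule metric_CauchyI)
      fix e :: real assume e: "0 < e"
      then obtain N where N: "\<And>n. n \<ge> N \<Longrightarrow> \<bar>y n\<bar> < e/4"
        using LIMSEQ_D[OF y, of "e/4"] by auto
      let ?t = "\<lambda>n. \<Sum>i<N. y i * c0_unit i n"
      have t: "?t \<longlonglongrightarrow> 0" by (intro tendsto_null_sum tendsto_mult_right_zero c0_unit_in)
      have d: "(\<lambda>n. y n - ?t n) \<longlonglongrightarrow> 0" using tendsto_diff[OF y t] by simp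
      have "\<bar>y n - ?t n\<bar> \<le> e/4" for n
        using N[of n] e fun_cong[OF c0_truncation[of y N], of n] by auto
      then have small: "vnorm c0 (\<lambda>n. y n - ?t n) \<le> e/4" by (rule c0_norm_le)
      have near: "\<bar>f n y - f n ?t\<bar> \<le> e/4" for n
      proof -
        have "f n (\<lambda>i. (y i - ?t i) + ?t i) = f n (\<lambda>i. y i - ?t i) + f n ?t"
          using lin[of n, unfolded linear_functional_def, THEN conjunct1, rule_format, of "\<lambda>i. y i - ?t i" ?t] d t
          by simp
        then show ?thesis using le[OF d, of n] small by simp
      qed
      have "(\<lambda>n. f (r n) ?t) \<longlonglongrightarrow> (\<Sum>i<N. y i * l i)"
        unfolding c0_truncation_functional[OF lin] by (intro tendsto_intros l)
      then have "Cauchy (\<lambda>n. f (r n) ?t)" by (rule LIMSEQ_imp_Cauchy)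
      then obtain M where M: "\<And>m n. m \<ge> M \<Longrightarrow> n \<ge> M \<Longrightarrow> \<bar>f (r m) ?t - f (r n) ?t\<bar> < e/2"
        using e unfolding Cauchy_def dist_real_def by (meson half_gt_zero)
      have "dist (f (r m) y) (f (r n) y) < e" if "m \<ge> M" "n \<ge> M" for m n
        using M[OF that] near[of "r m"] near[of "r n"] unfolding dist_real_def by linarith
      then show "\<exists>M. \<forall>m\<ge>M. \<forall>n\<ge>M. dist (f (r m) y) (f (r n) y) < e" by blast
    qed
    then show ?thesis by (rule Cauchy_convergent)
  qed
  define g where "g y = lim (\<lambda>n. f (r n) y)" for y
  have g: "(\<lambda>n. f (r n) y) \<longlonglongrightarrow> g y" if "y \<longlonglongrightarrow> 0" for y
    using conv[OF that] by (simp add: g_def convergent_LIMSEQ_iff)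
  have "linear_functional c0 g"
    unfolding linear_functional_def
  proof (intro conjI ballI allI)
    fix x y assume xy: "x \<in> car c0" "y \<in> car c0"
    then have "(\<lambda>n. f (r n) x + f (r n) y) \<longlonglongrightarrow> g x + g y" by (intro tendsto_add g) auto
    moreover have "(\<lambda>n. f (r n) x + f (r n) y) \<longlonglongrightarrow> g (vadd c0 x y)"
      using g[of "vadd c0 x y"] lin xy by (simp add: linear_functional_def tendsto_add_zero)
    ultimately show "g (vadd c0 x y) = g x + g y" using LIMSEQ_unique by blast
  next
    fix x and a :: real assume x: "x \<in> car c0"
    then have "(\<lambda>n. a * f (r n) x) \<longlonglongrightarrow> a * g x" by (intro tendsto_mult_left g) auto
    moreover have "(\<lambda>n. a * f (r n) x) \<longlonglongrightarrow> g (vscale c0 a x)"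
      using g[of "vscale c0 a x"] lin x by (simp add: linear_functional_def tendsto_mult_right_zero)
    ultimately show "g (vscale c0 a x) = a * g x" using LIMSEQ_unique by blast
  qed
  moreover have "\<bar>g y\<bar> \<le> vnorm c0 y" if y: "y \<longlonglongrightarrow> 0" for y
    by (rule LIMSEQ_le_const2[OF tendsto_rabs[OF g[OF y]]]) (use le[OF y] in blast)
  ultimately have "g \<in> dual_ball c0"
    by (auto simp: dual_ball_def dual_def intro!: exI[of _ 1])
  then show "\<exists>g\<in>dual_ball c0. \<exists>r. strict_mono r \<and> (\<forall>y\<in>car c0. (\<lambda>n. f (r n) y) \<longlonglongrightarrow> g y)"
    using r g by (intro bexI[of _ g] exI[of _ r]) auto
qed

section \<open>Copies of a Banach lattice\<close>

text \<open>
  The space of null sequences has to be found among the Banach lattices over a prescribed type, of which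
  only the cardinality is known.  The structure is therefore carried over along an injection of the
  carrier into that type.
\<close>

definition transported :: "('b \<Rightarrow> 'c) \<Rightarrow> 'b normed_lattice \<Rightarrow> 'c normed_lattice" where
  "transported \<iota> F = (let \<kappa> = inv_into (car F) \<iota> in
     \<lparr>car = \<iota> ` car F, vadd = (\<lambda>x y. \<iota> (vadd F (\<kappa> x) (\<kappa> y))), vzero = \<iota> (vzero F),
      vscale = (\<lambda>a x. \<iota> (vscale F a (\<kappa> x))), vle = (\<lambda>x y. vle F (\<kappa> x) (\<kappa> y)),
      vnorm = (\<lambda>x. vnorm F (\<kappa> x))\<rparr>)"

locale transport = banach_lattice_on F for F :: "'b normed_lattice" +
  fixes \<iota> :: "'b \<Rightarrow> 'c"
  assumes inj: "inj_on \<iota> (car F)"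
begin

abbreviation "G \<equiv> transported \<iota> F"

lemma car_G: "car G = \<iota> ` car F" by (simp add: transported_def Let_def)

lemma ops_G [simp]:
  "x \<in> car F \<Longrightarrow> y \<in> car F \<Longrightarrow> vadd G (\<iota> x) (\<iota> y) = \<iota> (vadd F x y)"
  "vzero G = \<iota> (vzero F)"
  "x \<in> car F \<Longrightarrow> vscale G a (\<iota> x) = \<iota> (vscale F a x)"
  "x \<in> car F \<Longrightarrow> y \<in> car F \<Longrightarrow> vle G (\<iota> x) (\<iota> y) = vle F x y"
  "x \<in> car F \<Longrightarrow> vnorm G (\<iota> x) = vnorm F x"
  using inj by (simp_all add: transported_def Let_def)

lemma minus_G [simp]: "x \<in> car F \<Longrightarrow> y \<in> car F \<Longrightarrow> vminus G (\<iota> x) (\<iota> y) = \<iota> (vminus F x y)"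
  by (simp add: vminus_def scale_closed)

lemma \<iota>_eq [simp]: "x \<in> car F \<Longrightarrow> y \<in> car F \<Longrightarrow> \<iota> x = \<iota> y \<longleftrightarrow> x = y"
  using inj by (auto dest: inj_onD)

lemma is_sup_G: "x \<in> car F \<Longrightarrow> y \<in> car F \<Longrightarrow> s \<in> car F \<Longrightarrow> is_sup G (\<iota> x) (\<iota> y) (\<iota> s) \<longleftrightarrow> is_sup F x y s"
  by (auto simp: is_sup_def car_G)

lemma is_inf_G: "x \<in> car F \<Longrightarrow> y \<in> car F \<Longrightarrow> s \<in> car F \<Longrightarrow> is_inf G (\<iota> x) (\<iota> y) (\<iota> s) \<longleftrightarrow> is_inf F x y s"
  by (auto simp: is_inf_def car_G)

lemma is_modulus_G: "x \<in> car F \<Longrightarrow> s \<in> car F \<Longrightarrow> is_modulus G (\<iota> x) (\<iota> s) \<longleftrightarrow> is_modulus F x s"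
  by (simp add: is_modulus_def is_sup_G scale_closed)

lemma is_modulus_G_image: "is_modulus G z s \<Longrightarrow> s \<in> \<iota> ` car F"
  by (simp add: is_modulus_def is_sup_def car_G)

lemma banach_lattice_on_G: "banach_lattice_on G"
proof (unfold_locales, unfold car_G)
  fix x y assume xy: "x \<in> \<iota> ` car F" "y \<in> \<iota> ` car F"
  then obtain a b where ab: "x = \<iota> a" "y = \<iota> b" "a \<in> car F" "b \<in> car F" by blast
  obtain s t where "is_sup F a b s" "is_inf F a b t" using sup_exists inf_exists ab by metis
  moreover from this have "s \<in> car F" "t \<in> car F" by (simp_all add: is_sup_def is_inf_def)
  ultimately have "is_sup G x y (\<iota> s)" "is_inf G x y (\<iota> t)" using ab by (simp_all add: is_sup_G is_inf_G)
  then show "\<exists>s. is_sup G x y s" "\<exists>s. is_inf G x y s" by blast+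
next
  fix x y s t assume xy: "x \<in> \<iota> ` car F" "y \<in> \<iota> ` car F"
    and m: "is_modulus G x s" "is_modulus G y t" "vle G s t"
  from xy obtain a b where ab: "x = \<iota> a" "y = \<iota> b" "a \<in> car F" "b \<in> car F" by blast
  from m obtain u v where uv: "s = \<iota> u" "t = \<iota> v" "u \<in> car F" "v \<in> car F"
    using is_modulus_G_image by blast
  show "vnorm G x \<le> vnorm G y" using m ab uv norm_mono[of a b u v] by (simp add: is_modulus_G)
next
  fix X :: "nat \<Rightarrow> 'c" assume X: "\<And>n. X n \<in> \<iota> ` car F"
    and C: "\<And>e. 0 < e \<Longrightarrow> \<exists>N. \<forall>m\<ge>N. \<forall>n\<ge>N. vnorm G (vminus G (X m) (X n)) < e"
  have "\<forall>n. \<exists>a. X n = \<iota> a \<and> a \<in> car F" using X by blast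
  then obtain Y where Y: "\<And>n. X n = \<iota> (Y n)" "\<And>n. Y n \<in> car F" by metis
  obtain l where l: "l \<in> car F" "(\<lambda>n. vnorm F (vminus F (Y n) l)) \<longlonglongrightarrow> 0"
    using complete[of Y] C Y by (auto simp: minus_closed)
  then show "\<exists>l\<in>\<iota> ` car F. (\<lambda>n. vnorm G (vminus G (X n) l)) \<longlonglongrightarrow> 0"
    using Y by (auto simp: minus_closed)
qed (auto simp: zero_closed add_closed scale_closed add_assoc add_zero add_inverse
      scale_right_distrib scale_left_distrib scale_scale scale_one le_refl norm_eq_zero norm_triangle
      norm_scale intro: add_commute le_trans le_antisym add_mono scale_mono)

lemma dual_ball_G: "g \<in> dual_ball G \<longleftrightarrow> g \<circ> \<iota> \<in> dual_ball F"
  by (simp add: dual_ball_def dual_def linear_functional_def car_G)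

lemma dual_ball_compact_G:
  assumes "dual_ball_seq_weak_star_compact F" shows "dual_ball_seq_weak_star_compact G"
  unfolding dual_ball_seq_weak_star_compact_def
proof (intro allI impI)
  fix f :: "nat \<Rightarrow> 'c \<Rightarrow> real" assume "\<forall>n. f n \<in> dual_ball G"
  then have "\<forall>n. f n \<circ> \<iota> \<in> dual_ball F" by (simp add: dual_ball_G)
  then obtain g r where g: "g \<in> dual_ball F" "strict_mono r"
      "\<And>y. y \<in> car F \<Longrightarrow> (\<lambda>n. (f (r n) \<circ> \<iota>) y) \<longlonglongrightarrow> g y"
    using assms[unfolded dual_ball_seq_weak_star_compact_def, rule_format, of "\<lambda>n. f n \<circ> \<iota>"] by blast
  define h where "h = g \<circ> inv_into (car F) \<iota>"
  have h: "h (\<iota> y) = g y" if "y \<in> car F" for y using that inj by (simp add: h_def)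
  have "h \<in> dual_ball G"
    using g(1) by (simp add: dual_ball_def dual_def linear_functional_def car_G h add_closed scale_closed)
  then show "\<exists>g\<in>dual_ball G. \<exists>r. strict_mono r \<and> (\<forall>y\<in>car G. (\<lambda>n. f (r n) y) \<longlonglongrightarrow> g y)"
    using g(2,3) h by (intro bexI[of _ h] exI[of _ r]) (auto simp: car_G)
qed

lemma positive_poly_G:
  assumes "positive_poly k F P" shows "positive_poly k G (\<lambda>x. \<iota> (P x))"
proof -
  obtain T where T: "associated_op k F P T" "\<And>x. (\<forall>i<k. 0 \<le> x i) \<Longrightarrow> vle F (vzero F) (T x)"
    using assms unfolding positive_poly_def by blast
  have cl: "T x \<in> car F" for x using T(1) by (simp add: associated_op_def multilinear_op_def)
  have "associated_op k G (\<lambda>x. \<iota> (P x)) (\<lambda>x. \<iota> (T x))"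
    using T(1) cl unfolding associated_op_def multilinear_op_def symmetric_op_def
    by (auto simp: car_G)
  moreover have "vle G (vzero G) (\<iota> (T x))" if "\<forall>i<k. 0 \<le> x i" for x
    using T(2)[OF that] cl zero_closed by simp
  ultimately show ?thesis unfolding positive_poly_def by blast
qed

lemma disjoint_convergent_G:
  assumes "\<And>x. P x \<in> car F"
  shows "disjoint_convergent p G (\<lambda>x. \<iota> (P x)) \<longleftrightarrow> disjoint_convergent p F P"
  using assms by (simp add: disjoint_convergent_def)

end

section \<open>Regular forms and the positive projective symmetric tensor product\<close>

lemma positive_form_bounded:
  fixes P :: "'a::banach_lattice \<Rightarrow> real"
  assumes P: "positive_poly k scalars P" and "1 \<le> k"
  obtains C where "0 \<le> C" "\<And>x. 0 \<le> x \<Longrightarrow> P x \<le> C * norm x ^ k"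
proof -
  obtain T where T: "positive_op k scalars T" and PT: "\<And>x. P x = T (\<lambda>_. x)"
    using P unfolding positive_poly_iff by blast
  show ?thesis
  proof (rule monotone_homogeneous_bounded[of P k])
    show "P x \<le> P y" if "0 \<le> x" "x \<le> y" for x y
      unfolding PT by (rule positive_form_diagonal_mono[OF T that])
    show "P (t *\<^sub>R x) = t ^ k * P x" for x t
      unfolding PT by (rule multilinear_form_diagonal_scale[of k T]) (use T in \<open>simp add: positive_op_def\<close>)
  qed (use \<open>1 \<le> k\<close> that in auto)
qed

lemma positive_poly_abs_le:
  assumes "positive_poly k scalars P" shows "\<bar>P x\<bar> \<le> P \<bar>x\<bar>"
  using assms positive_form_abs_le unfolding positive_poly_iff by fastforce

lemma positive_poly_nonneg:
  assumes "positive_poly k scalars P" "0 \<le> x" shows "0 \<le> P x"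
  using positive_poly_abs_le[OF assms(1), of x] assms(2) by simp

lemma positive_poly_at_zero:
  assumes "positive_poly k scalars P" "1 \<le> k" shows "P 0 = 0"
  using assms multilinear_form_diagonal_scale[of k _ 0 0]
  unfolding positive_poly_iff positive_op_def by (auto simp: power_0_left)

lemma positive_op_add:
  "positive_op k scalars S \<Longrightarrow> positive_op k scalars T \<Longrightarrow> positive_op k scalars (\<lambda>x. S x + T x)"
  unfolding positive_op_def multilinear_op_def by (auto simp: algebra_simps) metis

lemma positive_op_scale:
  "0 \<le> a \<Longrightarrow> positive_op k scalars T \<Longrightarrow> positive_op k scalars (\<lambda>x. a * T x)"
  unfolding positive_op_def multilinear_op_def by (auto simp: algebra_simps)

lemma positive_poly_add:
  assumes "positive_poly k scalars P" "positive_poly k scalars Q"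
  shows "positive_poly k scalars (\<lambda>x. P x + Q x)"
proof -
  obtain S T where "positive_op k scalars S" "symmetric_op k S" "\<And>x. P x = S (\<lambda>_. x)"
      "positive_op k scalars T" "symmetric_op k T" "\<And>x. Q x = T (\<lambda>_. x)"
    using assms unfolding positive_poly_iff by blast
  then show ?thesis unfolding positive_poly_iff
    by (intro exI[of _ "\<lambda>x. S x + T x"]) (simp add: positive_op_add symmetric_op_def)
qed

lemma positive_poly_scale:
  assumes "0 \<le> a" "positive_poly k scalars P"
  shows "positive_poly k scalars (\<lambda>x. a * P x)"
proof -
  obtain T where "positive_op k scalars T" "symmetric_op k T" "\<And>x. P x = T (\<lambda>_. x)"
    using assms unfolding positive_poly_iff by blast
  then show ?thesis unfolding positive_poly_iff
    by (intro exI[of _ "\<lambda>x. a * T x"]) (simp add: positive_op_scale assms(1) symmetric_op_def)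
qed

lemma positive_poly_zero: "positive_poly k scalars (\<lambda>_. 0)"
  unfolding positive_poly_iff
  by (intro exI[of _ "\<lambda>_. 0"]) (simp add: positive_op_def multilinear_op_def symmetric_op_def)

lemma regular_polys_simps [simp]:
  "P \<in> car (regular_polys k) \<longleftrightarrow> regular_poly k scalars P"
  "vadd (regular_polys k) P Q = (\<lambda>x. P x + Q x)" "vzero (regular_polys k) = (\<lambda>_. 0)"
  "vscale (regular_polys k) a P = (\<lambda>x. a * P x)"
  "vle (regular_polys k) P Q \<longleftrightarrow> positive_poly k scalars (\<lambda>x. Q x - P x)"
  by (simp_all add: regular_polys_def)

lemma regular_polyE:
  assumes "regular_poly k scalars P"
  obtains Q R where "positive_poly k scalars Q" "positive_poly k scalars R" "P = (\<lambda>x. Q x - R x)"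
  using assms unfolding regular_poly_def by auto

lemma regular_polyI:
  "positive_poly k scalars Q \<Longrightarrow> positive_poly k scalars R \<Longrightarrow> regular_poly k scalars (\<lambda>x. Q x - R x)"
  unfolding regular_poly_def by auto

lemma positive_imp_regular: "positive_poly k scalars P \<Longrightarrow> regular_poly k scalars P"
  using regular_polyI[OF _ positive_poly_zero] by simp

lemma regular_poly_add:
  assumes "regular_poly k scalars P" "regular_poly k scalars Q"
  shows "regular_poly k scalars (\<lambda>x. P x + Q x)"
proof -
  obtain P1 P2 where P: "positive_poly k scalars P1" "positive_poly k scalars P2" "P = (\<lambda>x. P1 x - P2 x)"
    using assms(1) by (rule regular_polyE)
  obtain Q1 Q2 where Q: "positive_poly k scalars Q1" "positive_poly k scalars Q2" "Q = (\<lambda>x. Q1 x - Q2 x)"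
    using assms(2) by (rule regular_polyE)
  have "(\<lambda>x. P x + Q x) = (\<lambda>x. (P1 x + Q1 x) - (P2 x + Q2 x))" by (simp add: P Q fun_eq_iff)
  then show ?thesis using P Q by (simp only: regular_polyI positive_poly_add)
qed

lemma regular_poly_scale:
  assumes "regular_poly k scalars P" shows "regular_poly k scalars (\<lambda>x. a * P x)"
proof -
  obtain Q R where P: "positive_poly k scalars Q" "positive_poly k scalars R" "P = (\<lambda>x. Q x - R x)"
    using assms by (rule regular_polyE)
  show ?thesis
  proof (cases "0 \<le> a")
    case True
    have "(\<lambda>x. a * P x) = (\<lambda>x. a * Q x - a * R x)" by (simp add: P algebra_simps)
    then show ?thesis using P True by (simp only: regular_polyI positive_poly_scale)
  next
    case False
    have "(\<lambda>x. a * P x) = (\<lambda>x. (- a) * R x - (- a) * Q x)" by (simp add: P algebra_simps)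
    moreover have "0 \<le> - a" using False by simp
    ultimately show ?thesis using P by (simp only: regular_polyI positive_poly_scale)
  qed
qed

lemma order_dual_simps [simp]:
  "vadd (order_dual V) f g = (\<lambda>x. f x + g x)" "vzero (order_dual V) = (\<lambda>_. 0)"
  "vscale (order_dual V) a f = (\<lambda>x. a * f x)"
  "vle (order_dual V) f g \<longleftrightarrow> (\<forall>x\<in>car V. vle V (vzero V) x \<longrightarrow> f x \<le> g x)"
  by (simp_all add: order_dual_def)

lemma linear_functional_regular_polys:
  "linear_functional (regular_polys k) u \<longleftrightarrow>
     (\<forall>P Q. regular_poly k scalars P \<longrightarrow> regular_poly k scalars Q \<longrightarrow> u (\<lambda>x. P x + Q x) = u P + u Q) \<and>
     (\<forall>P a. regular_poly k scalars P \<longrightarrow> u (\<lambda>x. a * P x) = a * u P)"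
  by (auto simp: linear_functional_def)

lemma positive_functional_regular_polys:
  "positive_functional (regular_polys k) u \<longleftrightarrow>
     linear_functional (regular_polys k) u \<and> (\<forall>P. positive_poly k scalars P \<longrightarrow> 0 \<le> u P)"
  using positive_imp_regular by (auto simp: positive_functional_def)

lemma order_dual_regular_polys_diff:
  assumes "u \<in> car (order_dual (regular_polys k))" "regular_poly k scalars P" "regular_poly k scalars Q"
  shows "u (\<lambda>x. P x - Q x) = u P - u Q"
proof -
  obtain g h where gh: "linear_functional (regular_polys k) g" "linear_functional (regular_polys k) h"
      and u: "\<And>R. regular_poly k scalars R \<Longrightarrow> u R = g R - h R"
    using assms(1) by (auto simp: order_dual_def positive_functional_def)
  have R: "regular_poly k scalars (\<lambda>x. - 1 * Q x)" using regular_poly_scale[OF assms(3)] .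
  have diff: "f (\<lambda>x. P x - Q x) = f P - f Q" if "linear_functional (regular_polys k) f" for f
  proof -
    have "f (\<lambda>x. P x + - 1 * Q x) = f P + f (\<lambda>x. - 1 * Q x)"
      using that assms(2) R unfolding linear_functional_regular_polys by blast
    moreover have "f (\<lambda>x. - 1 * Q x) = - 1 * f Q"
      using that assms(3) unfolding linear_functional_regular_polys by blast
    ultimately show ?thesis by simp
  qed
  have "regular_poly k scalars (\<lambda>x. P x - Q x)"
    using regular_poly_add[OF assms(2) R] by simp
  then show ?thesis using diff[OF gh(1)] diff[OF gh(2)] u assms(2,3) by simp
qed

lemma tensor_power_regular [simp]: "regular_poly k scalars P \<Longrightarrow> tensor_power k x P = P x"
  by (simp add: tensor_power_def)

lemma linear_functional_tensor_power: "linear_functional (regular_polys k) (tensor_power k x)"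
  unfolding linear_functional_regular_polys by (simp add: regular_poly_add regular_poly_scale)

lemma tensor_power_in_order_dual: "tensor_power k x \<in> car (order_dual (regular_polys k))"
proof -
  let ?g = "tensor_power k \<bar>x\<bar>" and ?h = "\<lambda>P. tensor_power k \<bar>x\<bar> P - tensor_power k x P"
  have "positive_functional (regular_polys k) ?g"
    unfolding positive_functional_regular_polys
    by (simp add: linear_functional_tensor_power positive_imp_regular positive_poly_nonneg)
  moreover have "positive_functional (regular_polys k) ?h"
    unfolding positive_functional_regular_polys
  proof (intro conjI allI impI)
    show "linear_functional (regular_polys k) ?h"
      using linear_functional_tensor_power[of k x] linear_functional_tensor_power[of k "\<bar>x\<bar>"]
      by (simp add: linear_functional_regular_polys algebra_simps)
    show "0 \<le> ?h P" if "positive_poly k scalars P" for P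
      using positive_poly_abs_le[OF that, of x] that by (simp add: positive_imp_regular)
  qed
  moreover have "\<forall>P. P \<notin> car (regular_polys k) \<longrightarrow> tensor_power k x P = 0" by (simp add: tensor_power_def)
  ultimately show ?thesis unfolding order_dual_def by fastforce
qed

text \<open>
  Kept apart from the tensor norm, because convergence statements rest on a dominating series of tensor
  powers itself and not on the infimum of the possible sums of norms.
\<close>

definition dominated_by :: "nat \<Rightarrow> (nat \<Rightarrow> 'a::banach_lattice) \<Rightarrow> (('a \<Rightarrow> real) \<Rightarrow> real) \<Rightarrow> bool" where
  "dominated_by k x u \<longleftrightarrow> (\<forall>i. 0 \<le> x i) \<and> summable (\<lambda>i. norm (x i) ^ k) \<and>
     (\<forall>P. positive_poly k scalars P \<longrightarrow> \<bar>u P\<bar> \<le> (\<Sum>i. P (x i)))"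

lemma tensor_norm_bounds_iff:
  "r \<in> tensor_norm_bounds k u \<longleftrightarrow> (\<exists>x. dominated_by k x u \<and> r = (\<Sum>i. norm (x i) ^ k))"
  unfolding tensor_norm_bounds_def dominated_by_def
  by (auto simp: positive_imp_regular)

lemma positive_poly_summable:
  fixes P :: "'a::banach_lattice \<Rightarrow> real"
  assumes P: "positive_poly k scalars P" and "1 \<le> k" and x: "\<And>i. 0 \<le> x i" "summable (\<lambda>i. norm (x i) ^ k)"
  shows "summable (\<lambda>i. P (x i))"
proof -
  obtain C where C: "\<And>x. 0 \<le> x \<Longrightarrow> P x \<le> C * norm x ^ k"
    using positive_form_bounded[OF P \<open>1 \<le> k\<close>] by blast
  show ?thesis
    by (rule summable_comparison_test'[OF summable_mult[OF x(2), of C]])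
      (use C[OF x(1)] positive_poly_nonneg[OF P x(1)] in simp)
qed

text \<open>Interlacing merges two dominating sequences into one.\<close>

lemma sums_interlace:
  fixes f g :: "nat \<Rightarrow> real"
  assumes "f sums a" "g sums b"
  shows "(\<lambda>i. if even i then f (i div 2) else g (i div 2)) sums (a + b)"
proof -
  have "(\<lambda>i. if even i then f (i div 2) else g (i div 2)) = (\<lambda>i. if even i then f (i div 2) else g ((i - 1) div 2))"
    by (auto simp: fun_eq_iff elim!: oddE)
  then show ?thesis using sums_if[OF assms(2,1)] by (simp add: add.commute)
qed

lemma dominated_by_add:
  assumes "1 \<le> k" and u: "dominated_by k x u" and v: "dominated_by k y v"
    and w: "\<And>P. positive_poly k scalars P \<Longrightarrow> \<bar>w P\<bar> \<le> \<bar>u P\<bar> + \<bar>v P\<bar>"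
  shows "dominated_by k (\<lambda>i. if even i then x (i div 2) else y (i div 2)) w"
    (is "dominated_by k ?z w")
  unfolding dominated_by_def
proof (intro conjI allI impI)
  show "0 \<le> ?z i" for i using u v by (simp add: dominated_by_def)
  have sums: "(\<lambda>i. \<phi> (?z i)) sums ((\<Sum>i. \<phi> (x i)) + (\<Sum>i. \<phi> (y i)))"
    if "summable (\<lambda>i. \<phi> (x i))" "summable (\<lambda>i. \<phi> (y i))" for \<phi> :: "'a \<Rightarrow> real"
    using sums_interlace[OF summable_sums[OF that(1)] summable_sums[OF that(2)]]
    by (simp add: if_distrib[of \<phi>])
  show "summable (\<lambda>i. norm (?z i) ^ k)"
    using sums[of "\<lambda>x. norm x ^ k"] u v by (auto simp: dominated_by_def summable_def)
  fix P :: "'a \<Rightarrow> real" assume P: "positive_poly k scalars P"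
  have "(\<Sum>i. P (?z i)) = (\<Sum>i. P (x i)) + (\<Sum>i. P (y i))"
    using u v by (intro sums_unique[symmetric] sums positive_poly_summable[OF P \<open>1 \<le> k\<close>])
      (simp_all add: dominated_by_def)
  then show "\<bar>w P\<bar> \<le> (\<Sum>i. P (?z i))" using w[OF P] u v P by (fastforce simp: dominated_by_def)
qed

lemma dominated_by_tensor_power:
  assumes "1 \<le> k"
  shows "dominated_by k (\<lambda>i. if i = 0 then \<bar>x\<bar> else 0) (tensor_power k x)"
  unfolding dominated_by_def
proof (intro conjI allI impI)
  show "summable (\<lambda>i. norm (if i = 0 then \<bar>x\<bar> else 0) ^ k)"
    using assms by (intro summable_finite[of "{0}"]) auto
  fix P :: "'a \<Rightarrow> real" assume P: "positive_poly k scalars P"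
  have "P 0 = 0" by (rule positive_poly_at_zero[OF P assms])
  then have "(\<Sum>i. P (if i = 0 then \<bar>x\<bar> else 0)) = P \<bar>x\<bar>"
    by (subst suminf_finite[of "{0::nat}"]) auto
  then show "\<bar>tensor_power k x P\<bar> \<le> (\<Sum>i. P (if i = 0 then \<bar>x\<bar> else 0))"
    using positive_poly_abs_le[OF P, of x] P by (simp add: positive_imp_regular)
qed simp

text \<open>
  To compare a supremum with the dominating series, the latter must itself belong to the order dual.
\<close>

lemma dominating_functional:
  assumes "1 \<le> k" and x: "\<And>i. 0 \<le> x i" "summable (\<lambda>i. norm (x i) ^ k)"
  defines "A \<equiv> \<lambda>P. if regular_poly k scalars P then (\<Sum>i. P (x i)) else 0"
  shows "A \<in> car (order_dual (regular_polys k))" "(\<lambda>P. - A P) \<in> car (order_dual (regular_polys k))"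
proof -
  have sm: "summable (\<lambda>i. P (x i))" if "regular_poly k scalars P" for P
    using that by (elim regular_polyE) (simp add: summable_diff positive_poly_summable[OF _ \<open>1 \<le> k\<close> x])
  have "linear_functional (regular_polys k) A"
    unfolding linear_functional_regular_polys
    by (simp add: A_def regular_poly_add regular_poly_scale suminf_add[OF sm sm] suminf_mult[OF sm])
  moreover have "0 \<le> A P" if "positive_poly k scalars P" for P
    using that x by (simp add: A_def positive_imp_regular suminf_nonneg positive_poly_summable[OF that \<open>1 \<le> k\<close> x]
        positive_poly_nonneg)
  ultimately have A: "positive_functional (regular_polys k) A"
    by (simp add: positive_functional_regular_polys)
  have Z: "positive_functional (regular_polys k) (\<lambda>_. 0)"
    by (simp add: positive_functional_regular_polys linear_functional_regular_polys)
  have "\<forall>P. P \<notin> car (regular_polys k) \<longrightarrow> A P = 0" by (simp add: A_def)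
  then show "A \<in> car (order_dual (regular_polys k))" "(\<lambda>P. - A P) \<in> car (order_dual (regular_polys k))"
    using A Z by (fastforce simp: order_dual_def)+
qed

text \<open>
  The dominated functionals contain all tensor powers and are closed under the operations generating the
  Fremlin lattice.  For suprema: \<open>u \<squnion> v\<close> lies above \<open>u\<close>, and below any common upper bound of \<open>u\<close> and
  \<open>v\<close>, such as the sum of the two dominating functionals.
\<close>

lemma fremlin_tensor_lattice_dominated:
  assumes "1 \<le> k" "u \<in> fremlin_tensor_lattice k"
  shows "\<exists>x. dominated_by k x u"
  using assms(2) unfolding fremlin_tensor_lattice_def
proof (induction u rule: sublattice_generated.induct)
  case (base u)
  then show ?case using dominated_by_tensor_power[OF assms(1)] by blast
next
  case (add u v)
  then obtain x y where xy: "dominated_by k x u" "dominated_by k y v" by blast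
  have "dominated_by k (\<lambda>i. if even i then x (i div 2) else y (i div 2)) (\<lambda>P. u P + v P)"
    by (rule dominated_by_add[OF assms(1) xy]) (rule abs_triangle_ineq)
  then show ?case by auto
next
  case (scale u a)
  then obtain x where x: "dominated_by k x u" by blast
  let ?c = "root k \<bar>a\<bar>"
  have c: "0 \<le> ?c" "?c ^ k = \<bar>a\<bar>" using assms(1) by simp_all
  have "dominated_by k (\<lambda>i. ?c *\<^sub>R x i) (vscale (order_dual (regular_polys k)) a u)"
    unfolding dominated_by_def
  proof (intro conjI allI impI)
    show "0 \<le> ?c *\<^sub>R x i" for i using x c by (simp add: dominated_by_def scaleR_nonneg_nonneg)
    show "summable (\<lambda>i. norm (?c *\<^sub>R x i) ^ k)"
      using x c by (simp add: dominated_by_def power_mult_distrib summable_mult)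
    fix P :: "'a \<Rightarrow> real" assume P: "positive_poly k scalars P"
    have "P (?c *\<^sub>R x i) = \<bar>a\<bar> * P (x i)" for i
      using P c multilinear_form_diagonal_scale unfolding positive_poly_iff positive_op_def by metis
    moreover have "summable (\<lambda>i. P (x i))"
      using x by (intro positive_poly_summable[OF P assms(1)]) (simp_all add: dominated_by_def)
    ultimately show "\<bar>vscale (order_dual (regular_polys k)) a u P\<bar> \<le> (\<Sum>i. P (?c *\<^sub>R x i))"
      using x P by (simp add: dominated_by_def suminf_mult abs_mult mult_left_mono)
  qed
  then show ?case by blast
next
  case (sup u v w)
  then obtain x y where xy: "dominated_by k x u" "dominated_by k y v" by blast
  let ?z = "\<lambda>i. if even i then x (i div 2) else y (i div 2)"
  have z: "dominated_by k ?z (\<lambda>P. \<bar>u P\<bar> + \<bar>v P\<bar>)" by (rule dominated_by_add[OF assms(1) xy]) simp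
  define A where "A P = (if regular_poly k scalars P then (\<Sum>i. P (?z i)) else 0)" for P
  have A: "A \<in> car (order_dual (regular_polys k))"
    unfolding A_def using z by (intro dominating_functional(1)[OF assms(1)]) (simp_all only: dominated_by_def)
  have *: "\<bar>u P\<bar> + \<bar>v P\<bar> \<le> A P" if "positive_poly k scalars P" for P
  proof -
    have "\<bar>\<bar>u P\<bar> + \<bar>v P\<bar>\<bar> \<le> (\<Sum>i. P (?z i))" using z that unfolding dominated_by_def by blast
    then show ?thesis using that by (simp add: A_def positive_imp_regular)
  qed
  have w: "vle (order_dual (regular_polys k)) u w"
    "vle (order_dual (regular_polys k)) u A \<Longrightarrow> vle (order_dual (regular_polys k)) v A \<Longrightarrow>
       vle (order_dual (regular_polys k)) w A"
    using sup.hyps A by (auto simp only: is_sup_def)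
  have le: "u P \<le> A P \<and> v P \<le> A P" if "positive_poly k scalars P" for P using *[OF that] by linarith
  have "dominated_by k ?z w"
    unfolding dominated_by_def
  proof (intro conjI allI impI)
    show "0 \<le> ?z i" for i using z unfolding dominated_by_def by blast
    show "summable (\<lambda>i. norm (?z i) ^ k)" using z unfolding dominated_by_def by blast
    fix P :: "'a \<Rightarrow> real" assume P: "positive_poly k scalars P"
    have "u P \<le> w P" using w(1) P by (simp add: positive_imp_regular)
    moreover have "w P \<le> A P" using w(2) le P by (simp add: positive_imp_regular)
    ultimately have "\<bar>w P\<bar> \<le> A P" using *[OF P] by linarith
    then show "\<bar>w P\<bar> \<le> (\<Sum>i. P (?z i))" using P by (simp add: A_def positive_imp_regular)
  qed
  then show ?case by blast
qed

lemma sym_tensor_product_car: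
  "z \<in> car (sym_tensor_product k) \<longleftrightarrow> z \<in> car (order_dual (regular_polys k)) \<and>
     (\<forall>e>0. \<exists>u\<in>fremlin_tensor_lattice k. \<exists>r\<in>tensor_norm_bounds k (\<lambda>P. z P - u P). r < e)"
  by (simp add: sym_tensor_product_def)

lemma tensor_power_in_sym_tensor_product:
  assumes "1 \<le> k" shows "tensor_power k x \<in> car (sym_tensor_product k)"
  unfolding sym_tensor_product_car
proof (intro conjI allI impI tensor_power_in_order_dual)
  fix e :: real assume e: "0 < e"
  have "tensor_power k x \<in> fremlin_tensor_lattice k"
    by (simp add: fremlin_tensor_lattice_def sublattice_generated.base)
  moreover have "dominated_by k (\<lambda>_. 0 :: 'a) (\<lambda>P. tensor_power k x P - tensor_power k x P)"
    using assms by (simp add: dominated_by_def positive_poly_at_zero power_0_left)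
  then have "0 \<in> tensor_norm_bounds k (\<lambda>P. tensor_power k x P - tensor_power k x P)"
    unfolding tensor_norm_bounds_iff using assms by (intro exI[of _ "\<lambda>_. 0"]) (simp add: power_0_left)
  ultimately show "\<exists>u\<in>fremlin_tensor_lattice k. \<exists>r\<in>tensor_norm_bounds k (\<lambda>P. tensor_power k x P - u P). r < e"
    using e by blast
qed

text \<open>
  An element is the sum of a member of the Fremlin lattice and of a remainder of finite tensor norm, and
  both are dominated.
\<close>

lemma sym_tensor_product_dominated:
  assumes "1 \<le> k" "z \<in> car (sym_tensor_product k)"
  shows "\<exists>x. dominated_by k x z"
proof -
  obtain u r where u: "u \<in> fremlin_tensor_lattice k" and "r \<in> tensor_norm_bounds k (\<lambda>P. z P - u P)"
    using assms(2) zero_less_one unfolding sym_tensor_product_car by blast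
  then obtain x y where x: "dominated_by k x (\<lambda>P. z P - u P)" and y: "dominated_by k y u"
    using fremlin_tensor_lattice_dominated[OF assms(1) u] unfolding tensor_norm_bounds_iff by blast
  show ?thesis using dominated_by_add[OF assms(1) x y, of z] by fastforce
qed

text \<open>
  A bound \<open>C * norm x ^ k\<close> for a positive polynomial dominating \<open>P\<close> passes to every dominating series, term by term, and thus to the
  infimum.
\<close>

lemma linearization_in_dual:
  assumes "1 \<le> k" and P: "regular_poly k scalars P"
  shows "linearization P \<in> dual (sym_tensor_product k)"
proof -
  obtain Q R where Q: "positive_poly k scalars Q" and R: "positive_poly k scalars R"
    and PQR: "P = (\<lambda>x. Q x - R x)" using P by (rule regular_polyE)
  have QR: "positive_poly k scalars (\<lambda>x. Q x + R x)" by (rule positive_poly_add[OF Q R])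
  obtain C where C: "0 \<le> C" "\<And>x. 0 \<le> x \<Longrightarrow> Q x + R x \<le> C * norm x ^ k"
    using positive_form_bounded[OF QR \<open>1 \<le> k\<close>] by blast
  have "\<bar>z P\<bar> \<le> C * tensor_norm k z" if z: "z \<in> car (sym_tensor_product k)" for z
  proof -
    have zd: "z \<in> car (order_dual (regular_polys k))" using z by (simp add: sym_tensor_product_car)
    have bound: "\<bar>z P\<bar> \<le> C * r" if r_in: "r \<in> tensor_norm_bounds k z" for r
    proof -
      obtain x where x: "dominated_by k x z" and r: "r = (\<Sum>i. norm (x i) ^ k)"
        using r_in unfolding tensor_norm_bounds_iff by blast
      have x': "\<And>i. 0 \<le> x i" "summable (\<lambda>i. norm (x i) ^ k)" using x by (simp_all add: dominated_by_def)
      note sm = positive_poly_summable[OF _ \<open>1 \<le> k\<close> x']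
      have "z P = z Q - z R"
        unfolding PQR by (intro order_dual_regular_polys_diff[OF zd] positive_imp_regular Q R)
      then have "\<bar>z P\<bar> \<le> \<bar>z Q\<bar> + \<bar>z R\<bar>" by simp
      also have "\<dots> \<le> (\<Sum>i. Q (x i)) + (\<Sum>i. R (x i))"
        using x Q R by (intro add_mono) (simp_all add: dominated_by_def)
      also have "\<dots> = (\<Sum>i. Q (x i) + R (x i))" by (rule suminf_add[OF sm[OF Q] sm[OF R]])
      also have "\<dots> \<le> (\<Sum>i. C * norm (x i) ^ k)"
        by (intro suminf_le sm[OF QR] C(2) x' summable_mult)
      also have "\<dots> = C * r" using x' by (simp add: r suminf_mult)
      finally show ?thesis .
    qed
    obtain r where r: "r \<in> tensor_norm_bounds k z"
      using sym_tensor_product_dominated[OF \<open>1 \<le> k\<close> z] unfolding tensor_norm_bounds_iff by blast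
    show ?thesis
    proof (cases "C = 0")
      case True
      then show ?thesis using bound[OF r] by simp
    next
      case False
      then have "\<bar>z P\<bar> / C \<le> tensor_norm k z"
        unfolding tensor_norm_def using bound r C(1)
        by (intro cInf_greatest) (auto simp: field_simps)
      then show ?thesis using False C(1) by (simp add: field_simps)
    qed
  qed
  then show ?thesis
    by (auto simp: dual_def linear_functional_def linearization_def sym_tensor_product_def)
qed

lemma weak_star_null_polys_pointwise:
  assumes "1 \<le> k" "weak_star_null_polys k P" shows "(\<lambda>n. P n x) \<longlonglongrightarrow> 0"
proof -
  have "regular_poly k scalars (P n)" for n using assms(2) by (simp add: weak_star_null_polys_def)
  moreover have "(\<lambda>n. tensor_power k x (P n)) \<longlonglongrightarrow> 0"
    using assms(2) tensor_power_in_sym_tensor_product[OF assms(1), of x]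
    unfolding weak_star_null_polys_def weak_star_null_def linearization_def by blast
  ultimately show ?thesis by simp
qed

text \<open>
  Every element of the tensor product is dominated by a series of tensor powers, so for positive forms
  pointwise convergence on the positive cone suffices, by dominated convergence.
\<close>

lemma weak_star_null_polysI:
  fixes P :: "nat \<Rightarrow> 'a::banach_lattice \<Rightarrow> real"
  assumes "1 \<le> k" and P: "\<And>n. positive_poly k scalars (P n)"
    and null: "\<And>x. 0 \<le> x \<Longrightarrow> (\<lambda>n. P n x) \<longlonglongrightarrow> 0"
    and bound: "\<And>n x. 0 \<le> x \<Longrightarrow> P n x \<le> C * norm x ^ k"
  shows "weak_star_null_polys k P"
  unfolding weak_star_null_polys_def weak_star_null_def
proof (intro conjI allI ballI)
  show "P n \<in> car (regular_polys k)" for n by (simp add: positive_imp_regular P)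
  show "linearization (P n) \<in> dual (sym_tensor_product k)" for n
    by (intro linearization_in_dual assms(1) positive_imp_regular P)
  fix z :: "('a \<Rightarrow> real) \<Rightarrow> real" assume "z \<in> car (sym_tensor_product k)"
  then obtain x where x: "dominated_by k x z" using sym_tensor_product_dominated[OF assms(1)] by blast
  then have x': "\<And>i. 0 \<le> x i" "summable (\<lambda>i. norm (x i) ^ k)" by (simp_all add: dominated_by_def)
  have "(\<lambda>n. \<Sum>i. P n (x i)) \<longlonglongrightarrow> (\<Sum>i::nat. 0)"
  proof (rule tannerys_theorem[where M = "\<lambda>i. C * norm (x i) ^ k", THEN conjunct2, THEN conjunct2])
    show "(\<lambda>n. P n (x i)) \<longlonglongrightarrow> 0" for i by (rule null[OF x'(1)])
    show "\<forall>\<^sub>F (i, n) in sequentially \<times>\<^sub>F sequentially. norm (P n (x i)) \<le> C * norm (x i) ^ k"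
      using bound[OF x'(1)] positive_poly_nonneg[OF P x'(1)] by (intro always_eventually) auto
  qed (simp_all add: summable_mult x')
  then have series: "(\<lambda>n. \<Sum>i. P n (x i)) \<longlonglongrightarrow> 0" by simp
  have "\<forall>n. norm (linearization (P n) z) \<le> (\<Sum>i. P n (x i))"
    using x P by (simp add: dominated_by_def linearization_def)
  from Lim_null_comparison[OF always_eventually[OF this] series]
  show "(\<lambda>n. linearization (P n) z) \<longlonglongrightarrow> 0" .
qed

section \<open>Finitely additive measures on the natural numbers\<close>

text \<open>
  Halving: an infinite set splits into two infinite ones, and one of them has at most half of the
  variation.
\<close>

lemma infinite_subset_small:
  fixes \<nu> :: "nat set \<Rightarrow> real"
  assumes superadditive: "\<And>A B. A \<inter> B = {} \<Longrightarrow> \<nu> A + \<nu> B \<le> \<nu> (A \<union> B)"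
    and mono: "\<And>A B. A \<subseteq> B \<Longrightarrow> \<nu> A \<le> \<nu> B"
    and M: "infinite M" and "0 < \<delta>"
  shows "\<exists>N\<subseteq>M. infinite N \<and> \<nu> N < \<delta>"
proof -
  have halving: "\<exists>N\<subseteq>M. infinite N \<and> \<nu> N \<le> \<nu> M / 2 ^ m" for m
  proof (induction m)
    case 0
    then show ?case using M by auto
  next
    case (Suc m)
    then obtain N where N: "N \<subseteq> M" "infinite N" "\<nu> N \<le> \<nu> M / 2 ^ m" by blast
    let ?e = "enumerate N"
    let ?A = "range (\<lambda>i. ?e (2 * i))" and ?B = "range (\<lambda>i. ?e (2 * i + 1))"
    have inj: "?e i = ?e j \<longleftrightarrow> i = j" for i j
      using strict_mono_enumerate[OF N(2)] by (rule strict_mono_eq)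
    have inf: "infinite ?A" "infinite ?B"
      by (auto intro!: range_inj_infinite injI simp: inj)
    have "?e (2 * i) \<noteq> ?e (2 * j + 1)" for i j unfolding inj by presburger
    then have "?A \<inter> ?B = {}" by blast
    moreover have sub: "?A \<subseteq> N" "?B \<subseteq> N" using enumerate_in_set[OF N(2)] by auto
    ultimately have "\<nu> ?A + \<nu> ?B \<le> \<nu> N"
      using superadditive[of ?A ?B] mono[of "?A \<union> ?B" N] by simp
    then have "\<nu> ?A \<le> \<nu> N / 2 \<or> \<nu> ?B \<le> \<nu> N / 2" by linarith
    moreover have "\<nu> N / 2 \<le> \<nu> M / 2 ^ Suc m" using N(3) by simp
    ultimately show ?case using inf sub N(1) by (meson order_trans)
  qed
  have "(\<lambda>m. \<nu> M / 2 ^ m) \<longlonglongrightarrow> 0"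
    by (rule LIMSEQ_divide_realpow_zero) simp
  then have "\<forall>\<^sub>F m in sequentially. \<nu> M / 2 ^ m < \<delta>" using \<open>0 < \<delta>\<close> by (rule order_tendstoD)
  then obtain m where "\<nu> M / 2 ^ m < \<delta>" by (auto simp: eventually_sequentially)
  then show ?thesis using halving[of m] by (meson le_less_trans)
qed

text \<open>
  The diagonal part of Phillips' lemma.  If \<open>\<bar>\<mu> n {n}\<bar> \<ge> \<epsilon>\<close> infinitely often, choose such
  \<open>n 0 < n 1 < \<dots>\<close> so sparsely that, for the set \<open>A\<close> of all of them, the earlier points hardly count for
  \<open>\<mu> (n j)\<close> because \<open>\<mu> n {i} \<longlonglongrightarrow> 0\<close>, and the later ones lie in an infinite set that was selected to
  have small variation for \<open>\<mu> (n j)\<close>.  Then \<open>\<bar>\<mu> (n j) A\<bar> \<ge> \<epsilon> / 2\<close> although \<open>\<mu> n A \<longlonglongrightarrow> 0\<close>.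
\<close>

lemma finitely_additive_diagonal_tendsto:
  fixes \<mu> \<nu> :: "nat \<Rightarrow> nat set \<Rightarrow> real"
  assumes additive: "\<And>n A B. A \<inter> B = {} \<Longrightarrow> \<mu> n (A \<union> B) = \<mu> n A + \<mu> n B"
    and null: "\<And>A. (\<lambda>n. \<mu> n A) \<longlonglongrightarrow> 0"
    and superadditive: "\<And>n A B. A \<inter> B = {} \<Longrightarrow> \<nu> n A + \<nu> n B \<le> \<nu> n (A \<union> B)"
    and mono: "\<And>n A B. A \<subseteq> B \<Longrightarrow> \<nu> n A \<le> \<nu> n B"
    and le: "\<And>n A. \<bar>\<mu> n A\<bar> \<le> \<nu> n A"
  shows "(\<lambda>n. \<mu> n {n}) \<longlonglongrightarrow> 0"
proof (rule ccontr)
  assume "\<not> ?thesis"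
  then obtain \<epsilon> where \<epsilon>: "0 < \<epsilon>" and often: "\<And>N. \<exists>n\<ge>N. \<epsilon> \<le> \<bar>\<mu> n {n}\<bar>"
    unfolding LIMSEQ_iff by (force simp: not_less)
  define I where "I = {n. \<epsilon> \<le> \<bar>\<mu> n {n}\<bar>}"
  have I: "infinite I" using often unfolding infinite_nat_iff_unbounded_le I_def by auto
  have empty: "\<mu> n {} = 0" for n using additive[of "{}" "{}" n] by simp
  have finite: "\<bar>\<mu> n B\<bar> \<le> (\<Sum>i\<in>B. \<bar>\<mu> n {i}\<bar>)" if "finite B" for n B
    using that
  proof (induction B rule: finite_induct)
    case (insert b B)
    then have "\<mu> n (insert b B) = \<mu> n {b} + \<mu> n B" using additive[of "{b}" B n] by simp
    then show ?case using insert by simp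
  qed (simp add: empty)
  \<comment> \<open>a pair consists of the chosen index and the reservoir from which all later indices are taken\<close>
  have "\<exists>s :: nat \<Rightarrow> nat \<times> nat set. \<forall>j.
      (fst (s j) \<in> I \<and> snd (s j) \<subseteq> I \<and> infinite (snd (s j)) \<and> \<nu> (fst (s j)) (snd (s j)) < \<epsilon> / 4) \<and>
      (fst (s (Suc j)) \<in> snd (s j) \<and> snd (s (Suc j)) \<subseteq> snd (s j) \<and> fst (s j) < fst (s (Suc j)) \<and>
       (\<Sum>i\<le>fst (s j). \<bar>\<mu> (fst (s (Suc j))) {i}\<bar>) < \<epsilon> / 4)"
  proof (rule dependent_nat_choice)
    obtain n where n: "n \<in> I" using I by (metis finite.emptyI all_not_in_conv)
    obtain M where "M \<subseteq> I" "infinite M" "\<nu> n M < \<epsilon> / 4"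
      using infinite_subset_small[of "\<nu> n" I "\<epsilon> / 4"] superadditive mono I \<epsilon> by auto
    then show "\<exists>s. fst s \<in> I \<and> snd s \<subseteq> I \<and> infinite (snd s) \<and> \<nu> (fst s) (snd s) < \<epsilon> / 4"
      using n by (intro exI[of _ "(n, M)"]) simp
  next
    fix s :: "nat \<times> nat set"
    assume s: "fst s \<in> I \<and> snd s \<subseteq> I \<and> infinite (snd s) \<and> \<nu> (fst s) (snd s) < \<epsilon> / 4"
    have "(\<lambda>n. \<Sum>i\<le>fst s. \<bar>\<mu> n {i}\<bar>) \<longlonglongrightarrow> 0"
      by (intro tendsto_null_sum tendsto_rabs_zero null)
    then have "\<forall>\<^sub>F n in sequentially. (\<Sum>i\<le>fst s. \<bar>\<mu> n {i}\<bar>) < \<epsilon> / 4"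
      by (rule order_tendstoD) (use \<epsilon> in simp)
    then obtain N where N: "\<And>n. n \<ge> N \<Longrightarrow> (\<Sum>i\<le>fst s. \<bar>\<mu> n {i}\<bar>) < \<epsilon> / 4"
      by (auto simp: eventually_sequentially)
    obtain n where n: "n \<in> snd s" "N + Suc (fst s) \<le> n"
      using s infinite_nat_iff_unbounded_le by blast
    obtain M where "M \<subseteq> snd s" "infinite M" "\<nu> n M < \<epsilon> / 4"
      using infinite_subset_small[of "\<nu> n" "snd s" "\<epsilon> / 4"] superadditive mono s \<epsilon> by auto
    then show "\<exists>t. (fst t \<in> I \<and> snd t \<subseteq> I \<and> infinite (snd t) \<and> \<nu> (fst t) (snd t) < \<epsilon> / 4) \<and>
      (fst t \<in> snd s \<and> snd t \<subseteq> snd s \<and> fst s < fst t \<and> (\<Sum>i\<le>fst s. \<bar>\<mu> (fst t) {i}\<bar>) < \<epsilon> / 4)"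
      using n s N[of n] by (intro exI[of _ "(n, M)"]) auto
  qed
  then obtain s :: "nat \<Rightarrow> nat \<times> nat set" where s:
      "\<And>j. fst (s j) \<in> I" "\<And>j. \<nu> (fst (s j)) (snd (s j)) < \<epsilon> / 4"
      "\<And>j. fst (s (Suc j)) \<in> snd (s j)" "\<And>j. snd (s (Suc j)) \<subseteq> snd (s j)" "\<And>j. fst (s j) < fst (s (Suc j))"
      "\<And>j. (\<Sum>i\<le>fst (s j). \<bar>\<mu> (fst (s (Suc j))) {i}\<bar>) < \<epsilon> / 4" by blast
  define n where "n j = fst (s j)" for j
  have n: "strict_mono n" using s(5) by (simp add: strict_mono_Suc_iff n_def)
  have dec: "snd (s (j + d)) \<subseteq> snd (s j)" for j d using s(4) by (induction d) auto
  have later: "n i \<in> snd (s j)" if "j < i" for i j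
    using that s(3)[of "i - 1"] dec[of j "i - 1 - j"] by (auto simp: n_def)
  let ?A = "range n"
  have far: "\<epsilon> / 2 \<le> \<bar>\<mu> (n (Suc j)) ?A\<bar>" for j
  proof -
    let ?m = "n (Suc j)"
    let ?B = "n ` {..j}" and ?C = "n ` {Suc j<..}"
    have split: "?A = (?B \<union> {?m}) \<union> ?C"
      using not_less_eq_eq by (auto simp: image_iff) (metis atMost_iff greaterThan_iff not_less_eq_eq not_le le_neq_implies_less)
    have ne: "n a = n b \<longleftrightarrow> a = b" for a b by (rule strict_mono_eq[OF n])
    have disj: "?B \<inter> {?m} = {}" "(?B \<union> {?m}) \<inter> ?C = {}" by (auto simp: ne)
    have "\<mu> ?m ?A = \<mu> ?m ?B + \<mu> ?m {?m} + \<mu> ?m ?C"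
      unfolding split by (simp only: additive[OF disj(1)] additive[OF disj(2)])
    moreover have "\<bar>\<mu> ?m ?B\<bar> < \<epsilon> / 4"
    proof -
      have "\<bar>\<mu> ?m ?B\<bar> \<le> (\<Sum>i\<in>?B. \<bar>\<mu> ?m {i}\<bar>)" by (rule finite) simp
      also have "\<dots> \<le> (\<Sum>i\<le>n j. \<bar>\<mu> ?m {i}\<bar>)"
        using strict_mono_less_eq[OF n] by (intro sum_mono2) auto
      also have "\<dots> < \<epsilon> / 4" using s(6)[of j] by (simp add: n_def)
      finally show ?thesis .
    qed
    moreover have "\<bar>\<mu> ?m ?C\<bar> < \<epsilon> / 4"
    proof -
      have "?C \<subseteq> snd (s (Suc j))" using later by auto
      from mono[OF this, of ?m] le[of ?m ?C] s(2)[of "Suc j"] show ?thesis by (simp add: n_def)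
    qed
    moreover have "\<epsilon> \<le> \<bar>\<mu> ?m {?m}\<bar>" using s(1)[of "Suc j"] by (simp add: n_def I_def)
    ultimately show ?thesis by linarith
  qed
  have "(\<lambda>j. \<mu> (n (Suc j)) ?A) \<longlonglongrightarrow> 0"
    using LIMSEQ_subseq_LIMSEQ[OF null[of ?A] n] LIMSEQ_Suc by (fastforce simp: o_def)
  then have "\<forall>\<^sub>F j in sequentially. \<bar>\<mu> (n (Suc j)) ?A\<bar> < \<epsilon> / 2"
    using \<epsilon> by (intro order_tendstoD(2)[OF tendsto_rabs_zero]) auto
  then show False using far by (auto simp: eventually_sequentially not_less[symmetric])
qed

section \<open>Components of functionals\<close>

lemma riesz_decomposition:
  fixes y :: "'a::lattice_ab_group_add"
  assumes "0 \<le> y" "y \<le> u + v" "0 \<le> u" "0 \<le> v"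
  obtains a b where "y = a + b" "0 \<le> a" "a \<le> u" "0 \<le> b" "b \<le> v"
proof (rule that[of "inf y u" "y - inf y u"])
  have "y - inf y u = y + sup (- y) (- u)" by (rule diff_inf_eq_sup)
  also have "\<dots> = sup 0 (y - u)" by (simp add: add_sup_distrib_left)
  also have "\<dots> \<le> v" using assms by (simp add: algebra_simps)
  finally show "y - inf y u \<le> v" .
  show "y = inf y u + (y - inf y u)" by (simp only: add.commute[of "inf y u"] diff_add_cancel)
  show "0 \<le> y - inf y u" by (simp only: diff_ge_0_iff_ge inf_le1)
qed (use assms in auto)

text \<open>
  Subtracting the common part \<open>d\<close> from \<open>x\<^sup>+\<close> leaves an upper bound of \<open>x\<close> and \<open>0\<close>.
\<close>

lemma inf_pprt_pprt_uminus:
  fixes x :: "'a::lattice_ab_group_add_abs"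
  shows "inf (pprt x) (pprt (- x)) = 0"
proof -
  define d where "d = inf (pprt x) (pprt (- x))"
  have d: "0 \<le> d" "d \<le> pprt x" "d \<le> pprt (- x)" by (simp_all add: d_def)
  have "x = pprt x - pprt (- x)" by (simp add: pprt_diff_pprt)
  also have "\<dots> \<le> pprt x - d" using d by (intro diff_left_mono)
  finally have "sup x 0 \<le> pprt x - d" using d by simp
  then have "pprt x \<le> pprt x - d" by (simp only: pprt_def)
  then have "d \<le> 0" by simp
  then show ?thesis using d(1) unfolding d_def by (rule antisym)
qed

lemma inf_multiples_zero:
  fixes e f :: "'a::banach_lattice"
  assumes "inf e f = 0" "0 \<le> a" "a \<le> s *\<^sub>R e" "0 \<le> b" "b \<le> t *\<^sub>R f"
  shows "inf a b = 0"
proof -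
  have e: "0 \<le> e" "0 \<le> f" using assms(1) by (metis inf_le1, metis inf_le2)
  \<comment> \<open>a common factor, bounded below by 1 so that it can be divided out\<close>
  define r where "r = max 1 (max s t)"
  have r: "0 < r" "s \<le> r" "t \<le> r" by (auto simp: r_def)
  have "a \<le> r *\<^sub>R e" "b \<le> r *\<^sub>R f"
    using order_trans[OF assms(3) scaleR_right_mono[OF r(2) e(1)]]
      order_trans[OF assms(5) scaleR_right_mono[OF r(3) e(2)]] by auto
  then have "(1/r) *\<^sub>R inf a b \<le> e" "(1/r) *\<^sub>R inf a b \<le> f"
    using scaleR_left_mono[of "inf a b" "r *\<^sub>R e" "1/r"] scaleR_left_mono[of "inf a b" "r *\<^sub>R f" "1/r"] r
    by (auto intro: le_infI1 le_infI2)
  then have "(1/r) *\<^sub>R inf a b \<le> 0" using assms(1) by (metis le_inf_iff)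
  then have "r *\<^sub>R (1/r) *\<^sub>R inf a b \<le> r *\<^sub>R 0" using r by (intro scaleR_left_mono) auto
  then have "inf a b \<le> 0" using r by simp
  then show ?thesis using assms by (intro antisym) simp_all
qed

text \<open>
  For a solid cone \<open>D\<close>, the value at \<open>z \<ge> 0\<close> of the component of \<open>g\<^sup>+\<close> carried by the band generated by
  \<open>D\<close>.  With \<open>D = UNIV\<close> it is the positive part \<open>g\<^sup>+\<close> itself.
\<close>

definition component_at :: "('a::banach_lattice \<Rightarrow> real) \<Rightarrow> 'a set \<Rightarrow> 'a \<Rightarrow> real" where
  "component_at g D z = (SUP y\<in>{y. 0 \<le> y \<and> y \<le> z \<and> y \<in> D}. g y)"

definition component :: "('a::banach_lattice \<Rightarrow> real) \<Rightarrow> 'a set \<Rightarrow> 'a \<Rightarrow> real" where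
  "component g D z = component_at g D (pprt z) - component_at g D (pprt (- z))"

locale solid_cone =
  fixes g :: "'a::banach_lattice \<Rightarrow> real" and D :: "'a set"
  assumes g: "bounded_linear g"
    and D_zero: "0 \<in> D"
    and D_add: "a \<in> D \<Longrightarrow> b \<in> D \<Longrightarrow> a + b \<in> D"
    and D_scale: "a \<in> D \<Longrightarrow> 0 \<le> t \<Longrightarrow> t *\<^sub>R a \<in> D"
    and D_solid: "0 \<le> a \<Longrightarrow> a \<le> b \<Longrightarrow> b \<in> D \<Longrightarrow> a \<in> D"
begin

interpretation g: bounded_linear g by (rule g)

lemma bdd: "bdd_above (g ` {y. 0 \<le> y \<and> y \<le> z \<and> y \<in> D})"
proof -
  obtain K where K: "0 < K" "\<And>x. norm (g x) \<le> norm x * K" using g.pos_bounded by blast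
  show ?thesis
  proof (rule bdd_aboveI2[of _ _ "norm z * K"])
    fix y assume "y \<in> {y. 0 \<le> y \<and> y \<le> z \<and> y \<in> D}"
    then have "norm y * K \<le> norm z * K" using K by (intro mult_right_mono norm_mono_positive) auto
    then show "g y \<le> norm z * K" using K(2)[of y] by simp
  qed
qed

lemma le_component_at: "0 \<le> y \<Longrightarrow> y \<le> z \<Longrightarrow> y \<in> D \<Longrightarrow> g y \<le> component_at g D z"
  unfolding component_at_def by (intro cSUP_upper bdd) auto

lemma component_at_le:
  assumes "0 \<le> z" "\<And>y. 0 \<le> y \<Longrightarrow> y \<le> z \<Longrightarrow> y \<in> D \<Longrightarrow> g y \<le> c"
  shows "component_at g D z \<le> c"
  unfolding component_at_def using assms D_zero by (intro cSUP_least) auto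

lemma component_at_nonneg: "0 \<le> z \<Longrightarrow> 0 \<le> component_at g D z"
  using le_component_at[of 0 z] D_zero by (simp add: g.zero)

lemma component_at_add:
  assumes u: "0 \<le> u" and v: "0 \<le> v"
  shows "component_at g D (u + v) = component_at g D u + component_at g D v"
proof (rule antisym)
  show "component_at g D (u + v) \<le> component_at g D u + component_at g D v"
  proof (rule component_at_le)
    fix y assume y: "0 \<le> y" "y \<le> u + v" "y \<in> D"
    obtain a b where ab: "y = a + b" "0 \<le> a" "a \<le> u" "0 \<le> b" "b \<le> v"
      using riesz_decomposition[OF y(1,2) u v] by blast
    have "a \<in> D" "b \<in> D" using D_solid[of a y] D_solid[of b y] ab y by auto
    then show "g y \<le> component_at g D u + component_at g D v"
      using ab by (auto simp: g.add intro!: add_mono le_component_at)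
  qed (use u v in auto)
  have "component_at g D u \<le> component_at g D (u + v) - component_at g D v"
  proof (rule component_at_le[OF u])
    fix y assume y: "0 \<le> y" "y \<le> u" "y \<in> D"
    have "component_at g D v \<le> component_at g D (u + v) - g y"
    proof (rule component_at_le[OF v])
      fix z assume z: "0 \<le> z" "z \<le> v" "z \<in> D"
      have "g (y + z) \<le> component_at g D (u + v)"
        using y z D_add by (intro le_component_at add_mono) auto
      then show "g z \<le> component_at g D (u + v) - g y" by (simp add: g.add)
    qed
    then show "g y \<le> component_at g D (u + v) - component_at g D v" by simp
  qed
  then show "component_at g D u + component_at g D v \<le> component_at g D (u + v)" by simp
qed

lemma component_at_mono: "0 \<le> u \<Longrightarrow> u \<le> v \<Longrightarrow> component_at g D u \<le> component_at g D v"
  using component_at_add[of u "v - u"] component_at_nonneg[of "v - u"] by simp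

lemma component_at_zero: "component_at g D 0 = 0"
  using component_at_add[of 0 0] by simp

lemma component_at_scale_le:
  assumes "0 \<le> z" "0 < t" shows "t * component_at g D z \<le> component_at g D (t *\<^sub>R z)"
proof -
  have "component_at g D z \<le> component_at g D (t *\<^sub>R z) / t"
  proof (rule component_at_le[OF assms(1)])
    fix y assume y: "0 \<le> y" "y \<le> z" "y \<in> D"
    have "g (t *\<^sub>R y) \<le> component_at g D (t *\<^sub>R z)"
      using y assms D_scale by (intro le_component_at scaleR_left_mono scaleR_nonneg_nonneg) auto
    then show "g y \<le> component_at g D (t *\<^sub>R z) / t"
      using assms by (simp add: g.scaleR field_simps)
  qed
  then show ?thesis using assms by (simp add: field_simps)
qed

lemma component_at_scale:
  assumes z: "0 \<le> z" and t: "0 \<le> t"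
  shows "component_at g D (t *\<^sub>R z) = t * component_at g D z"
proof (cases "t = 0")
  case False
  then have t: "0 < t" using t by simp
  have "(1/t) * component_at g D (t *\<^sub>R z) \<le> component_at g D ((1/t) *\<^sub>R t *\<^sub>R z)"
    using z t by (intro component_at_scale_le scaleR_nonneg_nonneg) auto
  then have "component_at g D (t *\<^sub>R z) \<le> t * component_at g D z" using t by (simp add: field_simps)
  then show ?thesis using component_at_scale_le[OF z t] by simp
qed (simp add: component_at_zero)

text \<open>
  The extension to the whole space may be computed from any decomposition into positive vectors, because
  two decompositions differ by an identity between sums of positive vectors.
\<close>

lemma component_diff:
  assumes "0 \<le> u" "0 \<le> v"
  shows "component g D (u - v) = component_at g D u - component_at g D v"
proof -
  let ?z = "u - v"
  have "pprt ?z + v = u + pprt (- ?z)"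
    using pprt_diff_pprt(1)[of ?z] by (simp add: algebra_simps)
  then have "component_at g D (pprt ?z) + component_at g D v = component_at g D u + component_at g D (pprt (- ?z))"
    using assms component_at_add by (metis zero_le_pprt)
  then show ?thesis by (simp add: component_def)
qed

lemma component_positive: "0 \<le> z \<Longrightarrow> component g D z = component_at g D z"
  using component_diff[of z 0] by (simp add: component_at_zero)

lemma component_nonneg: "0 \<le> z \<Longrightarrow> 0 \<le> component g D z"
  by (simp add: component_positive component_at_nonneg)

lemma linear_component: "linear (component g D)"
proof (rule linearI)
  fix x y :: 'a
  have "x + y = (pprt x + pprt y) - (pprt (- x) + pprt (- y))"
    using pprt_diff_pprt(1)[of x] pprt_diff_pprt(1)[of y] by (simp add: algebra_simps)
  then have "component g D (x + y) = component_at g D (pprt x + pprt y) - component_at g D (pprt (- x) + pprt (- y))"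
    by (metis component_diff add_nonneg_nonneg zero_le_pprt)
  then show "component g D (x + y) = component g D x + component g D y"
    by (simp add: component_def component_at_add)
next
  fix t :: real and x :: 'a
  have pos: "component g D (t *\<^sub>R x) = t * component g D x" if t: "0 \<le> t" for t and x :: 'a
  proof -
    have "t *\<^sub>R x = t *\<^sub>R pprt x - t *\<^sub>R pprt (- x)"
      using pprt_diff_pprt(1)[of x] by (simp flip: scaleR_diff_right)
    then have "component g D (t *\<^sub>R x) = component_at g D (t *\<^sub>R pprt x) - component_at g D (t *\<^sub>R pprt (- x))"
      using t by (metis component_diff scaleR_nonneg_nonneg zero_le_pprt)
    then show ?thesis using t by (simp add: component_def component_at_scale algebra_simps)
  qed
  show "component g D (t *\<^sub>R x) = t *\<^sub>R component g D x"
  proof (cases "0 \<le> t")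
    case False
    have "component g D (- x) = - component g D x" by (simp add: component_def)
    then show ?thesis using pos[of "- t" "- x"] False by simp
  qed (simp add: pos)
qed

end

lemma solid_cone_UNIV: "bounded_linear g \<Longrightarrow> solid_cone g UNIV"
  by (simp add: solid_cone_def)

section \<open>Weakly* null sequences and disjoint order bounded sequences\<close>

context
  fixes y :: "nat \<Rightarrow> 'a::banach_lattice" and z :: 'a
  assumes complete: "sigma_Dedekind_complete TYPE('a)"
    and y: "\<And>n. 0 \<le> y n" "\<And>n. y n \<le> z" and disjoint: "\<And>n m. n \<noteq> m \<Longrightarrow> inf (y n) (y m) = 0"
begin

definition sup_over :: "nat set \<Rightarrow> 'a" where
  "sup_over A = (SOME s. (\<forall>a\<in>insert 0 (y ` A). a \<le> s) \<and> (\<forall>u. (\<forall>a\<in>insert 0 (y ` A). a \<le> u) \<longrightarrow> s \<le> u))"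

lemma sup_over_is_lub:
  "(\<forall>a\<in>insert 0 (y ` A). a \<le> sup_over A) \<and>
     (\<forall>u. (\<forall>a\<in>insert 0 (y ` A). a \<le> u) \<longrightarrow> sup_over A \<le> u)"
proof -
  have "0 \<le> z" using y order_trans by blast
  then have "bdd_above (insert 0 (y ` A))" using y(2) by (intro bdd_aboveI[of _ z]) auto
  then have "insert 0 (y ` A) \<noteq> {} \<and> countable (insert 0 (y ` A)) \<and> bdd_above (insert 0 (y ` A))" by simp
  from complete[unfolded sigma_Dedekind_complete_def, THEN spec, THEN mp, OF this]
  have "\<exists>s. (\<forall>a\<in>insert 0 (y ` A). a \<le> s) \<and> (\<forall>u. (\<forall>a\<in>insert 0 (y ` A). a \<le> u) \<longrightarrow> s \<le> u)" .
  then show ?thesis unfolding sup_over_def by (rule someI_ex)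
qed

lemma sup_over_nonneg: "0 \<le> sup_over A" using sup_over_is_lub by simp

lemma le_sup_over: "n \<in> A \<Longrightarrow> y n \<le> sup_over A" using sup_over_is_lub by simp

lemma sup_over_le: "0 \<le> u \<Longrightarrow> (\<And>n. n \<in> A \<Longrightarrow> y n \<le> u) \<Longrightarrow> sup_over A \<le> u"
  using sup_over_is_lub by simp

lemma sup_over_mono: "A \<subseteq> B \<Longrightarrow> sup_over A \<le> sup_over B"
  by (intro sup_over_le sup_over_nonneg le_sup_over) auto

lemma sup_over_singleton: "sup_over {n} = y n"
  by (intro antisym sup_over_le le_sup_over y) auto

text \<open>
  The infimum \<open>d\<close> lies below \<open>w\<close>, so it is disjoint from each \<open>y n\<close>; thus \<open>d + y n\<close> is a supremum and stays below the
  supremum \<open>sup_over A\<close>; hence \<open>sup_over A - d\<close> is still an upper bound.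
\<close>

lemma inf_sup_over_eq_zero:
  assumes w: "0 \<le> w" "\<And>n. n \<in> A \<Longrightarrow> inf w (y n) = 0"
  shows "inf w (sup_over A) = 0"
proof -
  define d where "d = inf w (sup_over A)"
  have d: "0 \<le> d" "d \<le> w" "d \<le> sup_over A" using w sup_over_nonneg by (simp_all add: d_def)
  have "sup_over A \<le> sup_over A - d"
  proof (rule sup_over_le)
    fix n assume n: "n \<in> A"
    have "inf d (y n) \<le> inf w (y n)" using d by (intro inf_mono) auto
    then have "inf d (y n) = 0" using w(2)[OF n] d y(1) by (intro antisym) auto
    then have "d + y n = sup d (y n)" using add_eq_inf_sup[of d "y n"] by simp
    also have "\<dots> \<le> sup_over A" using le_sup_over[OF n] d by simp
    finally show "y n \<le> sup_over A - d" by (simp add: algebra_simps)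
  qed (use d in simp)
  then have "d \<le> 0" by simp
  then show ?thesis using d(1) unfolding d_def by (rule antisym)
qed

lemma sup_over_Un:
  assumes "A \<inter> B = {}" shows "sup_over (A \<union> B) = sup_over A + sup_over B"
proof (rule antisym)
  show "sup_over (A \<union> B) \<le> sup_over A + sup_over B"
    using le_sup_over sup_over_nonneg
    by (intro sup_over_le) (auto intro: add_increasing add_increasing2)
  have "inf (y n) (sup_over B) = 0" if "n \<in> A" for n
  proof (rule inf_sup_over_eq_zero[OF y(1)])
    fix m assume "m \<in> B"
    then have "n \<noteq> m" using assms that by auto
    then show "inf (y n) (y m) = 0" by (rule disjoint)
  qed
  then have "inf (sup_over B) (sup_over A) = 0"
    by (intro inf_sup_over_eq_zero sup_over_nonneg) (simp add: inf_commute)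
  then have "sup_over A + sup_over B = sup (sup_over A) (sup_over B)"
    using add_eq_inf_sup[of "sup_over A" "sup_over B"] by (simp add: inf_commute)
  also have "\<dots> \<le> sup_over (A \<union> B)" by (simp add: sup_over_mono)
  finally show "sup_over A + sup_over B \<le> sup_over (A \<union> B)" .
qed

text \<open>
  The suprema of subsequences form a finitely additive vector measure, and \<open>g n\<close> turns it into a scalar
  measure of finite variation.
\<close>

lemma disjoint_order_bounded_tendsto:
  assumes g: "\<And>n. bounded_linear (g n)" "\<And>x. (\<lambda>n. g n x) \<longlonglongrightarrow> (0::real)"
  shows "(\<lambda>n. g n (y n)) \<longlonglongrightarrow> 0"
proof -
  interpret p: solid_cone "g n" UNIV for n by (intro solid_cone_UNIV g)
  interpret m: solid_cone "\<lambda>x. - g n x" UNIV for n by (intro solid_cone_UNIV bounded_linear_minus g)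
  have "(\<lambda>n. g n (sup_over {n})) \<longlonglongrightarrow> 0"
  proof (rule finitely_additive_diagonal_tendsto[where \<mu> = "\<lambda>n A. g n (sup_over A)"
        and \<nu> = "\<lambda>n A. component_at (g n) UNIV (sup_over A) + component_at (\<lambda>x. - g n x) UNIV (sup_over A)"])
    show "(\<lambda>n. g n (sup_over A)) \<longlonglongrightarrow> 0" for A by (rule g(2))
    fix n A B
    show "g n (sup_over (A \<union> B)) = g n (sup_over A) + g n (sup_over B)" if "A \<inter> B = {}"
      by (simp add: sup_over_Un[OF that] linear_simps[OF g(1)])
    show "component_at (g n) UNIV (sup_over A) + component_at (\<lambda>x. - g n x) UNIV (sup_over A) +
        (component_at (g n) UNIV (sup_over B) + component_at (\<lambda>x. - g n x) UNIV (sup_over B))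
      \<le> component_at (g n) UNIV (sup_over (A \<union> B)) + component_at (\<lambda>x. - g n x) UNIV (sup_over (A \<union> B))"
      if "A \<inter> B = {}"
      by (simp add: sup_over_Un[OF that] p.component_at_add m.component_at_add sup_over_nonneg)
    show "component_at (g n) UNIV (sup_over A) + component_at (\<lambda>x. - g n x) UNIV (sup_over A)
      \<le> component_at (g n) UNIV (sup_over B) + component_at (\<lambda>x. - g n x) UNIV (sup_over B)" if "A \<subseteq> B"
      using that by (intro add_mono p.component_at_mono m.component_at_mono sup_over_nonneg sup_over_mono)
    show "\<bar>g n (sup_over A)\<bar> \<le>
      component_at (g n) UNIV (sup_over A) + component_at (\<lambda>x. - g n x) UNIV (sup_over A)"
      using p.le_component_at[of "sup_over A" "sup_over A" n] m.le_component_at[of "sup_over A" "sup_over A" n]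
        p.component_at_nonneg[of "sup_over A" n] m.component_at_nonneg[of "sup_over A" n] sup_over_nonneg[of A]
      by simp
  qed
  then show ?thesis by (simp add: sup_over_singleton)
qed

end

section \<open>Powers of components\<close>

lemma multilinear_op_form_diff:
  "multilinear_op k scalars S \<Longrightarrow> multilinear_op k scalars T \<Longrightarrow> multilinear_op k scalars (\<lambda>x. S x - T x)"
  unfolding multilinear_op_def by (auto simp: algebra_simps) metis

lemma symmetric_op_diff:
  "symmetric_op k S \<Longrightarrow> symmetric_op k T \<Longrightarrow> symmetric_op k (\<lambda>x. S x - T x :: real)"
  by (simp add: symmetric_op_def)

lemma symmetric_forms_eq:
  assumes "multilinear_op k scalars S" "symmetric_op k S" "multilinear_op k scalars T" "symmetric_op k T"
    and "\<And>x. S (\<lambda>_. x) = T (\<lambda>_. x)"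
  shows "S y = T y"
proof -
  have "fact k * S y = fact k * T y"
    using assms(5) by (simp flip: polarization[OF assms(1,2)] polarization[OF assms(3,4)])
  then show ?thesis by simp
qed

lemma symmetric_op_prod:
  fixes h :: "'a \<Rightarrow> real"
  shows "symmetric_op k (\<lambda>x. \<Prod>i<k. h (x i))"
  unfolding symmetric_op_def
proof (intro allI impI)
  fix \<sigma> and x :: "nat \<Rightarrow> 'a" assume "\<sigma> permutes {..<k}"
  from prod.permute[OF this, of "\<lambda>i. h (x i)"]
  show "(\<Prod>i<k. h ((x \<circ> \<sigma>) i)) = (\<Prod>i<k. h (x i))" by (simp add: comp_def)
qed

lemma prod_slot:
  fixes h :: "'a \<Rightarrow> real" and i k :: nat
  assumes "i < k"
  shows "(\<Prod>j<k. h ((x(i := a)) j)) = h a * (\<Prod>j\<in>{..<k} - {i}. h (x j))"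
  using assms by (subst prod.remove[of _ i]) (auto intro!: prod.cong)

lemma positive_op_prod:
  fixes h :: "'a::banach_lattice \<Rightarrow> real"
  assumes "linear h" "\<And>z. 0 \<le> z \<Longrightarrow> 0 \<le> h z"
  shows "positive_op k scalars (\<lambda>x. \<Prod>i<k. h (x i))"
  unfolding positive_op_def multilinear_op_def
proof (intro conjI allI impI)
  fix x :: "nat \<Rightarrow> 'a" and a b :: 'a and r :: real and i assume i: "i < k"
  show "(\<Prod>j<k. h ((x(i := a + b)) j)) = vadd scalars (\<Prod>j<k. h ((x(i := a)) j)) (\<Prod>j<k. h ((x(i := b)) j))"
    unfolding prod_slot[OF i] using assms(1) by (simp add: linear_add algebra_simps)
  show "(\<Prod>j<k. h ((x(i := r *\<^sub>R a)) j)) = vscale scalars r (\<Prod>j<k. h ((x(i := a)) j))"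
    unfolding prod_slot[OF i] using assms(1) by (simp add: linear_cmul)
next
  fix x :: "nat \<Rightarrow> 'a" assume "\<forall>i<k. 0 \<le> x i"
  then show "vle scalars (vzero scalars) (\<Prod>i<k. h (x i))" by (auto intro!: prod_nonneg assms(2))
qed (auto intro!: prod.cong)

text \<open>
  The power \<open>x \<mapsto> h x ^ k\<close> belongs to the symmetric form \<open>(x\<^sub>1, \<dots>, x\<^sub>k) \<mapsto> h x\<^sub>1 \<cdots> h x\<^sub>k\<close>.
\<close>

lemma positive_poly_power:
  fixes h :: "'a::banach_lattice \<Rightarrow> real"
  assumes "linear h" "\<And>z. 0 \<le> z \<Longrightarrow> 0 \<le> h z"
  shows "positive_poly k scalars (\<lambda>x. h x ^ k)"
  unfolding positive_poly_iff
  using positive_op_prod[OF assms, of k] symmetric_op_prod[of k h]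
  by (intro exI[of _ "\<lambda>x. \<Prod>i<k. h (x i)"]) simp

lemma regular_polys_modulus_positive:
  assumes "positive_poly k scalars P" shows "is_modulus (regular_polys k) P P"
proof -
  have "(\<lambda>x. P x - - 1 * P x) = (\<lambda>x. P x + P x)" by simp
  then have "positive_poly k scalars (\<lambda>x. P x - - 1 * P x)"
    using positive_poly_add[OF assms assms] by simp
  then show ?thesis
    using assms by (simp add: is_modulus_def is_sup_def positive_imp_regular positive_poly_zero)
qed

text \<open>For \<open>e \<ge> 0\<close>, its positive elements form the positive cone of the ideal generated by \<open>e\<close>.\<close>

definition principal_cone :: "'a::banach_lattice \<Rightarrow> 'a set" where
  "principal_cone e = {y. \<exists>t\<ge>0. y \<le> t *\<^sub>R e}"

lemma solid_cone_principal:
  assumes "bounded_linear g" shows "solid_cone g (principal_cone e)"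
proof (rule solid_cone.intro[OF assms])
  show "0 \<in> principal_cone e" by (auto simp: principal_cone_def intro: exI[of _ 0])
next
  fix a b assume "a \<in> principal_cone e" "b \<in> principal_cone e"
  then obtain s t where st: "0 \<le> s" "a \<le> s *\<^sub>R e" "0 \<le> t" "b \<le> t *\<^sub>R e" by (auto simp: principal_cone_def)
  then have "a + b \<le> (s + t) *\<^sub>R e" by (simp add: scaleR_add_left add_mono)
  then show "a + b \<in> principal_cone e"
    using st unfolding principal_cone_def by (intro CollectI exI[of _ "s + t"]) simp
next
  fix a and t :: real assume "a \<in> principal_cone e" and t: "0 \<le> t"
  then obtain s where s: "0 \<le> s" "a \<le> s *\<^sub>R e" by (auto simp: principal_cone_def)
  have "t *\<^sub>R a \<le> (t * s) *\<^sub>R e" using scaleR_left_mono[OF s(2) t] by simp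
  then show "t *\<^sub>R a \<in> principal_cone e"
    using s t unfolding principal_cone_def by (intro CollectI exI[of _ "t * s"]) simp
next
  fix a b assume "a \<le> b" "b \<in> principal_cone e"
  then show "a \<in> principal_cone e" unfolding principal_cone_def using order_trans by blast
qed

lemma inf_principal_cone_zero:
  assumes "inf e f = 0" "0 \<le> a" "a \<in> principal_cone e" "0 \<le> b" "b \<in> principal_cone f"
  shows "inf a b = 0"
  using assms inf_multiples_zero[OF assms(1,2) _ assms(4)] by (auto simp: principal_cone_def)

lemma principal_cone_self: "e \<in> principal_cone e"
  by (auto simp: principal_cone_def intro: exI[of _ 1])

lemma component_at_disjoint:
  assumes g: "bounded_linear g" and e: "inf e z = 0"
  shows "component_at g (principal_cone e) z = 0"
proof -
  interpret solid_cone g "principal_cone e" by (rule solid_cone_principal[OF g])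
  have z: "0 \<le> z" using e by (metis inf_le2)
  have "component_at g (principal_cone e) z \<le> 0"
  proof (rule component_at_le[OF z])
    fix y assume y: "0 \<le> y" "y \<le> z" "y \<in> principal_cone e"
    have "inf y z = 0" by (rule inf_principal_cone_zero[OF e y(1,3) z principal_cone_self])
    then have "y = 0" using y(2) by (simp add: inf_absorb1)
    then show "g y \<le> 0" by (simp add: linear_simps[OF g])
  qed
  then show ?thesis using component_at_nonneg[OF z] by simp
qed

text \<open>
  A polynomial \<open>u\<close> below both powers is estimated by splitting one argument \<open>z\<close> into a part \<open>a\<close> in the band of
  the first component, where the second power vanishes, and a remainder \<open>z - a\<close> on which the first power
  is as small as desired.
\<close>

lemma component_powers_disjoint:
  fixes e1 e2 :: "'a::banach_lattice"
  assumes "1 \<le> k" and g1: "bounded_linear g1" and g2: "bounded_linear g2" and e: "inf e1 e2 = 0"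
  defines "h1 \<equiv> component g1 (principal_cone e1)" and "h2 \<equiv> component g2 (principal_cone e2)"
  shows "is_inf (regular_polys k) (\<lambda>x. h1 x ^ k) (\<lambda>x. h2 x ^ k) (vzero (regular_polys k))"
proof -
  interpret c1: solid_cone g1 "principal_cone e1" by (rule solid_cone_principal[OF g1])
  interpret c2: solid_cone g2 "principal_cone e2" by (rule solid_cone_principal[OF g2])
  have h: "linear h1" "\<And>z. 0 \<le> z \<Longrightarrow> 0 \<le> h1 z" "linear h2" "\<And>z. 0 \<le> z \<Longrightarrow> 0 \<le> h2 z"
    unfolding h1_def h2_def by (simp_all add: c1.linear_component c1.component_nonneg c2.linear_component c2.component_nonneg)
  have "positive_poly k scalars (\<lambda>x. - u x)"
    if u: "positive_poly k scalars (\<lambda>x. h1 x ^ k - u x)" "positive_poly k scalars (\<lambda>x. h2 x ^ k - u x)" for u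
  proof -
    obtain T1 T2 where T1: "positive_op k scalars T1" "symmetric_op k T1" "\<And>x. h1 x ^ k - u x = T1 (\<lambda>_. x)"
      and T2: "positive_op k scalars T2" "symmetric_op k T2" "\<And>x. h2 x ^ k - u x = T2 (\<lambda>_. x)"
      using u unfolding positive_poly_iff by blast
    define S where "S y = (\<Prod>i<k. h1 (y i)) - T1 y" for y
    define S' where "S' y = (\<Prod>i<k. h2 (y i)) - T2 y" for y
    have S: "multilinear_op k scalars S" "symmetric_op k S"
      using positive_op_prod[OF h(1,2), of k] T1 unfolding S_def positive_op_def
      by (simp_all add: multilinear_op_form_diff symmetric_op_diff symmetric_op_prod)
    have S': "multilinear_op k scalars S'" "symmetric_op k S'"
      using positive_op_prod[OF h(3,4), of k] T2 unfolding S'_def positive_op_def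
      by (simp_all add: multilinear_op_form_diff symmetric_op_diff symmetric_op_prod)
    have diag: "S (\<lambda>_. x) = u x" "S' (\<lambda>_. x) = u x" for x
      using T1(3)[of x] T2(3)[of x] by (simp_all add: S_def S'_def)
    have SS': "S y = S' y" for y by (rule symmetric_forms_eq[OF S S']) (simp add: diag)
    have le1: "S y \<le> (\<Prod>i<k. h1 (y i))" if "\<forall>i<k. 0 \<le> y i" for y
      using T1(1) that by (simp add: S_def positive_op_def)
    have le2: "S y \<le> (\<Prod>i<k. h2 (y i))" if "\<forall>i<k. 0 \<le> y i" for y
      unfolding SS' using T2(1) that by (simp add: S'_def positive_op_def)
    have "S y \<le> 0" if y: "\<forall>i<k. 0 \<le> y i" for y
    proof (rule field_le_epsilon)
      fix \<epsilon> :: real assume \<epsilon>: "0 < \<epsilon>"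
      let ?z = "y 0" and ?K = "\<Prod>j\<in>{..<k} - {0}. h1 (y j)"
      have K: "0 \<le> ?K" using y h(2) by (intro prod_nonneg) auto
      \<comment> \<open>the summand 1 keeps the quotient meaningful when the product vanishes\<close>
      define \<delta> where "\<delta> = \<epsilon> / (?K + 1)"
      have \<delta>: "0 < \<delta>" "\<delta> * ?K \<le> \<epsilon>" using \<epsilon> K by (simp_all add: \<delta>_def field_simps)
      have k0: "0 < k" using \<open>1 \<le> k\<close> by simp
      then have z: "0 \<le> ?z" using y by blast
      have "\<exists>a. 0 \<le> a \<and> a \<le> ?z \<and> a \<in> principal_cone e1 \<and> component_at g1 (principal_cone e1) ?z - \<delta> < g1 a"
      proof (rule ccontr)
        assume "\<not> ?thesis"
        then have "component_at g1 (principal_cone e1) ?z \<le> component_at g1 (principal_cone e1) ?z - \<delta>"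
          by (intro c1.component_at_le[OF z]) (auto simp: not_less)
        then show False using \<delta> by simp
      qed
      then obtain a where a: "0 \<le> a" "a \<le> ?z" "a \<in> principal_cone e1"
          "component_at g1 (principal_cone e1) ?z - \<delta> < g1 a" by blast
      have "h1 (?z - a) = component_at g1 (principal_cone e1) ?z - component_at g1 (principal_cone e1) a"
        unfolding h1_def using a z by (simp add: c1.component_diff)
      moreover have "g1 a \<le> component_at g1 (principal_cone e1) a" using a by (intro c1.le_component_at) auto
      ultimately have small: "h1 (?z - a) \<le> \<delta>" using a(4) by simp
      have "inf e2 a = 0"
        using inf_principal_cone_zero[OF e a(1,3) _ principal_cone_self] e by (metis inf_commute inf_le2)
      then have zero: "h2 a = 0" using a(1) unfolding h2_def by (simp add: c2.component_positive component_at_disjoint[OF g2])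
      have "S y = S (y(0 := a + (?z - a)))" by simp
      also have "\<dots> = S (y(0 := a)) + S (y(0 := ?z - a))"
        using multilinear_op_add[OF S(1) k0, of y a "?z - a"] by simp
      also have "\<dots> \<le> (\<Prod>i<k. h2 ((y(0 := a)) i)) + (\<Prod>i<k. h1 ((y(0 := ?z - a)) i))"
        using a y by (intro add_mono le1 le2) auto
      also have "\<dots> = h1 (?z - a) * ?K" by (simp only: prod_slot[OF k0] zero)
      also have "\<dots> \<le> \<delta> * ?K" by (rule mult_right_mono[OF small K])
      finally show "S y \<le> 0 + \<epsilon>" using \<delta>(2) by simp
    qed
    then have "positive_op k scalars (\<lambda>y. 0 - S y)"
      using multilinear_op_form_diff[OF _ S(1), of "\<lambda>_. 0"] by (simp add: positive_op_def multilinear_op_def)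
    moreover have "symmetric_op k (\<lambda>y. 0 - S y)" using S(2) by (simp add: symmetric_op_def)
    moreover have "- u x = 0 - S (\<lambda>_. x)" for x using T1(3)[of x] by (simp add: S_def)
    ultimately show ?thesis unfolding positive_poly_iff by blast
  qed
  then show ?thesis
    by (simp add: is_inf_def positive_imp_regular positive_poly_zero positive_poly_power h)
qed

text \<open>
  If the property fails, weakly* null functionals \<open>f n\<close> and a disjoint weakly summable sequence satisfy
  \<open>\<bar>f n (x n)\<bar> \<ge> \<epsilon>\<close> after passing to subsequences.  Up to a sign \<open>s n\<close>, half of this comes from the
  positive or the negative part \<open>e n\<close> of \<open>x n\<close>.  The components of \<open>(s n f n)\<^sup>+\<close> in the band of \<open>e n\<close> are
  positive and disjoint, and \<open>\<sigma>\<close>-Dedekind completeness makes them weakly* null.  Their powers inherit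
  all of this and stay away from zero at \<open>x n\<close>.
\<close>

lemma disjoint_DP_star_if_positive_disjoint_forms:
  assumes complete: "sigma_Dedekind_complete TYPE('a::banach_lattice)" and k: "1 \<le> k"
    and forms: "\<And>(x :: nat \<Rightarrow> 'a) P. disjoint_sequence x \<Longrightarrow> weakly_summable p x \<Longrightarrow>
      positive_seq (regular_polys k) P \<Longrightarrow> disjoint_seq (regular_polys k) P \<Longrightarrow>
      weak_star_null_polys k P \<Longrightarrow> (\<lambda>n. P n (x n)) \<longlonglongrightarrow> 0"
  shows "disjoint_DP_star TYPE('a) p"
  unfolding disjoint_DP_star_def limited_set_def
proof (intro allI impI, elim conjE)
  fix x0 :: "nat \<Rightarrow> 'a" and f0 :: "nat \<Rightarrow> 'a \<Rightarrow> real"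
  assume x0: "disjoint_sequence x0" "weakly_summable p x0"
    and f0: "\<forall>n. bounded_linear (f0 n)" "\<forall>x. (\<lambda>n. f0 n x) \<longlonglongrightarrow> 0"
  show "uniform_limit (range x0) f0 (\<lambda>_. 0) sequentially"
  proof (rule ccontr)
    assume "\<not> ?thesis"
    then obtain \<epsilon> where \<epsilon>: "0 < \<epsilon>" and often: "\<And>N. \<exists>n\<ge>N. \<exists>m. \<epsilon> \<le> \<bar>f0 n (x0 m)\<bar>"
      unfolding uniform_limit_sequentially_iff by (force simp: not_less)
    \<comment> \<open>Both indices can be made strictly increasing: each of the finitely many \<open>x0 m\<close> with \<open>m\<close> below the
      last index is eventually mapped below \<open>\<epsilon>\<close>, so a later violation occurs at a new \<open>m\<close>.\<close>
    have "\<exists>r :: nat \<Rightarrow> nat \<times> nat. \<forall>j. \<epsilon> \<le> \<bar>f0 (fst (r j)) (x0 (snd (r j)))\<bar> \<and>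
        (fst (r j) < fst (r (Suc j)) \<and> snd (r j) < snd (r (Suc j)))"
    proof (rule dependent_nat_choice)
      show "\<exists>s. \<epsilon> \<le> \<bar>f0 (fst s) (x0 (snd s))\<bar>" using often[of 0] by auto
    next
      fix s :: "nat \<times> nat"
      have "(\<lambda>n. \<Sum>m\<le>snd s. \<bar>f0 n (x0 m)\<bar>) \<longlonglongrightarrow> 0"
        using f0(2) by (intro tendsto_null_sum tendsto_rabs_zero) auto
      then have "\<forall>\<^sub>F n in sequentially. (\<Sum>m\<le>snd s. \<bar>f0 n (x0 m)\<bar>) < \<epsilon>" using \<epsilon> by (rule order_tendstoD)
      then obtain N where N: "\<And>n. n \<ge> N \<Longrightarrow> (\<Sum>m\<le>snd s. \<bar>f0 n (x0 m)\<bar>) < \<epsilon>"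
        by (auto simp: eventually_sequentially)
      obtain n m where nm: "N + Suc (fst s) \<le> n" "\<epsilon> \<le> \<bar>f0 n (x0 m)\<bar>" using often by blast
      have "snd s < m"
      proof (rule ccontr)
        assume "\<not> snd s < m"
        then have "\<bar>f0 n (x0 m)\<bar> \<le> (\<Sum>m\<le>snd s. \<bar>f0 n (x0 m)\<bar>)" by (intro member_le_sum) auto
        then show False using N[of n] nm by simp
      qed
      then show "\<exists>t. \<epsilon> \<le> \<bar>f0 (fst t) (x0 (snd t))\<bar> \<and> fst s < fst t \<and> snd s < snd t"
        using nm by (intro exI[of _ "(n, m)"]) simp
    qed
    then obtain r :: "nat \<Rightarrow> nat \<times> nat" where r: "\<And>j. \<epsilon> \<le> \<bar>f0 (fst (r j)) (x0 (snd (r j)))\<bar>"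
      "\<And>j. fst (r j) < fst (r (Suc j))" "\<And>j. snd (r j) < snd (r (Suc j))" by blast
    have mono: "strict_mono (\<lambda>j. fst (r j))" "strict_mono (\<lambda>j. snd (r j))"
      using r by (simp_all add: strict_mono_Suc_iff)
    define x where "x = x0 \<circ> (\<lambda>j. snd (r j))"
    define f where "f j = f0 (fst (r j))" for j
    have x: "disjoint_sequence x" "weakly_summable p x"
      unfolding x_def using x0 mono by (simp_all add: disjoint_sequence_subseq weakly_summable_subseq)
    have f: "bounded_linear (f j)" "(\<lambda>j. f j z) \<longlonglongrightarrow> 0" for j z
      using f0 LIMSEQ_subseq_LIMSEQ[OF _ mono(1), of "\<lambda>n. f0 n z" 0] by (auto simp: f_def o_def)
    have large: "\<epsilon> \<le> \<bar>f j (x j)\<bar>" for j using r(1) by (simp add: x_def f_def)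
    define e where "e j = (if \<epsilon> / 2 \<le> \<bar>f j (pprt (x j))\<bar> then pprt (x j) else pprt (- x j))" for j
    define s where "s j = sgn (f j (e j))" for j
    define g where "g j z = s j * f j z" for j z
    have fe: "\<epsilon> / 2 \<le> \<bar>f j (e j)\<bar>" for j
    proof -
      have "f j (x j) = f j (pprt (x j) - pprt (- x j))" by (simp add: pprt_diff_pprt)
      also have "\<dots> = f j (pprt (x j)) - f j (pprt (- x j))" by (simp add: linear_simps[OF f(1)])
      finally show ?thesis using large[of j] by (auto simp: e_def)
    qed
    have e: "0 \<le> e j" "e j \<le> \<bar>x j\<bar>" for j by (simp_all add: e_def pprt_le_abs)
    have e_disjoint: "inf (e i) (e j) = 0" if "i \<noteq> j" for i j
    proof (rule antisym)
      have "inf (e i) (e j) \<le> inf \<bar>x i\<bar> \<bar>x j\<bar>" using e by (intro inf_mono)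
      also have "\<dots> = 0" using x(1) that by (simp add: disjoint_sequence_def)
      finally show "inf (e i) (e j) \<le> 0" .
    qed (simp add: e)
    have g: "bounded_linear (g j)" for j
      unfolding g_def by (intro bounded_linear_const_mult f)
    have g_null: "(\<lambda>j. g j z) \<longlonglongrightarrow> 0" for z
    proof (rule Lim_null_comparison[OF always_eventually])
      show "\<forall>j. norm (g j z) \<le> \<bar>f j z\<bar>"
        by (auto simp: g_def s_def abs_mult sgn_if)
      show "(\<lambda>j. \<bar>f j z\<bar>) \<longlonglongrightarrow> 0" by (intro tendsto_rabs_zero f)
    qed
    have ge: "\<epsilon> / 2 \<le> g j (e j)" for j using fe[of j] by (simp add: g_def s_def linordered_idom_class.abs_sgn mult.commute)
    let ?D = "\<lambda>j. principal_cone (e j)"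
    interpret c: solid_cone "g j" "?D j" for j by (rule solid_cone_principal[OF g])
    define h where "h j = component (g j) (?D j)" for j
    have h: "linear (h j)" "\<And>z. 0 \<le> z \<Longrightarrow> 0 \<le> h j z" for j
      unfolding h_def by (simp_all add: c.linear_component c.component_nonneg)
    have null: "(\<lambda>j. h j z) \<longlonglongrightarrow> 0" if z: "0 \<le> z" for z
    proof -
      have "\<exists>y. 0 \<le> y \<and> y \<le> z \<and> y \<in> ?D j \<and> h j z - 1 / real (Suc j) < g j y" for j
      proof (rule ccontr)
        assume "\<not> ?thesis"
        then have "component_at (g j) (?D j) z \<le> h j z - 1 / real (Suc j)"
          by (intro c.component_at_le[OF z]) (auto simp: not_less)
        then show False using z by (simp add: h_def c.component_positive)
      qed
      then obtain y where y: "\<And>j. 0 \<le> y j" "\<And>j. y j \<le> z" "\<And>j. y j \<in> ?D j"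
          "\<And>j. h j z - 1 / real (Suc j) < g j (y j)" by metis
      have "(\<lambda>j. g j (y j)) \<longlonglongrightarrow> 0"
      proof (rule disjoint_order_bounded_tendsto[OF complete y(1,2)])
        show "inf (y i) (y j) = 0" if "i \<noteq> j" for i j
          by (rule inf_principal_cone_zero[OF e_disjoint[OF that] y(1) y(3) y(1) y(3)])
      qed (rule g g_null)+
      then have "(\<lambda>j. g j (y j) + 1 / real (Suc j)) \<longlonglongrightarrow> 0"
        using tendsto_add[OF _ LIMSEQ_inverse_real_of_nat] by (fastforce simp: inverse_eq_divide)
      moreover have "norm (h j z) \<le> g j (y j) + 1 / real (Suc j)" for j
        using h(2)[OF z, of j] y(4)[of j] by simp
      ultimately show ?thesis by (rule Lim_null_comparison[OF always_eventually[OF allI], rotated])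
    qed
    \<comment> \<open>The supremum of the \<open>h j\<close> is finite, monotone and homogeneous, hence bounded on the cone by a
      multiple of the norm; this is the uniform bound needed for weak* nullity.\<close>
    have bounded: "\<exists>C\<ge>0. \<forall>j z. 0 \<le> z \<longrightarrow> h j z \<le> C * norm z"
    proof -
      have bdd: "bdd_above (range (\<lambda>j. h j z))" if "0 \<le> z" for z
        using convergent_imp_Bseq[OF convergentI[OF null[OF that]]] by (auto simp: Bseq_eq_bounded bounded_imp_bdd_above)
      have upper: "h j z \<le> (SUP j. h j z)" if "0 \<le> z" for j z by (rule cSUP_upper[OF UNIV_I bdd[OF that]])
      have scale_le: "(SUP j. h j (t *\<^sub>R z)) \<le> t * (SUP j. h j z)" if "0 \<le> z" "0 \<le> t" for z t
      proof (rule cSUP_least)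
        fix j show "h j (t *\<^sub>R z) \<le> t * (SUP j. h j z)"
          using mult_left_mono[OF upper[OF that(1), of j] that(2)] h(1)[of j] by (simp add: linear_cmul)
      qed simp
      obtain C where "0 \<le> C" "\<And>z. 0 \<le> z \<Longrightarrow> (SUP j. h j z) \<le> C * norm z ^ 1"
      proof (rule monotone_homogeneous_bounded[where \<phi> = "\<lambda>z. SUP j. h j z" and k = 1])
        fix z w :: 'a assume zw: "0 \<le> z" "z \<le> w"
        show "(SUP j. h j z) \<le> (SUP j. h j w)"
        proof (rule cSUP_mono)
          show "bdd_above (range (\<lambda>j. h j w))" using bdd zw by (meson order_trans)
          show "\<exists>m\<in>UNIV. h n z \<le> h m w" for n
            using zw c.component_at_mono[of z w n] order_trans[OF zw] by (auto simp: h_def c.component_positive)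
        qed simp
      next
        fix z :: 'a and t :: real assume zt: "0 \<le> z" "0 \<le> t"
        show "(SUP j. h j (t *\<^sub>R z)) = t ^ 1 * (SUP j. h j z)"
        proof (cases "t = 0")
          case True
          then show ?thesis using h(1) by (simp add: linear_0)
        next
          case False
          have "(SUP j. h j ((1/t) *\<^sub>R t *\<^sub>R z)) \<le> (1/t) * (SUP j. h j (t *\<^sub>R z))"
            using zt by (intro scale_le scaleR_nonneg_nonneg) auto
          then have "t * (SUP j. h j z) \<le> (SUP j. h j (t *\<^sub>R z))" using False zt by (simp add: field_simps)
          then show ?thesis using scale_le[OF zt] by simp
        qed
      qed auto
      then show ?thesis using upper by (intro exI[of _ C]) (auto intro: order_trans)
    qed
    then obtain C where C: "0 \<le> C" "\<And>j z. 0 \<le> z \<Longrightarrow> h j z \<le> C * norm z" by blast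
    define P where "P j z = h j z ^ k" for j z
    have P: "positive_poly k scalars (P j)" for j unfolding P_def by (rule positive_poly_power[OF h])
    have "(\<lambda>j. P j (x j)) \<longlonglongrightarrow> 0"
    proof (rule forms[OF x])
      show "positive_seq (regular_polys k) P" using P by (simp add: positive_seq_def)
      show "disjoint_seq (regular_polys k) P"
        unfolding disjoint_seq_def
      proof (intro allI impI)
        fix i j :: nat assume "i \<noteq> j"
        then have "is_inf (regular_polys k) (P i) (P j) (vzero (regular_polys k))"
          unfolding P_def h_def by (intro component_powers_disjoint k g e_disjoint)
        then show "\<exists>a b. is_modulus (regular_polys k) (P i) a \<and> is_modulus (regular_polys k) (P j) b \<and>
            is_inf (regular_polys k) a b (vzero (regular_polys k))"
          using regular_polys_modulus_positive P by blast
      qed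
      show "weak_star_null_polys k P"
      proof (rule weak_star_null_polysI[OF k P])
        fix z :: 'a assume z: "0 \<le> z"
        show "(\<lambda>j. P j z) \<longlonglongrightarrow> 0"
          using tendsto_power[OF null[OF z], of k] k by (simp add: P_def power_0_left)
        show "P j z \<le> C ^ k * norm z ^ k" for j
          using power_mono[OF C(2)[OF z] h(2)[OF z], of j k] by (simp add: P_def power_mult_distrib)
      qed
    qed
    moreover have "(\<epsilon> / 2) ^ k \<le> \<bar>P j (x j)\<bar>" for j
    proof -
      have other: "component_at (g j) (?D j) w = 0" if "inf (e j) w = 0" for w
        by (rule component_at_disjoint[OF g that])
      have "\<bar>h j (x j)\<bar> = \<bar>component_at (g j) (?D j) (e j)\<bar>"
        using other[of "pprt (- x j)"] other[of "pprt (x j)"] inf_pprt_pprt_uminus[of "x j"]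
        by (auto simp: h_def component_def e_def inf_commute)
      moreover have "g j (e j) \<le> component_at (g j) (?D j) (e j)"
        by (intro c.le_component_at e principal_cone_self) simp
      ultimately have "\<epsilon> / 2 \<le> \<bar>h j (x j)\<bar>" using ge[of j] by simp
      then have "(\<epsilon> / 2) ^ k \<le> \<bar>h j (x j)\<bar> ^ k" using \<epsilon> by (intro power_mono) auto
      then show ?thesis by (simp add: P_def power_abs)
    qed
    ultimately have "(\<epsilon> / 2) ^ k \<le> 0"
      by (intro LIMSEQ_le_const[OF tendsto_rabs_zero]) auto
    moreover have "0 < (\<epsilon> / 2) ^ k" using \<epsilon> by simp
    ultimately show False by simp
  qed
qed

section \<open>The equivalences\<close>

lemma regular_poly_form:
  assumes "regular_poly k scalars P"
  obtains T where "multilinear_op k scalars T" "symmetric_op k T" "separately_bounded_linear k T"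
    "\<And>x. P x = T (\<lambda>_. x)"
proof -
  obtain Q R where Q: "positive_poly k scalars Q" and R: "positive_poly k scalars R"
    and P: "P = (\<lambda>x. Q x - R x)" using assms by (rule regular_polyE)
  obtain S T where S: "positive_op k scalars S" "symmetric_op k S" "\<And>x. Q x = S (\<lambda>_. x)"
    and T: "positive_op k scalars T" "symmetric_op k T" "\<And>x. R x = T (\<lambda>_. x)"
    using Q R unfolding positive_poly_iff by blast
  show ?thesis
  proof (rule that[of "\<lambda>x. S x - T x"])
    show "multilinear_op k scalars (\<lambda>x. S x - T x)"
      using S(1) T(1) by (intro multilinear_op_form_diff) (simp_all add: positive_op_def)
    show "separately_bounded_linear k (\<lambda>x. S x - T x)"
      by (intro separately_bounded_linear_diff positive_form_separately_bounded_linear S T)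
  qed (simp_all add: P S T symmetric_op_diff)
qed

text \<open>
  At the tensor powers weak* convergence is pointwise convergence; polarization extends it to the associated
  forms, whose slots can then be filled one after the other.
\<close>

lemma DP_star_imp_weak_star_null_forms:
  fixes x :: "nat \<Rightarrow> 'a::banach_lattice"
  assumes DP: "disjoint_DP_star TYPE('a) p" and "0 < p" "1 \<le> k"
    and x: "disjoint_sequence x" "weakly_summable p x" and P: "weak_star_null_polys k P"
  shows "(\<lambda>n. P n (x n)) \<longlonglongrightarrow> 0"
proof -
  have "\<exists>T. multilinear_op k scalars T \<and> symmetric_op k T \<and> separately_bounded_linear k T \<and>
      (\<forall>x. P n x = T (\<lambda>_. x))" for n
  proof -
    have "regular_poly k scalars (P n)" using P by (simp add: weak_star_null_polys_def)
    then show ?thesis by (rule regular_poly_form) blast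
  qed
  then obtain T where T: "\<And>n. multilinear_op k scalars (T n)" "\<And>n. symmetric_op k (T n)"
      "\<And>n. separately_bounded_linear k (T n)" and PT: "\<And>n x. P n x = T n (\<lambda>_. x)" by metis
  have null: "(\<lambda>n. T n y) \<longlonglongrightarrow> 0" for y
    by (rule polarization_tendsto[OF T(1,2)])
      (use weak_star_null_polys_pointwise[OF \<open>1 \<le> k\<close> P] in \<open>simp add: PT\<close>)
  have "(\<lambda>n. T n (\<lambda>_. x n)) \<longlonglongrightarrow> 0"
  proof (rule disjoint_DP_star_forms_tendsto[OF DP \<open>0 < p\<close> \<open>1 \<le> k\<close> x T(3), where S = "\<lambda>_. 0"])
    show "separately_bounded_linear k (\<lambda>_ :: nat \<Rightarrow> 'a. 0)"
      by (simp add: separately_bounded_linear_def bounded_linear_zero)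
  qed (rule null, rule multilinear_op_cong[OF T(1)])
  then show ?thesis by (simp add: PT)
qed

text \<open>
  Functionals \<open>f n\<close> norming \<open>P (x n)\<close> have a weakly* convergent subsequence.  Composed with the operator
  associated to \<open>P\<close>, they form a pointwise convergent sequence of forms, so \<open>f n (P (x n))\<close>, which is the
  norm of \<open>P (x n)\<close>, tends to zero along it.
\<close>

lemma (in banach_lattice_on) DP_star_imp_disjoint_convergent:
  fixes P :: "'a::banach_lattice \<Rightarrow> 'b"
  assumes DP: "disjoint_DP_star TYPE('a) p" and p: "0 < p" and k: "1 \<le> k"
    and compact: "dual_ball_seq_weak_star_compact F" and P: "positive_poly k F P"
  shows "disjoint_convergent p F P"
  unfolding disjoint_convergent_def
proof (intro allI impI, elim conjE, rule ccontr)
  fix x :: "nat \<Rightarrow> 'a"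
  assume x: "disjoint_sequence x" "weakly_summable p x"
    and "\<not> (\<lambda>n. vnorm F (P (x n))) \<longlonglongrightarrow> 0"
  obtain T where T: "positive_op k F T" and PT: "\<And>x. P x = T (\<lambda>_. x)"
    using P unfolding positive_poly_iff by blast
  have M: "multilinear_op k F T" using T by (simp add: positive_op_def)
  have cl: "T y \<in> car F" for y by (rule multilinear_op_closed[OF M])
  have nonneg: "0 \<le> vnorm F (P y)" for y unfolding PT by (rule vnorm_nonneg[OF cl])
  obtain \<epsilon> where \<epsilon>: "0 < \<epsilon>" and often: "\<And>N. \<exists>n\<ge>N. \<epsilon> \<le> vnorm F (P (x n))"
    using \<open>\<not> (\<lambda>n. vnorm F (P (x n))) \<longlonglongrightarrow> 0\<close> nonneg unfolding LIMSEQ_iff by (force simp: not_less)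
  have "infinite {n. \<epsilon> \<le> vnorm F (P (x n))}"
    using often unfolding infinite_nat_iff_unbounded_le by auto
  then obtain q :: "nat \<Rightarrow> nat" where q: "strict_mono q" "\<And>n. \<epsilon> \<le> vnorm F (P (x (q n)))"
    using infinite_enumerate by blast
  have "\<forall>n. \<exists>f\<in>dual_ball F. f (P (x (q n))) = vnorm F (P (x (q n)))"
    using norming_functional cl by (simp add: PT)
  then obtain f where f: "\<And>n. f n \<in> dual_ball F" "\<And>n. f n (P (x (q n))) = vnorm F (P (x (q n)))" by metis
  obtain g r where g: "g \<in> dual_ball F" and r: "strict_mono r"
    and lim: "\<And>y. y \<in> car F \<Longrightarrow> (\<lambda>n. f (r n) y) \<longlonglongrightarrow> g y"
    using compact[unfolded dual_ball_seq_weak_star_compact_def, rule_format, of f] f(1) by blast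
  let ?s = "q \<circ> r"
  have s: "strict_mono ?s" using q(1) r by (rule strict_mono_o)
  have "(\<lambda>n. f (r n) (T (\<lambda>_. (x \<circ> ?s) n))) \<longlonglongrightarrow> 0"
  proof (rule disjoint_DP_star_forms_tendsto[OF DP p k, where T = "\<lambda>n y. f (r n) (T y)" and S = "\<lambda>y. g (T y)"])
    show "disjoint_sequence (x \<circ> ?s)" "weakly_summable p (x \<circ> ?s)"
      using x s by (simp_all only: disjoint_sequence_subseq weakly_summable_subseq)
    have "f n \<in> dual F" for n using f(1) by (simp add: dual_ball_def)
    then show "separately_bounded_linear k (\<lambda>y. f (r n) (T y))" for n
      by (rule dual_positive_op_separately_bounded_linear[OF T])
    show "separately_bounded_linear k (\<lambda>y. g (T y))"
      using g by (intro dual_positive_op_separately_bounded_linear[OF T]) (simp add: dual_ball_def)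
    show "(\<lambda>n. f (r n) (T y)) \<longlonglongrightarrow> g (T y)" for y by (rule lim[OF cl])
    show "f (r n) (T y) = f (r n) (T z)" if "\<And>i. i < k \<Longrightarrow> y i = z i" for n y z
      using multilinear_op_cong[OF M that] by simp
  qed
  then have "(\<lambda>n. vnorm F (P (x (q (r n))))) \<longlonglongrightarrow> 0" by (simp add: f(2) flip: PT)
  then have "\<epsilon> \<le> 0" using q(2) by (intro LIMSEQ_le_const) auto
  then show False using \<epsilon> by simp
qed

lemma disjoint_convergent_c0_if_embedded:
  fixes P :: "'a::banach_lattice \<Rightarrow> nat \<Rightarrow> real"
  assumes universe: "car c0 \<lesssim> (UNIV :: 'u set)"
    and all: "\<And>(F :: 'u normed_lattice) (P :: 'a \<Rightarrow> 'u). banach_lattice_on F \<Longrightarrow>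
      dual_ball_seq_weak_star_compact F \<Longrightarrow> positive_poly k F P \<Longrightarrow> disjoint_convergent p F P"
    and P: "positive_poly k c0 P"
  shows "disjoint_convergent p c0 P"
proof -
  obtain \<iota> :: "(nat \<Rightarrow> real) \<Rightarrow> 'u" where \<iota>: "inj_on \<iota> (car c0)" using universe unfolding lepoll_def by blast
  interpret transport c0 \<iota>
    using banach_lattice_on_c0 \<iota> by (simp add: transport_def transport_axioms_def)
  have "P x \<in> car c0" for x
    using P unfolding positive_poly_iff positive_op_def multilinear_op_def by metis
  then have "disjoint_convergent p G (\<lambda>x. \<iota> (P x)) \<longleftrightarrow> disjoint_convergent p c0 P"
    by (rule disjoint_convergent_G)
  then show ?thesis
    using all[OF banach_lattice_on_G dual_ball_compact_G[OF c0_dual_ball_compact] positive_poly_G[OF P]] by simp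
qed

lemma disjoint_convergent_regular_c0:
  fixes P :: "'a::banach_lattice \<Rightarrow> nat \<Rightarrow> real"
  assumes all: "\<And>P :: 'a \<Rightarrow> nat \<Rightarrow> real. positive_poly k c0 P \<Longrightarrow> disjoint_convergent p c0 P"
    and P: "regular_poly k c0 P"
  shows "disjoint_convergent p c0 P"
proof -
  interpret c0: banach_lattice_on c0 by (rule banach_lattice_on_c0)
  obtain Q R where Q: "positive_poly k c0 Q" and R: "positive_poly k c0 R"
    and PQR: "\<And>x. P x = vminus c0 (Q x) (R x)" using P unfolding regular_poly_def by blast
  have cl: "Q x \<in> car c0" "R x \<in> car c0" for x
    using Q R unfolding positive_poly_iff positive_op_def multilinear_op_def by metis+
  have "(\<lambda>n. vnorm c0 (P (x n))) \<longlonglongrightarrow> 0" if x: "disjoint_sequence x \<and> weakly_summable p x" for x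
  proof -
    have "(\<lambda>n. vnorm c0 (Q (x n)) + vnorm c0 (R (x n))) \<longlonglongrightarrow> 0"
      using all[OF Q] all[OF R] x unfolding disjoint_convergent_def by (intro tendsto_add_zero) blast+
    moreover have "norm (vnorm c0 (P (x n))) \<le> vnorm c0 (Q (x n)) + vnorm c0 (R (x n))" for n
      using c0.vnorm_minus_le[OF cl] c0.vnorm_nonneg[OF c0.minus_closed[OF cl]]
      unfolding PQR real_norm_def by (metis abs_of_nonneg)
    ultimately show ?thesis by (rule Lim_null_comparison[OF always_eventually[OF allI], rotated])
  qed
  then show ?thesis unfolding disjoint_convergent_def by blast
qed

lemma positive_imp_regular_c0:
  assumes "positive_poly k c0 P" shows "regular_poly k c0 P"
proof -
  have "positive_poly k c0 (\<lambda>_. \<lambda>_. 0)"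
    unfolding positive_poly_iff
    by (intro exI[of _ "\<lambda>_ _. 0"]) (simp add: positive_op_def multilinear_op_def symmetric_op_def)
  then show ?thesis using assms unfolding regular_poly_def
    by (intro exI[of _ P] exI[of _ "\<lambda>_ _. 0"]) simp
qed

text \<open>A weakly* null sequence of positive forms is the coordinate sequence of a positive polynomial into \<open>c0\<close>.\<close>

lemma positive_weak_star_null_forms_tendsto:
  fixes x :: "nat \<Rightarrow> 'a::banach_lattice"
  assumes k: "1 \<le> k" and all: "\<And>P :: 'a \<Rightarrow> nat \<Rightarrow> real. positive_poly k c0 P \<Longrightarrow> disjoint_convergent p c0 P"
    and x: "disjoint_sequence x" "weakly_summable p x"
    and P: "positive_seq (regular_polys k) P" "weak_star_null_polys k P"
  shows "(\<lambda>n. P n (x n)) \<longlonglongrightarrow> 0"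
proof -
  have "\<exists>T. positive_op k scalars T \<and> symmetric_op k T \<and> (\<forall>x. P n x = T (\<lambda>_. x))" for n
    using P(1) by (simp add: positive_seq_def positive_poly_iff)
  then obtain T where T: "\<And>n. positive_op k scalars (T n)" "\<And>n. symmetric_op k (T n)"
      and PT: "\<And>n x. P n x = T n (\<lambda>_. x)" by metis
  have M: "multilinear_op k scalars (T n)" for n using T(1) by (simp add: positive_op_def)
  have null: "(\<lambda>n. T n y) \<longlonglongrightarrow> 0" for y
    by (rule polarization_tendsto[OF M T(2)])
      (use weak_star_null_polys_pointwise[OF k P(2)] in \<open>simp add: PT\<close>)
  have "positive_poly k c0 (\<lambda>x n. P n x)"
    unfolding positive_poly_iff
  proof (intro exI[of _ "\<lambda>y n. T n y"] conjI allI)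
    show "positive_op k c0 (\<lambda>y n. T n y)"
      unfolding positive_op_def multilinear_op_def
    proof (intro conjI allI impI)
      show "(\<lambda>n. T n y) \<in> car c0" for y using null by simp
      show "(\<lambda>n. T n y) = (\<lambda>n. T n z)" if "\<forall>i<k. y i = z i" for y z
        using that by (intro ext multilinear_op_cong[OF M]) simp
      show "vle c0 (vzero c0) (\<lambda>n. T n y)" if "\<forall>i<k. 0 \<le> y i" for y
        using T(1) that by (simp add: positive_op_def)
      fix y a b r and i :: nat assume "i < k"
      from multilinear_op_add[OF M this] multilinear_op_scale[OF M this]
      show "(\<lambda>n. T n (y(i := a + b))) = vadd c0 (\<lambda>n. T n (y(i := a))) (\<lambda>n. T n (y(i := b)))"
        "(\<lambda>n. T n (y(i := r *\<^sub>R a))) = vscale c0 r (\<lambda>n. T n (y(i := a)))"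
        by simp_all
    qed
    show "symmetric_op k (\<lambda>y n. T n y)" using T(2) by (simp add: symmetric_op_def)
  qed (simp add: PT)
  then have norm: "(\<lambda>n. vnorm c0 (\<lambda>m. P m (x n))) \<longlonglongrightarrow> 0"
    using all x unfolding disjoint_convergent_def by blast
  have "\<bar>P n (x n)\<bar> \<le> vnorm c0 (\<lambda>m. P m (x n))" for n
    using c0_abs_le_norm[of "\<lambda>m. P m (x n)" n] null by (simp only: PT)
  then show ?thesis by (intro Lim_null_comparison[OF always_eventually norm] allI) (simp only: real_norm_def)
qed

lemma all_equivalent_if_implications:
  assumes "a \<Longrightarrow> b" "b \<Longrightarrow> c" "c \<Longrightarrow> d" "d \<Longrightarrow> c" "c \<Longrightarrow> h" "h \<Longrightarrow> g" "g \<Longrightarrow> a"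
    and "a \<Longrightarrow> e" "e \<Longrightarrow> f" "f \<Longrightarrow> g"
  shows "all_equivalent [a, b, c, d, e, f, g, h]"
proof -
  have "b = a" "c = a" "d = a" "e = a" "f = a" "g = a" "h = a" using assms by metis+
  then show ?thesis by (simp add: all_equivalent_def)
qed

theorem theorem4p4:
  fixes p :: real and k :: nat
  assumes "1 \<le> p" and "1 \<le> k"
    and "sigma_Dedekind_complete TYPE('a::banach_lattice)"
    and universe: "car c0 \<lesssim> (UNIV :: 'u set)"
  shows "all_equivalent [
    disjoint_DP_star TYPE('a) p,

    \<forall>F :: 'u normed_lattice. banach_lattice_on F \<and> dual_ball_seq_weak_star_compact F \<longrightarrow>
      (\<forall>P :: 'a \<Rightarrow> 'u. positive_poly k F P \<longrightarrow> disjoint_convergent p F P),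

    \<forall>P :: 'a \<Rightarrow> nat \<Rightarrow> real. positive_poly k c0 P \<longrightarrow> disjoint_convergent p c0 P,

    \<forall>P :: 'a \<Rightarrow> nat \<Rightarrow> real. regular_poly k c0 P \<longrightarrow> disjoint_convergent p c0 P,

    \<forall>(x :: nat \<Rightarrow> 'a) P. disjoint_sequence x \<and> weakly_summable p x \<and>
      weak_star_null_polys k P \<longrightarrow> (\<lambda>n. P n (x n)) \<longlonglongrightarrow> 0,

    \<forall>(x :: nat \<Rightarrow> 'a) P. disjoint_sequence x \<and> weakly_summable p x \<and>
      disjoint_seq (regular_polys k) P \<and>
      weak_star_null_polys k P \<longrightarrow> (\<lambda>n. P n (x n)) \<longlonglongrightarrow> 0,

    \<forall>(x :: nat \<Rightarrow> 'a) P. disjoint_sequence x \<and> weakly_summable p x \<and>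
      positive_seq (regular_polys k) P \<and> disjoint_seq (regular_polys k) P \<and>
      weak_star_null_polys k P \<longrightarrow> (\<lambda>n. P n (x n)) \<longlonglongrightarrow> 0,

    \<forall>(x :: nat \<Rightarrow> 'a) P. disjoint_sequence x \<and> weakly_summable p x \<and>
      positive_seq (regular_polys k) P \<and>
      weak_star_null_polys k P \<longrightarrow> (\<lambda>n. P n (x n)) \<longlonglongrightarrow> 0]"
    (is "all_equivalent [?a, ?b, ?c, ?d, ?e, ?f, ?g, ?h]")
proof (rule all_equivalent_if_implications)
  have p: "0 < p" using \<open>1 \<le> p\<close> by simp
  show ?b if ?a
    using banach_lattice_on.DP_star_imp_disjoint_convergent[OF _ that p \<open>1 \<le> k\<close>] by blast
  show ?e if ?a
    using DP_star_imp_weak_star_null_forms[OF that p \<open>1 \<le> k\<close>] by blast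
  show ?c if ?b
    using disjoint_convergent_c0_if_embedded[OF universe] that by blast
  show ?d if ?c
    using disjoint_convergent_regular_c0[of k p] that by blast
  show ?h if ?c
    using positive_weak_star_null_forms_tendsto[OF \<open>1 \<le> k\<close>, of p] that by blast
  show ?c if ?d
    using positive_imp_regular_c0 that by blast
  show ?g if ?h
    using that by blast
  show ?a if ?g
    using disjoint_DP_star_if_positive_disjoint_forms[OF assms(3) \<open>1 \<le> k\<close>, of p] that by blast
  show ?f if ?e
    using that by blast
  show ?g if ?f
    using that by blast
qed

end
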